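(* Let $n\ge 3$ and let $K\subset\mathbb{R}^n$ be a convex body whose centroid is at the origin. Let $\mu$ be the cone-volume measure of $K$ and set $V:=\mu(\mathbb{S}^{n-1})=V(K)$, the volume of $K$. Then for every $u\in\mathbb{S}^{n-1}$, $$ n\,\frac{\mu(u)+\mu(-u)}{V}+(n+1)^{n-1}\left|\frac{\mu(u)-\mu(-u)}{V}\right|^{n}\le 1 . $$ Moreover, if equality holds for some $u\in\mathbb{S}^{n-1}$, then there exist an affine hyperplane $H\subset\mathbb{R}^n$ perpendicular to $u$ and an $(n-1)$-dimensional convex body $P\subset H$ such that $K$ is - either an oblique prism $K=\operatorname{conv}\big(P\cup(P+\vec{l}\,)\big)$ for some translation vector $\vec{l}\in\mathbb{R}^n$ not parallel to $H$ (that is, $\vec{l}\cdot u\neq 0$), - or a cone $K=\operatorname{conv}\big(P\cup\{p\}\big)$ for some point $p\in\mathbb{R}^n$ with $p\notin H$.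
   Context: A convex body in $\mathbb{R}^n$ is a compact convex set with nonempty interior. Its centroid is $c(K)=\frac{1}{V(K)}\int_K x\,dx$. An $(n-1)$-dimensional convex body in a hyperplane $H$ is a compact convex subset of $H$ with nonempty interior relative to $H$. $\operatorname{conv}(A)$ denotes the convex hull of $A$. Let $\nu_K$ be the outer unit normal (Gauss) map of $K$, defined $\mathcal{H}^{n-1}$-almost everywhere on $\partial K$ (where the outer unit normal is unique). For a convex body $K$ containing the origin in its interior, the cone-volume measure of $K$ is the Borel measure on $\mathbb{S}^{n-1}$ given by $$\mu(E)=\frac1n\int_{\nu_K^{-1}(E)} x\cdot\nu_K(x)\,d\mathcal{H}^{n-1}(x),$$ so $\mu(\mathbb{S}^{n-1})=V(K)$. For $u\in\mathbb{S}^{n-1}$ we write $\mu(u):=\mu(\{u\})$; this equals the volume of the convex hull of the origin and the face $\{y\in K: y\cdot u=\max_{x\in K}x\cdot u\}$. *)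

theory Defs
  imports "HOL-Analysis.Analysis"
begin

text \<open>
  The normalisation makes the \<open>k\<close>-dimensional Hausdorff measure agree with
  \<open>k\<close>-dimensional Lebesgue measure on \<open>k\<close>-dimensional affine subspaces. The empty set is
  treated separately because \<open>0 ^ 0 = 1\<close>.
\<close>

definition hausdorff_weight :: "nat \<Rightarrow> 'a::metric_space set \<Rightarrow> ennreal" where
  "hausdorff_weight k C =
     (if C = {} then 0 else ennreal (unit_ball_vol (real k) * (diameter C / 2) ^ k))"

text \<open>
  Boundedness of the covering sets is required explicitly, since \<^const>\<open>diameter\<close> is
  meaningful only for bounded sets.
\<close>

definition hausdorff_premeasure :: "nat \<Rightarrow> real \<Rightarrow> 'a::metric_space set \<Rightarrow> ennreal" where
  "hausdorff_premeasure k \<delta> A =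
     (INF C \<in> {C :: nat \<Rightarrow> 'a set. (\<forall>i. bounded (C i) \<and> diameter (C i) \<le> \<delta>) \<and> A \<subseteq> (\<Union>i. C i)}.
        \<Sum>i. hausdorff_weight k (C i))"

definition hausdorff_outer_measure :: "nat \<Rightarrow> 'a::metric_space set \<Rightarrow> ennreal" where
  "hausdorff_outer_measure k A = (SUP \<delta> \<in> {0<..}. hausdorff_premeasure k \<delta> A)"

definition hausdorff_measure :: "nat \<Rightarrow> 'a::metric_space measure" where
  "hausdorff_measure k =
     measure_of UNIV (lambda_system UNIV UNIV (hausdorff_outer_measure k))
       (hausdorff_outer_measure k)"

text \<open>
  \<^const>\<open>measure_of\<close> returns the zero measure if its arguments do not form a measure space.
  The following facts show that this does not happen here, and that all Borel sets are
  measurable.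
\<close>

lemma hausdorff_premeasure_mono:
  "A \<subseteq> B \<Longrightarrow> hausdorff_premeasure k \<delta> A \<le> hausdorff_premeasure k \<delta> B"
  unfolding hausdorff_premeasure_def by (rule INF_superset_mono) auto

lemma hausdorff_premeasure_antimono:
  "\<delta> \<le> \<epsilon> \<Longrightarrow> hausdorff_premeasure k \<epsilon> A \<le> hausdorff_premeasure k \<delta> A"
  unfolding hausdorff_premeasure_def by (rule INF_superset_mono) (auto intro: order_trans)

lemma hausdorff_premeasure_empty: "\<delta> > 0 \<Longrightarrow> hausdorff_premeasure k \<delta> {} = 0"
  unfolding hausdorff_premeasure_def
  by (intro antisym INF_lower2[of "\<lambda>_. {}"]) (auto simp: hausdorff_weight_def)

lemma hausdorff_premeasure_countable_subadditive:
  "hausdorff_premeasure k \<delta> (\<Union>i. A i) \<le> (\<Sum>n. hausdorff_premeasure k \<delta> (A n))"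
proof (rule ennreal_le_epsilon)
  let ?O = "hausdorff_premeasure k \<delta>"
  fix e :: real assume "0 < e" and fin: "(\<Sum>n. ?O (A n)) < top"
  then have *: "?O (A n) < ?O (A n) + e * (1/2) ^ Suc n" for n
    by (auto simp add: less_top dest!: ennreal_suminf_lessD)
  have "\<exists>B. (\<forall>i. bounded (B i) \<and> diameter (B i) \<le> \<delta>) \<and> A n \<subseteq> (\<Union>i. B i) \<and>
          (\<Sum>i. hausdorff_weight k (B i)) \<le> ?O (A n) + e * (1/2) ^ Suc n" for n
    using *[of n] unfolding hausdorff_premeasure_def INF_less_iff mem_Collect_eq
    by (blast intro: less_imp_le)
  then have "\<forall>n. \<exists>B. (\<forall>i. bounded (B i) \<and> diameter (B i) \<le> \<delta>) \<and> A n \<subseteq> (\<Union>i. B i) \<and>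
          (\<Sum>i. hausdorff_weight k (B i)) \<le> ?O (A n) + e * (1/2) ^ Suc n"
    by blast
  from choice[OF this] obtain B where B: "\<And>n i. bounded (B n i)" "\<And>n i. diameter (B n i) \<le> \<delta>"
      "\<And>n. A n \<subseteq> (\<Union>i. B n i)"
      and Ble: "\<And>n. (\<Sum>i. hausdorff_weight k (B n i)) \<le> ?O (A n) + e * (1/2) ^ Suc n"
    by blast
  define C where "C = case_prod B \<circ> prod_decode"
  have sub: "(\<Union>i. A i) \<subseteq> (\<Union>i. C i)"
  proof
    fix x assume "x \<in> (\<Union>i. A i)"
    then obtain n i where "x \<in> B n i"
      using B(3) by blast
    then have "x \<in> C (prod_encode (n, i))"
      by (simp add: C_def)
    then show "x \<in> (\<Union>i. C i)" by blast
  qed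
  have C_bounded: "bounded (C i) \<and> diameter (C i) \<le> \<delta>" for i
    using B(1,2) by (simp add: C_def split_def)
  have "?O (\<Union>i. A i) \<le> (\<Sum>i. hausdorff_weight k (C i))"
    unfolding hausdorff_premeasure_def
    by (rule INF_lower) (simp add: sub C_bounded)
  also have "\<dots> = (\<Sum>n. \<Sum>i. hausdorff_weight k (B n i))"
    unfolding C_def comp_def
    by (subst suminf_ennreal_2dimen[where f = "\<lambda>p. hausdorff_weight k (case_prod B p)", symmetric])
      auto
  also have "\<dots> \<le> (\<Sum>n. ?O (A n) + e * (1/2) ^ Suc n)"
    by (intro suminf_le Ble) auto
  also have "\<dots> = (\<Sum>n. ?O (A n)) + (\<Sum>n. ennreal e * ennreal ((1/2) ^ Suc n))"
    using \<open>0 < e\<close> by (subst suminf_add[symmetric])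
      (auto simp del: ennreal_suminf_cmult simp add: ennreal_mult[symmetric])
  also have "\<dots> = (\<Sum>n. ?O (A n)) + e"
    unfolding ennreal_suminf_cmult
    by (subst suminf_ennreal_eq[OF zero_le_power power_half_series]) auto
  finally show "?O (\<Union>i. A i) \<le> (\<Sum>n. ?O (A n)) + e" .
qed

lemma hausdorff_outer_measure_mono:
  "A \<subseteq> B \<Longrightarrow> hausdorff_outer_measure k A \<le> hausdorff_outer_measure k B"
  unfolding hausdorff_outer_measure_def by (intro SUP_mono) (auto intro: hausdorff_premeasure_mono)

lemma hausdorff_premeasure_le_outer:
  "\<delta> > 0 \<Longrightarrow> hausdorff_premeasure k \<delta> A \<le> hausdorff_outer_measure k A"
  unfolding hausdorff_outer_measure_def by (rule SUP_upper) auto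

lemma hausdorff_outer_measure_empty [simp]: "hausdorff_outer_measure k {} = 0"
proof -
  have "hausdorff_outer_measure k {} \<le> 0"
    unfolding hausdorff_outer_measure_def
    by (rule SUP_least) (simp add: hausdorff_premeasure_empty)
  then show ?thesis by simp
qed

lemma hausdorff_outer_measure_countable_subadditive:
  "hausdorff_outer_measure k (\<Union>i. A i) \<le> (\<Sum>n. hausdorff_outer_measure k (A n))"
proof -
  have "hausdorff_premeasure k \<delta> (\<Union>i. A i) \<le> (\<Sum>n. hausdorff_outer_measure k (A n))"
    if "\<delta> > 0" for \<delta>
    using hausdorff_premeasure_countable_subadditive
    by (rule order_trans) (intro suminf_le hausdorff_premeasure_le_outer that; simp)
  then show ?thesis
    by (subst hausdorff_outer_measure_def) (auto intro: SUP_least)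
qed

lemma hausdorff_outer_measure_Un:
  "hausdorff_outer_measure k (A \<union> B) \<le> hausdorff_outer_measure k A + hausdorff_outer_measure k B"
proof -
  let ?C = "\<lambda>i::nat. if i = 0 then A else if i = 1 then B else {}"
  have "A \<union> B = (\<Union>i. ?C i)"
    by (auto split: if_splits)
  then have "hausdorff_outer_measure k (A \<union> B) \<le> (\<Sum>n. hausdorff_outer_measure k (?C n))"
    by (simp only: hausdorff_outer_measure_countable_subadditive)
  also have "\<dots> = (\<Sum>n\<in>{0,1}. hausdorff_outer_measure k (?C n))"
    by (rule suminf_finite) auto
  finally show ?thesis by simp
qed

lemma outer_measure_space_hausdorff:
  "outer_measure_space UNIV (hausdorff_outer_measure k)"
  by (auto simp: outer_measure_space_def positive_def increasing_def countably_subadditive_def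
      intro: hausdorff_outer_measure_mono hausdorff_outer_measure_countable_subadditive)

lemma measure_space_hausdorff:
  "measure_space UNIV (lambda_system UNIV UNIV (hausdorff_outer_measure k))
     (hausdorff_outer_measure k)"
  using sigma_algebra.caratheodory_lemma[OF sigma_algebra_Pow, of UNIV "hausdorff_outer_measure k"]
    outer_measure_space_hausdorff[of k]
  by simp

lemma space_hausdorff_measure [simp]: "space (hausdorff_measure k) = UNIV"
  by (simp add: hausdorff_measure_def)

lemma sets_hausdorff_measure:
  "sets (hausdorff_measure k :: 'a::metric_space measure) =
    lambda_system UNIV UNIV (hausdorff_outer_measure k)"
proof -
  have "sigma_algebra UNIV (lambda_system UNIV UNIV (hausdorff_outer_measure k :: 'a set \<Rightarrow> ennreal))"
    by (rule measure_space_hausdorff[unfolded measure_space_def, THEN conjunct1])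
  then show ?thesis
    unfolding hausdorff_measure_def by (rule sigma_algebra.sets_measure_of_eq)
qed

lemma emeasure_hausdorff_measure:
  assumes "A \<in> sets (hausdorff_measure k)"
  shows "emeasure (hausdorff_measure k) A = hausdorff_outer_measure k A"
  using assms measure_space_hausdorff[of k]
  unfolding sets_hausdorff_measure
  by (subst hausdorff_measure_def, subst emeasure_measure_of_sigma) (auto simp: measure_space_def)

lemma hausdorff_outer_measure_metric:
  assumes "d > 0" and sep: "\<And>x y. x \<in> A \<Longrightarrow> y \<in> B \<Longrightarrow> d \<le> dist x y"
  shows "hausdorff_outer_measure k A + hausdorff_outer_measure k B
    \<le> hausdorff_outer_measure k (A \<union> B)"
proof -
  have pre: "hausdorff_premeasure k \<delta> A + hausdorff_premeasure k \<delta> B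
      \<le> hausdorff_premeasure k \<delta> (A \<union> B)" if "\<delta> < d" "\<delta> > 0" for \<delta>
    unfolding hausdorff_premeasure_def[of k \<delta> "A \<union> B"]
  proof (rule INF_greatest, clarify)
    fix C :: "nat \<Rightarrow> 'a set"
    assume C: "\<forall>i. bounded (C i) \<and> diameter (C i) \<le> \<delta>" "A \<union> B \<subseteq> (\<Union>i. C i)"
    define CA where "CA i = (if C i \<inter> A = {} then {} else C i)" for i
    define CB where "CB i = (if C i \<inter> B = {} then {} else C i)" for i
    have *: "hausdorff_weight k (CA i) + hausdorff_weight k (CB i) \<le> hausdorff_weight k (C i)" for i
    proof -
      have "C i \<inter> A = {} \<or> C i \<inter> B = {}"
      proof (rule ccontr)
        assume "\<not> ?thesis"
        then obtain x y where xy: "x \<in> C i" "x \<in> A" "y \<in> C i" "y \<in> B" by blast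
        then have "dist x y \<le> \<delta>"
          using diameter_bounded_bound[of "C i" x y] C(1) by (meson order_trans)
        with sep[OF xy(2,4)] that show False by simp
      qed
      then show ?thesis by (auto simp: CA_def CB_def hausdorff_weight_def)
    qed
    have "hausdorff_premeasure k \<delta> A \<le> (\<Sum>i. hausdorff_weight k (CA i))"
      unfolding hausdorff_premeasure_def
      by (rule INF_lower) (use C that in \<open>fastforce simp: CA_def\<close>)
    moreover have "hausdorff_premeasure k \<delta> B \<le> (\<Sum>i. hausdorff_weight k (CB i))"
      unfolding hausdorff_premeasure_def
      by (rule INF_lower) (use C that in \<open>fastforce simp: CB_def\<close>)
    ultimately have "hausdorff_premeasure k \<delta> A + hausdorff_premeasure k \<delta> B
        \<le> (\<Sum>i. hausdorff_weight k (CA i)) + (\<Sum>i. hausdorff_weight k (CB i))"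
      by (rule add_mono)
    also have "\<dots> = (\<Sum>i. hausdorff_weight k (CA i) + hausdorff_weight k (CB i))"
      by (rule suminf_add) auto
    also have "\<dots> \<le> (\<Sum>i. hausdorff_weight k (C i))"
      by (intro suminf_le *) auto
    finally show "hausdorff_premeasure k \<delta> A + hausdorff_premeasure k \<delta> B
      \<le> (\<Sum>i. hausdorff_weight k (C i))" .
  qed
  have "hausdorff_outer_measure k A + hausdorff_outer_measure k B =
      (SUP \<delta>\<in>{0<..}. hausdorff_premeasure k \<delta> A + hausdorff_premeasure k \<delta> B)"
    unfolding hausdorff_outer_measure_def
  proof (rule SUP_add_directed_ennreal[symmetric])
    fix i j :: real assume "i \<in> {0<..}" "j \<in> {0<..}"
    then show "\<exists>l\<in>{0<..}. hausdorff_premeasure k i A + hausdorff_premeasure k j B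
        \<le> hausdorff_premeasure k l A + hausdorff_premeasure k l B"
      by (intro bexI[of _ "min i j"] add_mono hausdorff_premeasure_antimono) auto
  qed
  also have "\<dots> \<le> hausdorff_outer_measure k (A \<union> B)"
  proof (rule SUP_least)
    fix \<delta> :: real assume \<delta>: "\<delta> \<in> {0<..}"
    let ?m = "min \<delta> (d / 2)"
    have m: "?m < d" "?m > 0" using \<delta> \<open>d > 0\<close> by auto
    have "hausdorff_premeasure k \<delta> A + hausdorff_premeasure k \<delta> B
        \<le> hausdorff_premeasure k ?m A + hausdorff_premeasure k ?m B"
      by (intro add_mono hausdorff_premeasure_antimono) auto
    also have "\<dots> \<le> hausdorff_premeasure k ?m (A \<union> B)" by (rule pre[OF m])
    also have "\<dots> \<le> hausdorff_outer_measure k (A \<union> B)"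
      by (rule hausdorff_premeasure_le_outer[OF m(2)])
    finally show "hausdorff_premeasure k \<delta> A + hausdorff_premeasure k \<delta> B
      \<le> hausdorff_outer_measure k (A \<union> B)" .
  qed
  finally show ?thesis .
qed

lemma closed_in_sets_hausdorff_measure:
  assumes "closed S"
  shows "S \<in> sets (hausdorff_measure k)"
proof (cases "S = {}")
  case False
  let ?O = "hausdorff_outer_measure k"
  have le: "?O (X \<inter> S) + ?O (X - S) \<le> ?O X" for X
  proof (cases "?O X = top")
    case fin: False
    define D where "D n = {x \<in> X. 1 / (real n + 1) \<le> infdist x S}" for n
    define R where "R n = {x \<in> X. 1 / (real n + 2) \<le> infdist x S \<and> infdist x S < 1 / (real n + 1)}" for n
    have sepD: "?O (X \<inter> S) + ?O (D n) \<le> ?O X" for n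
    proof -
      have "?O (X \<inter> S) + ?O (D n) \<le> ?O (X \<inter> S \<union> D n)"
      proof (rule hausdorff_outer_measure_metric)
        fix x y assume "x \<in> X \<inter> S" "y \<in> D n"
        then show "1 / (real n + 1) \<le> dist x y"
          using infdist_le[of x S y] by (auto simp: D_def dist_commute)
      qed auto
      also have "\<dots> \<le> ?O X"
        by (rule hausdorff_outer_measure_mono) (auto simp: D_def)
      finally show ?thesis .
    qed
    have alt: "(\<Sum>i<N. ?O (R (2 * i + c))) \<le> ?O (\<Union>i<N. R (2 * i + c))" for N c
    proof (induction N)
      case (Suc N)
      have "(\<Sum>i<Suc N. ?O (R (2 * i + c))) \<le>
          ?O (\<Union>i<N. R (2 * i + c)) + ?O (R (2 * N + c))"
        using Suc by (simp add: add_right_mono)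
      also have "\<dots> \<le> ?O ((\<Union>i<N. R (2 * i + c)) \<union> R (2 * N + c))"
      proof (cases "N = 0")
        case False
        let ?a = "1 / (real (2 * N + c))" and ?b = "1 / (real (2 * N + c) + 1)"
        show ?thesis
        proof (rule hausdorff_outer_measure_metric[of "?a - ?b"])
          have "?b < ?a" using False by (intro divide_strict_left_mono) auto
          then show "0 < ?a - ?b" by simp
        next
          fix x y assume x: "x \<in> (\<Union>i<N. R (2 * i + c))" and y: "y \<in> R (2 * N + c)"
          then obtain i where "i < N" "1 / (real (2 * i + c) + 2) \<le> infdist x S"
            by (auto simp: R_def)
          moreover have "?a \<le> 1 / (real (2 * i + c) + 2)"
            using \<open>i < N\<close> by (intro frac_le) auto
          moreover have "infdist y S < ?b" using y by (auto simp: R_def)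
          ultimately show "?a - ?b \<le> dist x y"
            using infdist_triangle[of x S y] by linarith
        qed
      qed auto
      also have "(\<Union>i<N. R (2 * i + c)) \<union> R (2 * N + c) = (\<Union>i<Suc N. R (2 * i + c))"
        by (auto simp: lessThan_Suc)
      finally show ?case .
    qed auto
    have alt': "(\<Sum>i<N. ?O (R (2 * i + c))) \<le> ?O X" for N c
      using alt by (rule order_trans) (auto intro!: hausdorff_outer_measure_mono simp: R_def)
    have split: "(\<Sum>j<2 * N. ?O (R j)) = (\<Sum>i<N. ?O (R (2 * i + 0))) + (\<Sum>i<N. ?O (R (2 * i + 1)))"
      for N by (induction N) (auto simp: algebra_simps)
    have bnd: "(\<Sum>j<N. ?O (R j)) \<le> ?O X + ?O X" for N
    proof -
      have "(\<Sum>j<N. ?O (R j)) \<le> (\<Sum>j<2 * N. ?O (R j))"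
        by (rule sum_mono2) auto
      also have "\<dots> \<le> ?O X + ?O X"
        unfolding split by (intro add_mono alt')
      finally show ?thesis .
    qed
    have "(\<Sum>j. ?O (R j)) \<le> ?O X + ?O X"
      by (intro suminf_le_const[OF summableI] bnd)
    then have fin_sum: "(\<Sum>j. ?O (R j)) \<noteq> top"
      using fin by (metis ennreal_add_eq_top top_unique)
    have tail: "(\<lambda>n. \<Sum>j. ?O (R (j + n))) \<longlonglongrightarrow> 0"
    proof -
      define r where "r j = enn2real (?O (R j))" for j
      have r: "?O (R j) = ennreal (r j)" for j
        using fin hausdorff_outer_measure_mono[of "R j" X k]
        by (auto simp: r_def R_def less_top top_unique)
      have r0: "r j \<ge> 0" for j by (simp add: r_def)
      have sm: "summable r"
        using fin_sum r0 unfolding r by (intro summable_suminf_not_top)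
      have "(\<lambda>n. \<Sum>j. r (j + n)) \<longlonglongrightarrow> 0"
        by (rule suminf_exist_split2[OF sm])
      moreover have "(\<Sum>j. ?O (R (j + n))) = ennreal (\<Sum>j. r (j + n))" for n
        unfolding r by (rule suminf_ennreal2) (use r0 sm summable_iff_shift in auto)
      ultimately show ?thesis
        using tendsto_ennrealI[of "\<lambda>n. \<Sum>j. r (j + n)" 0 sequentially] by simp
    qed
    have main: "?O (X \<inter> S) + ?O (X - S) \<le> ?O X + (\<Sum>j. ?O (R (j + n)))" for n
    proof -
      have "X - S \<subseteq> D n \<union> (\<Union>j. R (j + n))"
      proof
        fix x assume x: "x \<in> X - S"
        then have pos: "infdist x S > 0"
          using assms False by (metis DiffD2 in_closed_iff_infdist_zero infdist_nonneg less_eq_real_def)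
        show "x \<in> D n \<union> (\<Union>j. R (j + n))"
        proof (cases "x \<in> D n")
          case nD: False
          define m where "m = (LEAST m. 1 / (real m + 1) \<le> infdist x S)"
          obtain m0 where "inverse (real (Suc m0)) < infdist x S"
            using reals_Archimedean[OF pos] by blast
          then have ex: "1 / (real m0 + 1) \<le> infdist x S"
            by (simp add: inverse_eq_divide add.commute)
          then have m: "1 / (real m + 1) \<le> infdist x S"
            unfolding m_def by (rule LeastI)
          have "n < m"
          proof (rule ccontr)
            assume "\<not> n < m"
            then have "1 / (real n + 1) \<le> 1 / (real m + 1)" by (intro divide_left_mono) auto
            with m nD x show False by (auto simp: D_def)
          qed
          then obtain j where j: "m = Suc (j + n)"
            by (metis add.commute add_Suc_right less_iff_Suc_add)
          have "\<not> 1 / (real (j + n) + 1) \<le> infdist x S"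
            using not_less_Least[of "j + n" "\<lambda>m. 1 / (real m + 1) \<le> infdist x S"] j
            unfolding m_def by simp
          with m x have "x \<in> R (j + n)" by (auto simp: R_def j algebra_simps)
          then show ?thesis by blast
        qed simp
      qed
      then have "?O (X - S) \<le> ?O (D n \<union> (\<Union>j. R (j + n)))"
        by (rule hausdorff_outer_measure_mono)
      also have "\<dots> \<le> ?O (D n) + ?O (\<Union>j. R (j + n))"
        by (rule hausdorff_outer_measure_Un)
      also have "\<dots> \<le> ?O (D n) + (\<Sum>j. ?O (R (j + n)))"
        by (intro add_left_mono hausdorff_outer_measure_countable_subadditive)
      finally have "?O (X \<inter> S) + ?O (X - S) \<le> ?O (X \<inter> S) + (?O (D n) + (\<Sum>j. ?O (R (j + n))))"
        by (rule add_left_mono)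
      also have "\<dots> = (?O (X \<inter> S) + ?O (D n)) + (\<Sum>j. ?O (R (j + n)))"
        by (simp add: add.assoc)
      also have "\<dots> \<le> ?O X + (\<Sum>j. ?O (R (j + n)))"
        by (intro add_right_mono sepD)
      finally show ?thesis .
    qed
    have "(\<lambda>n. ?O X + (\<Sum>j. ?O (R (j + n)))) \<longlonglongrightarrow> ?O X + 0"
      by (intro tendsto_add tendsto_const tail)
    then have "?O (X \<inter> S) + ?O (X - S) \<le> ?O X + 0"
      by (rule LIMSEQ_le_const) (use main in blast)
    then show ?thesis by simp
  qed auto
  have "?O (S \<inter> X) + ?O ((UNIV - S) \<inter> X) = ?O X" for X
  proof (rule antisym)
    have "X = (X \<inter> S) \<union> (X - S)" by auto
    then show "?O X \<le> ?O (S \<inter> X) + ?O ((UNIV - S) \<inter> X)"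
      using hausdorff_outer_measure_Un[of k "X \<inter> S" "X - S"]
      by (simp add: Int_commute Diff_eq)
    show "?O (S \<inter> X) + ?O ((UNIV - S) \<inter> X) \<le> ?O X"
      using le[of X] by (simp add: Int_commute Diff_eq)
  qed
  then show ?thesis by (simp add: sets_hausdorff_measure lambda_system_def)
qed auto

lemma sets_borel_subset_hausdorff_measure: "sets borel \<subseteq> sets (hausdorff_measure k)"
proof -
  have "Collect closed \<subseteq> sets (hausdorff_measure k)"
    by (auto simp: closed_in_sets_hausdorff_measure)
  then show ?thesis
    using sets.sigma_sets_subset[of "Collect closed" "hausdorff_measure k"]
    by (simp add: borel_eq_closed)
qed


definition convex_body :: "'a::euclidean_space set \<Rightarrow> bool" where
  "convex_body K \<longleftrightarrow> compact K \<and> convex K \<and> interior K \<noteq> {}"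

definition volume :: "'a::euclidean_space set \<Rightarrow> real" where
  "volume K = measure lborel K"

definition centroid :: "'a::euclidean_space set \<Rightarrow> 'a" where
  "centroid K = (1 / volume K) *\<^sub>R set_lebesgue_integral lborel K (\<lambda>x. x)"

definition outer_unit_normals :: "'a::euclidean_space set \<Rightarrow> 'a \<Rightarrow> 'a set" where
  "outer_unit_normals K x = {u \<in> sphere 0 1. \<forall>y\<in>K. y \<bullet> u \<le> x \<bullet> u}"

definition regular_boundary :: "'a::euclidean_space set \<Rightarrow> 'a set" where
  "regular_boundary K = {x \<in> frontier K. \<exists>!u. u \<in> outer_unit_normals K x}"

text \<open>The Gauss map; its value is meaningful only on \<^term>\<open>regular_boundary K\<close>.\<close>

definition gauss_map :: "'a::euclidean_space set \<Rightarrow> 'a \<Rightarrow> 'a" where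
  "gauss_map K x = (THE u. u \<in> outer_unit_normals K x)"

text \<open>
  The push-forward under the Gauss map of the measure with density \<open>x \<bullet> \<nu>\<^sub>K(x) / n\<close> with respect
  to the \<open>(n-1)\<close>-dimensional Hausdorff measure on the regular part of the boundary, that is,
  the Borel measure on the sphere sending \<open>E\<close> to the integral of \<open>x \<bullet> \<nu>\<^sub>K(x) / n\<close> over
  the preimage of \<open>E\<close>. The density is nonnegative when \<^term>\<open>0 \<in> K\<close>, so that
  \<^const>\<open>ennreal\<close> does not truncate it.
\<close>

definition cone_volume_measure :: "'a::euclidean_space set \<Rightarrow> 'a measure" where
  "cone_volume_measure K =
     distr
       (density (restrict_space (hausdorff_measure (DIM('a) - 1)) (regular_boundary K))
         (\<lambda>x. ennreal (1 / real DIM('a) * (x \<bullet> gauss_map K x))))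
       (restrict_space borel (sphere 0 1))
       (gauss_map K)"

lemma gauss_map_normal:
  "x \<in> regular_boundary K \<Longrightarrow> u \<in> outer_unit_normals K x \<longleftrightarrow> u = gauss_map K x"
  unfolding regular_boundary_def gauss_map_def by (auto intro: theI2 the_equality)

lemma closed_outer_unit_normals: "closed {(x, u). u \<in> outer_unit_normals K x}"
proof -
  have "{(x, u). u \<in> outer_unit_normals K x} =
      {p. norm (snd p) = 1} \<inter> (\<Inter>y\<in>K. {p. y \<bullet> snd p \<le> fst p \<bullet> snd p})"
    by (auto simp: outer_unit_normals_def)
  also have "closed \<dots>"
    by (intro closed_Int closed_INT ballI closed_Collect_eq closed_Collect_le continuous_intros)
  finally show ?thesis .
qed

lemma compact_frontier_normals_in:
  assumes "compact K" "closed E"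
  shows "compact {x \<in> frontier K. \<exists>u\<in>E. u \<in> outer_unit_normals K x}"
proof -
  have "compact (frontier K \<times> sphere (0::'a) 1)"
    using assms by (intro compact_Times compact_frontier) auto
  then have "compact (frontier K \<times> sphere (0::'a) 1 \<inter> ({(x, u). u \<in> outer_unit_normals K x} \<inter> UNIV \<times> E))"
    using assms by (intro compact_Int_closed closed_Int closed_outer_unit_normals closed_Times) auto
  then have "compact (fst ` (frontier K \<times> sphere (0::'a) 1 \<inter> ({(x, u). u \<in> outer_unit_normals K x} \<inter> UNIV \<times> E)))"
    by (intro compact_continuous_image continuous_intros)
  also have "fst ` (frontier K \<times> sphere (0::'a) 1 \<inter> ({(x, u). u \<in> outer_unit_normals K x} \<inter> UNIV \<times> E)) =
      {x \<in> frontier K. \<exists>u\<in>E. u \<in> outer_unit_normals K x}"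
    by (force simp: outer_unit_normals_def)
  finally show ?thesis .
qed

lemma regular_boundary_borel:
  assumes "convex_body K"
  shows "regular_boundary K \<in> sets borel"
proof -
  have K: "compact K" using assms by (simp add: convex_body_def)
  let ?N = "{(x, u). u \<in> outer_unit_normals K x}"
  define T where "T n = (frontier K \<times> sphere (0::'a) 1 \<times> sphere (0::'a) 1) \<inter>
      {p. (fst p, fst (snd p)) \<in> ?N \<and> (fst p, snd (snd p)) \<in> ?N \<and>
        inverse (real (Suc n)) \<le> dist (fst (snd p)) (snd (snd p))}" for n
  have "compact (fst ` T n)" for n
  proof (rule compact_continuous_image)
    have 1: "closed ((\<lambda>p::'a \<times> 'a \<times> 'a. (fst p, fst (snd p))) -` ?N)"
      by (intro closed_vimage closed_outer_unit_normals continuous_intros)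
    have 2: "closed ((\<lambda>p::'a \<times> 'a \<times> 'a. (fst p, snd (snd p))) -` ?N)"
      by (intro closed_vimage closed_outer_unit_normals continuous_intros)
    have 3: "closed {p::'a \<times> 'a \<times> 'a. inverse (real (Suc n)) \<le> dist (fst (snd p)) (snd (snd p))}"
      by (intro closed_Collect_le continuous_intros)
    have "closed {p. (fst p, fst (snd p)) \<in> ?N \<and> (fst p, snd (snd p)) \<in> ?N \<and>
        inverse (real (Suc n)) \<le> dist (fst (snd p)) (snd (snd p))}"
      using closed_Int[OF 1 closed_Int[OF 2 3]] by (simp add: vimage_def Collect_conj_eq)
    then show "compact (T n)"
      unfolding T_def using K by (intro compact_Int_closed compact_Times compact_frontier) auto
  qed (intro continuous_intros)
  then have T: "fst ` T n \<in> sets borel" for n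
    by (intro borel_closed compact_imp_closed)
  have E: "{x \<in> frontier K. \<exists>u\<in>UNIV. u \<in> outer_unit_normals K x} \<in> sets borel"
    by (rule borel_closed[OF compact_imp_closed[OF compact_frontier_normals_in[OF K closed_UNIV]]])
  have "regular_boundary K =
      {x \<in> frontier K. \<exists>u\<in>UNIV. u \<in> outer_unit_normals K x} - (\<Union>n. fst ` T n)"
  proof (intro equalityI subsetI)
    fix x assume x: "x \<in> regular_boundary K"
    have "x \<notin> fst ` T n" for n
    proof
      assume "x \<in> fst ` T n"
      then obtain u v where "u \<in> outer_unit_normals K x" "v \<in> outer_unit_normals K x"
          "inverse (real (Suc n)) \<le> dist u v"
        by (auto simp: T_def)
      moreover from this have "u = v" using x by (auto simp: regular_boundary_def)
      moreover have "0 < inverse (real (Suc n))" by simp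
      ultimately show False by simp
    qed
    with x show "x \<in> {x \<in> frontier K. \<exists>u\<in>UNIV. u \<in> outer_unit_normals K x} - (\<Union>n. fst ` T n)"
      by (auto simp: regular_boundary_def)
  next
    fix x assume x: "x \<in> {x \<in> frontier K. \<exists>u\<in>UNIV. u \<in> outer_unit_normals K x} - (\<Union>n. fst ` T n)"
    have "u = v" if uv: "u \<in> outer_unit_normals K x" "v \<in> outer_unit_normals K x" for u v
    proof (rule ccontr)
      assume "u \<noteq> v"
      then obtain n where "inverse (real (Suc n)) < dist u v"
        using reals_Archimedean[of "dist u v"] by auto
      then have "(x, u, v) \<in> T n"
        using x uv by (auto simp: T_def outer_unit_normals_def)
      then have "x \<in> fst ` T n" by force
      with x show False by blast
    qed
    with x show "x \<in> regular_boundary K" by (auto simp: regular_boundary_def)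
  qed
  with E T show ?thesis by auto
qed

lemma gauss_map_measurable:
  assumes "convex_body K"
  shows "gauss_map K \<in> borel_measurable (restrict_space (hausdorff_measure k) (regular_boundary K))"
  unfolding borel_eq_closed
proof (rule measurable_measure_of)
  fix E :: "'a set" assume "E \<in> Collect closed"
  then have "closed E" by simp
  have K: "compact K" using assms by (simp add: convex_body_def)
  have R: "regular_boundary K \<in> sets (hausdorff_measure k)"
    using regular_boundary_borel[OF assms] sets_borel_subset_hausdorff_measure by blast
  have "{x \<in> frontier K. \<exists>u\<in>E. u \<in> outer_unit_normals K x} \<in> sets borel"
    by (rule borel_closed[OF compact_imp_closed[OF compact_frontier_normals_in[OF K \<open>closed E\<close>]]])
  then have C: "{x \<in> frontier K. \<exists>u\<in>E. u \<in> outer_unit_normals K x} \<in> sets (hausdorff_measure k)"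
    using sets_borel_subset_hausdorff_measure by blast
  have "gauss_map K -` E \<inter> space (restrict_space (hausdorff_measure k) (regular_boundary K)) =
      regular_boundary K \<inter> {x \<in> frontier K. \<exists>u\<in>E. u \<in> outer_unit_normals K x}"
    by (auto simp: space_restrict_space gauss_map_normal) (auto simp: regular_boundary_def)
  also have "\<dots> \<in> sets (restrict_space (hausdorff_measure k) (regular_boundary K))"
    using C by (auto simp: sets_restrict_space)
  finally show "gauss_map K -` E \<inter> space (restrict_space (hausdorff_measure k) (regular_boundary K))
      \<in> sets (restrict_space (hausdorff_measure k) (regular_boundary K))" .
qed auto

lemma emeasure_cone_volume_measure:
  fixes K :: "'a::euclidean_space set"
  assumes "convex_body K" "E \<in> sets borel" "E \<subseteq> sphere 0 1"
  shows "emeasure (cone_volume_measure K) E =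
    (\<integral>\<^sup>+ x \<in> {x \<in> regular_boundary K. gauss_map K x \<in> E}.
       ennreal (1 / real DIM('a) * (x \<bullet> gauss_map K x)) \<partial>hausdorff_measure (DIM('a) - 1))"
proof -
  let ?H = "hausdorff_measure (DIM('a) - 1) :: 'a measure"
  let ?R = "restrict_space ?H (regular_boundary K)"
  let ?f = "\<lambda>x. ennreal (1 / real DIM('a) * (x \<bullet> gauss_map K x))"
  have R: "regular_boundary K \<in> sets ?H"
    using regular_boundary_borel[OF assms(1)] sets_borel_subset_hausdorff_measure by blast
  have g[measurable]: "gauss_map K \<in> borel_measurable ?R"
    by (rule gauss_map_measurable[OF assms(1)])
  have "(\<lambda>x. x) \<in> borel_measurable ?H"
    using sets_borel_subset_hausdorff_measure by (intro measurableI) auto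
  then have [measurable]: "(\<lambda>x. x) \<in> borel_measurable ?R"
    by (rule measurable_restrict_space1)
  have f: "?f \<in> borel_measurable ?R" by measurable
  have "gauss_map K x \<in> sphere 0 1" if "x \<in> regular_boundary K" for x
    using gauss_map_normal[OF that, of "gauss_map K x"] by (auto simp: outer_unit_normals_def)
  then have gs: "gauss_map K \<in> density ?R ?f \<rightarrow>\<^sub>M restrict_space borel (sphere 0 1)"
    using g by (intro measurable_restrict_space2) (auto simp: space_restrict_space)
  have E: "E \<in> sets (restrict_space borel (sphere 0 1))"
    using assms by (auto simp: sets_restrict_space_iff)
  let ?P = "{x \<in> regular_boundary K. gauss_map K x \<in> E}"
  have P: "gauss_map K -` E \<inter> space (density ?R ?f) = ?P"
    by (auto simp: space_restrict_space)
  have PR: "?P \<in> sets ?R"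
    using measurable_sets[OF gs E] unfolding P by simp
  have "emeasure (cone_volume_measure K) E = emeasure (density ?R ?f) ?P"
    unfolding cone_volume_measure_def using emeasure_distr[OF gs E] by (simp only: P)
  also have "\<dots> = (\<integral>\<^sup>+ x. ?f x * indicator ?P x \<partial>?R)"
    by (rule emeasure_density[OF f PR])
  also have "\<dots> = (\<integral>\<^sup>+ x. ?f x * indicator ?P x * indicator (regular_boundary K) x \<partial>?H)"
    using R by (intro nn_integral_restrict_space) auto
  also have "\<dots> = (\<integral>\<^sup>+ x. ?f x * indicator ?P x \<partial>?H)"
    by (intro nn_integral_cong) (auto simp: indicator_def)
  finally show ?thesis .
qed

definition hyperplane_perp :: "'a::euclidean_space \<Rightarrow> 'a set \<Rightarrow> bool" where
  "hyperplane_perp u H \<longleftrightarrow> u \<noteq> 0 \<and> (\<exists>b. H = {x. x \<bullet> u = b})"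

definition convex_body_in :: "'a::euclidean_space set \<Rightarrow> 'a set \<Rightarrow> bool" where
  "convex_body_in H P \<longleftrightarrow>
     P \<subseteq> H \<and> compact P \<and> convex P \<and> (top_of_set H) interior_of P \<noteq> {}"

end

theory Submission
  imports Defs "HOL-Probability.Weak_Convergence"
begin

text \<open>
  Fix a unit vector \<open>u\<close>, let the heights \<open>x \<bullet> u\<close> of the points of \<open>K\<close> fill \<open>[-b, a]\<close>, and let
  \<open>A(t)\<close> be the \<open>(n-1)\<close>-dimensional volume of the section of \<open>K\<close> at height \<open>t\<close>. The face of \<open>K\<close>
  with outer normal \<open>u\<close> is the section at height \<open>a\<close>, so that \<open>n \<mu>(u) = a A(a)\<close> and
  \<open>n \<mu>(-u) = b A(-b)\<close>. Only the upper bounds matter for the theorem, because the functional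
  \<open>x + y + (n+1)^(n-1) (\<bar>x-y\<bar>/n)^n\<close> of \<open>x = n \<mu>(u)/V\<close> and \<open>y = n \<mu>(-u)/V\<close> increases in each
  variable on the relevant range (\<open>slab_functional_mono\<close>). They follow from
  \<open>hausdorff_le_section_vol\<close>.

  By the Brunn-Minkowski inequality, \<open>f = A^(1/(n-1))\<close> is concave on \<open>[-b, a]\<close>, and the centroid
  condition says that \<open>f^(n-1)\<close> has mean zero. Choose an affine function \<open>g \<ge> 0\<close> for which \<open>g^(n-1)\<close>
  has the same integral \<open>V\<close> and the same mean. Then \<open>f - g\<close> is concave and \<open>f^(n-1) - g^(n-1)\<close>
  is orthogonal to all affine functions. If \<open>f\<close> were above \<open>g\<close> at an end of the interval, then
  \<open>f - g\<close> would change sign at most once, which that orthogonality forbids. Hence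
  \<open>f(a) \<le> g(a)\<close> and \<open>f(-b) \<le> g(-b)\<close>, and it is enough to treat \<open>g\<close>, that is, a frustum of a cone.

  For a frustum with ratio \<open>q\<close> between its ends both cone volumes are explicit, and the claim
  becomes \<open>E(q)^n \<le> \<phi>(q)\<close> for two rational functions \<open>E\<close> and \<open>\<phi>\<close>, with \<open>E(0) = \<phi>(0) = 1\<close>. They
  satisfy \<open>n (1-q) E' = (1+q) \<phi>'\<close>, which makes \<open>\<phi> / E^n\<close> strictly increasing on \<open>[0, 1)\<close> when
  \<open>n \<ge> 3\<close> (\<open>frustum_ineq\<close>). Equality therefore forces \<open>q = 0\<close> or \<open>q = 1\<close>, and also \<open>f = g\<close> at
  both ends.

  If equality holds, the convex hull \<open>C\<close> of two opposite faces of \<open>K\<close> (for \<open>q = 0\<close>: of one face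
  and one point) has, again by concavity, sections at least as large as those of the frustum, hence
  volume at least \<open>V\<close>, and so \<open>C = K\<close>. For \<open>q = 0\<close> this is a cone. For \<open>q = 1\<close> all sections have
  equal volume, so the two faces and the section half way between them are a case of equality in
  the Brunn-Minkowski inequality, and the faces are translates of each other
  (\<open>brunn_minkowski_equality\<close>).

  The Brunn-Minkowski inequality is obtained from the Prekopa-Leindler inequality, whose weighted
  form is what the case of equality uses. Sections in an arbitrary direction \<open>u\<close> are measured as
  \<open>n\<close>-dimensional volumes of cylinders of height one (\<open>section_cyl\<close>); this makes it
  possible to argue without coordinates adapted to \<open>u\<close>.
\<close>

section \<open>The Prekopa-Leindler inequality\<close>

text \<open>
  If \<open>A\<close> lay to the left of \<open>x0 \<in> A\<close> and \<open>B\<close> to the right of \<open>y0 \<in> B\<close>, the sets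
  \<open>(1-l) A + l y0\<close> and \<open>(1-l) x0 + l B\<close> would be subsets of \<open>E\<close> with at most one common point.
  Points \<open>x0\<close> and \<open>y0\<close> close to \<open>Sup A\<close> and \<open>Inf B\<close> lose only a small part of each set.
\<close>

lemma brunn_minkowski_line_bounded:
  fixes A B E :: "real set"
  assumes meas: "A \<in> sets borel" "B \<in> sets borel" "E \<in> sets borel"
    and ne: "A \<noteq> {}" "B \<noteq> {}" and bdd: "bounded A" "bounded B" and l: "0 < l" "l < 1"
    and sum: "\<And>x y. x \<in> A \<Longrightarrow> y \<in> B \<Longrightarrow> (1 - l) * x + l * y \<in> E"
  shows "ennreal (1 - l) * emeasure lborel A + ennreal l * emeasure lborel B \<le> emeasure lborel E"
proof (rule ennreal_le_epsilon)
  fix e :: real assume e: "0 < e"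
  have A': "bdd_above A" and B': "bdd_below B"
    using bdd by (auto simp: bounded_imp_bdd_above bounded_imp_bdd_below)
  obtain x0 where x0: "x0 \<in> A" "Sup A - e < x0"
    using less_cSup_iff[OF ne(1) A', of "Sup A - e"] e by auto
  obtain y0 where y0: "y0 \<in> B" "y0 < Inf B + e"
    using cInf_less_iff[OF ne(2) B', of "Inf B + e"] e by auto
  let ?A = "A \<inter> {..x0}" and ?B = "B \<inter> {y0..}"
  have "emeasure lborel A \<le> emeasure lborel (?A \<union> {x0..x0 + e})"
  proof (rule emeasure_mono)
    show "A \<subseteq> A \<inter> {..x0} \<union> {x0..x0 + e}"
    proof
      fix x assume "x \<in> A"
      moreover have "x \<le> Sup A" using \<open>x \<in> A\<close> A' by (rule cSup_upper)
      ultimately show "x \<in> A \<inter> {..x0} \<union> {x0..x0 + e}" using x0 by auto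
    qed
  qed (use meas in auto)
  also have "\<dots> \<le> emeasure lborel ?A + ennreal e"
    using emeasure_subadditive[of ?A lborel "{x0..x0+e}"] meas e by simp
  finally have a: "emeasure lborel A \<le> emeasure lborel ?A + ennreal e" .
  have "emeasure lborel B \<le> emeasure lborel (?B \<union> {y0 - e..y0})"
  proof (rule emeasure_mono)
    show "B \<subseteq> B \<inter> {y0..} \<union> {y0 - e..y0}"
    proof
      fix x assume "x \<in> B"
      moreover have "Inf B \<le> x" using \<open>x \<in> B\<close> B' by (rule cInf_lower)
      ultimately show "x \<in> B \<inter> {y0..} \<union> {y0 - e..y0}" using y0 by auto
    qed
  qed (use meas in auto)
  also have "\<dots> \<le> emeasure lborel ?B + ennreal e"
    using emeasure_subadditive[of ?B lborel "{y0-e..y0}"] meas e by simp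
  finally have b: "emeasure lborel B \<le> emeasure lborel ?B + ennreal e" .
  let ?f = "\<lambda>x. l * y0 + (1 - l) * x" and ?g = "\<lambda>y. (1 - l) * x0 + l * y"
  have img: "emeasure lborel ((\<lambda>x. t + c * x) ` S) = ennreal c * emeasure lborel S"
    "(\<lambda>x. t + c * x) ` S \<in> sets borel"
    if "0 < c" "S \<in> sets borel" for c t :: real and S
  proof -
    have eq: "(\<lambda>x. t + c * x) ` S = (\<lambda>z. - t / c + (1/c) * z) -` S"
      using that by (auto simp: image_iff field_simps intro!: bexI[of _ "(_ - t) / c"])
    show sets: "(\<lambda>x. t + c * x) ` S \<in> sets borel"
      unfolding eq using that measurable_sets[of "\<lambda>z. - t / c + (1/c) * z" borel borel S]
      by simp
    have "emeasure lborel ((\<lambda>x. t + c * x) ` S) = (\<integral>\<^sup>+x. indicator ((\<lambda>x. t + c * x) ` S) x \<partial>lborel)"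
      using sets by simp
    also have "\<dots> = ennreal c * (\<integral>\<^sup>+x. indicator ((\<lambda>x. t + c * x) ` S) (t + c * x) \<partial>lborel)"
      using that sets by (subst nn_integral_real_affine[of _ c t]) auto
    also have "(\<lambda>x. indicator ((\<lambda>x. t + c * x) ` S) (t + c * x) :: ennreal) = indicator S"
      using that by (auto simp: indicator_def fun_eq_iff)
    finally show "emeasure lborel ((\<lambda>x. t + c * x) ` S) = ennreal c * emeasure lborel S"
      using that by simp
  qed
  have f: "emeasure lborel (?f ` ?A) = ennreal (1 - l) * emeasure lborel ?A" "?f ` ?A \<in> sets borel"
    and g: "emeasure lborel (?g ` ?B) = ennreal l * emeasure lborel ?B" "?g ` ?B \<in> sets borel"
    using img meas l by auto
  define p where "p = (1 - l) * x0 + l * y0"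
  have p: "emeasure lborel (?f ` ?A) + emeasure lborel (?g ` ?B) \<le> emeasure lborel E"
  proof -
    have "AE x in lborel. x \<noteq> p" by (rule AE_lborel_singleton)
    have "emeasure lborel (?f ` ?A) = emeasure lborel (?f ` ?A - {p})"
      using f by (intro emeasure_eq_AE) (use AE_lborel_singleton[of p] in auto)
    moreover have "emeasure lborel (?f ` ?A - {p}) + emeasure lborel (?g ` ?B)
        = emeasure lborel ((?f ` ?A - {p}) \<union> ?g ` ?B)"
    proof (rule plus_emeasure)
      have "z < p" if z: "z \<in> ?f ` ?A - {p}" for z
      proof -
        obtain x where "x \<in> A" "x \<le> x0" "z = ?f x" using z by blast
        with l have "z \<le> p" by (simp add: p_def)
        with z show ?thesis by auto
      qed
      moreover have "p \<le> z" if "z \<in> ?g ` ?B" for z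
        using that l by (auto simp: p_def)
      ultimately show "(?f ` ?A - {p}) \<inter> ?g ` ?B = {}" by force
    qed (use f g in auto)
    moreover have "emeasure lborel ((?f ` ?A - {p}) \<union> ?g ` ?B) \<le> emeasure lborel E"
      using sum x0 y0 meas by (intro emeasure_mono) (auto simp: add.commute)
    ultimately show ?thesis by simp
  qed
  have "ennreal (1 - l) * emeasure lborel A + ennreal l * emeasure lborel B
      \<le> ennreal (1 - l) * (emeasure lborel ?A + ennreal e) + ennreal l * (emeasure lborel ?B + ennreal e)"
    using a b by (intro add_mono mult_left_mono) auto
  also have "\<dots> = (emeasure lborel (?f ` ?A) + emeasure lborel (?g ` ?B)) + (ennreal (1-l) * e + ennreal l * e)"
    unfolding f g by (simp add: distrib_left algebra_simps)
  also have "ennreal (1-l) * e + ennreal l * e = ennreal e"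
    using l e by (simp add: ennreal_mult'[symmetric] ennreal_plus[symmetric] algebra_simps del: ennreal_plus)
  also have "(emeasure lborel (?f ` ?A) + emeasure lborel (?g ` ?B)) + ennreal e \<le> emeasure lborel E + ennreal e"
    using p by (rule add_right_mono)
  finally show "ennreal (1 - l) * emeasure lborel A + ennreal l * emeasure lborel B \<le> emeasure lborel E + ennreal e" .
qed

lemma brunn_minkowski_line:
  fixes A B E :: "real set"
  assumes meas: "A \<in> sets borel" "B \<in> sets borel" "E \<in> sets borel"
    and ne: "A \<noteq> {}" "B \<noteq> {}" and l: "0 < l" "l < 1"
    and sum: "\<And>x y. x \<in> A \<Longrightarrow> y \<in> B \<Longrightarrow> (1 - l) * x + l * y \<in> E"
  shows "ennreal (1 - l) * emeasure lborel A + ennreal l * emeasure lborel B \<le> emeasure lborel E"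
proof -
  obtain a b where ab: "a \<in> A" "b \<in> B" using ne by auto
  define r where "r k = max \<bar>a\<bar> \<bar>b\<bar> + real k" for k :: nat
  have lim: "(\<lambda>k. emeasure lborel (S \<inter> {-r k..r k})) \<longlonglongrightarrow> emeasure lborel S" if "S \<in> sets borel" for S
  proof -
    have "(\<Union>k. S \<inter> {-r k..r k}) = S"
    proof -
      have "\<exists>k. -r k \<le> x \<and> x \<le> r k" for x
      proof -
        obtain k where "\<bar>x\<bar> < real k" using reals_Archimedean2 by blast
        then show ?thesis by (intro exI[of _ k]) (auto simp: r_def)
      qed
      then show ?thesis by auto
    qed
    moreover have "incseq (\<lambda>k. S \<inter> {-r k..r k})"
      by (auto simp: incseq_def r_def)
    ultimately show ?thesis
      using Lim_emeasure_incseq[of "\<lambda>k. S \<inter> {-r k..r k}" lborel] that by (simp add: image_subset_iff)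
  qed
  have "ennreal (1 - l) * emeasure lborel (A \<inter> {-r k..r k}) + ennreal l * emeasure lborel (B \<inter> {-r k..r k})
      \<le> emeasure lborel E" for k
  proof (rule brunn_minkowski_line_bounded)
    have "a \<in> A \<inter> {-r k..r k}" "b \<in> B \<inter> {-r k..r k}" using ab by (auto simp: r_def)
    then show "A \<inter> {-r k..r k} \<noteq> {}" "B \<inter> {-r k..r k} \<noteq> {}" by auto
  qed (use meas l sum in \<open>auto intro: bounded_subset[OF bounded_closed_interval]\<close>)
  moreover have "(\<lambda>k. ennreal (1 - l) * emeasure lborel (A \<inter> {-r k..r k}) + ennreal l * emeasure lborel (B \<inter> {-r k..r k}))
      \<longlonglongrightarrow> ennreal (1 - l) * emeasure lborel A + ennreal l * emeasure lborel B"
    using meas by (intro tendsto_add ennreal_tendsto_cmult lim) auto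
  ultimately show ?thesis
    by (intro LIMSEQ_le_const2) auto
qed

text \<open>
  The layer cake formula for a single value \<open>y\<close>, with levels scaled by \<open>N\<close>.
\<close>

lemma emeasure_lborel_subgraph:
  assumes "0 < N"
  shows "ennreal N * emeasure lborel {s. 0 < s \<and> ennreal (N * s) < y} = y"
proof (cases y)
  case (real r)
  then have "{s. 0 < s \<and> ennreal (N * s) < y} = {0<..<r/N}"
    using assms by (auto simp: ennreal_less_iff field_simps)
  then show ?thesis using real assms by (simp add: ennreal_mult'[symmetric])
next
  case top
  have "{s. 0 < s \<and> ennreal (N * s) < y} = {0<..}" using top by auto
  moreover have "emeasure lborel {0::real<..} = \<infinity>"
  proof (rule ccontr)
    assume "emeasure lborel {0::real<..} \<noteq> \<infinity>"
    then obtain r where r: "emeasure lborel {0::real<..} = ennreal r" "0 \<le> r"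
      by (cases "emeasure lborel {0::real<..}") auto
    have "emeasure lborel {0<..<r + 1} \<le> emeasure lborel {0::real<..}"
      by (intro emeasure_mono) auto
    with r show False by (simp add: ennreal_le_iff)
  qed
  ultimately show ?thesis using assms top by (simp add: ennreal_mult_top)
qed

lemma nn_integral_layer_cake:
  fixes f :: "'a::euclidean_space \<Rightarrow> ennreal"
  assumes [measurable]: "f \<in> borel_measurable borel" and N: "0 < N"
  shows "(\<integral>\<^sup>+x. f x \<partial>lborel) =
    ennreal N * (\<integral>\<^sup>+s. indicator {0<..} s * emeasure lborel {x. ennreal (N * s) < f x} \<partial>lborel)"
proof -
  let ?S = "{p :: 'a \<times> real. 0 < snd p \<and> ennreal (N * snd p) < f (fst p)}"
  have "{p \<in> space (borel \<Otimes>\<^sub>M borel). 0 < snd p \<and> ennreal (N * snd p) < f (fst p)} \<in> sets (borel \<Otimes>\<^sub>M borel)"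
    by measurable
  then have [measurable]: "?S \<in> sets (borel \<Otimes>\<^sub>M borel)"
    by (simp add: space_pair_measure)
  have S[measurable]: "?S \<in> sets (lborel \<Otimes>\<^sub>M lborel)"
    by simp
  have "(\<integral>\<^sup>+x. f x \<partial>lborel) = (\<integral>\<^sup>+x. ennreal N * emeasure lborel {s. 0 < s \<and> ennreal (N * s) < f x} \<partial>lborel)"
    by (simp add: emeasure_lborel_subgraph[OF N])
  also have "\<dots> = ennreal N * (\<integral>\<^sup>+x. emeasure lborel {s. 0 < s \<and> ennreal (N * s) < f x} \<partial>lborel)"
    using lborel.measurable_emeasure_Pair[OF S] by (intro nn_integral_cmult) (simp add: vimage_def)
  also have "(\<integral>\<^sup>+x. emeasure lborel {s. 0 < s \<and> ennreal (N * s) < f x} \<partial>lborel)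
      = emeasure (lborel \<Otimes>\<^sub>M lborel) ?S"
    using lborel.emeasure_pair_measure_alt[OF S] by (simp add: vimage_def)
  also have "\<dots> = (\<integral>\<^sup>+s. emeasure lborel {x. 0 < s \<and> ennreal (N * s) < f x} \<partial>lborel)"
    using lborel_pair.emeasure_pair_measure_alt2[OF S] by (simp add: vimage_def)
  also have "\<dots> = (\<integral>\<^sup>+s. indicator {0<..} s * emeasure lborel {x. ennreal (N * s) < f x} \<partial>lborel)"
    by (intro nn_integral_cong) (auto simp: indicator_def)
  finally show ?thesis .
qed

text \<open>
  For finite values this says \<open>a^(1-l) b^l \<le> c\<close>. Testing real numbers strictly below \<open>a\<close> and \<open>b\<close>
  gives a meaning to infinite values, and it lets truncations of integrands approximate their
  integrals from below.
\<close>

definition geomean_le :: "real \<Rightarrow> ennreal \<Rightarrow> ennreal \<Rightarrow> ennreal \<Rightarrow> bool" where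
  "geomean_le l a b c \<longleftrightarrow> (\<forall>a'>0. \<forall>b'>0. ennreal a' < a \<longrightarrow> ennreal b' < b \<longrightarrow>
     ennreal (a' powr (1 - l) * b' powr l) \<le> c)"

lemma nn_integral_truncation:
  fixes f :: "'a \<Rightarrow> ennreal"
  assumes [measurable]: "f \<in> borel_measurable M" and a: "a < (\<integral>\<^sup>+x. f x \<partial>M)"
  obtains k :: nat where "a < (\<integral>\<^sup>+x. min (f x) (of_nat k) \<partial>M)"
proof -
  have sup: "(SUP k. min (f x) (of_nat k)) = f x" for x
  proof (rule antisym)
    show "f x \<le> (SUP k. min (f x) (of_nat k))"
    proof (cases "f x = top")
      case True
      then show ?thesis by (simp add: ennreal_SUP_of_nat_eq_top)
    next
      case False
      then obtain k where "f x < of_nat k" using ennreal_Ex_less_of_nat[of "f x"] by (auto simp: less_top)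
      then show ?thesis by (intro SUP_upper2[of k]) auto
    qed
  qed (auto intro: SUP_least)
  have "(\<integral>\<^sup>+x. f x \<partial>M) = (\<integral>\<^sup>+x. (SUP k. min (f x) (of_nat k)) \<partial>M)"
    by (simp add: sup)
  also have "\<dots> = (SUP k. (\<integral>\<^sup>+x. min (f x) (of_nat k) \<partial>M))"
    by (intro nn_integral_monotone_convergence_SUP)
       (auto simp: incseq_def le_fun_def intro: min.coboundedI2)
  finally show ?thesis using a that by (auto simp: less_SUP_iff)
qed

text \<open>
  After truncation \<open>f\<close> and \<open>g\<close> have finite suprema \<open>F\<close> and \<open>G\<close>. For \<open>s < 1\<close> the level sets
  \<open>f > F s\<close> and \<open>g > G s\<close> are both nonempty, and with \<open>N = F^(1-l) G^l\<close> their combination lies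
  in the level set \<open>h > N s\<close>, so the one-dimensional Brunn-Minkowski inequality
  bounds the measure of the latter. Integration over \<open>s\<close> gives
  \<open>\<integral>h \<ge> N ((1-l) \<integral>f / F + l \<integral>g / G)\<close>, to which the weighted
  inequality between arithmetic and geometric means applies.
\<close>

lemma prekopa_leindler_line:
  fixes f g h :: "real \<Rightarrow> ennreal"
  assumes [measurable]: "f \<in> borel_measurable borel" "g \<in> borel_measurable borel" "h \<in> borel_measurable borel"
    and l: "0 < l" "l < 1"
    and fgh: "\<And>x y. geomean_le l (f x) (g y) (h ((1 - l) * x + l * y))"
  shows "geomean_le l (\<integral>\<^sup>+x. f x \<partial>lborel) (\<integral>\<^sup>+x. g x \<partial>lborel) (\<integral>\<^sup>+x. h x \<partial>lborel)"
  unfolding geomean_le_def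
proof (intro allI impI)
  fix a b :: real
  assume a: "0 < a" "ennreal a < (\<integral>\<^sup>+x. f x \<partial>lborel)" and b: "0 < b" "ennreal b < (\<integral>\<^sup>+x. g x \<partial>lborel)"
  obtain j where j: "ennreal a < (\<integral>\<^sup>+x. min (f x) (of_nat j) \<partial>lborel)"
    using nn_integral_truncation[of f lborel, OF _ a(2)] by auto
  obtain k where k: "ennreal b < (\<integral>\<^sup>+x. min (g x) (of_nat k) \<partial>lborel)"
    using nn_integral_truncation[of g lborel, OF _ b(2)] by auto
  define f' where "f' x = min (f x) (of_nat j)" for x
  define g' where "g' x = min (g x) (of_nat k)" for x
  have [measurable]: "f' \<in> borel_measurable borel" "g' \<in> borel_measurable borel"
    unfolding f'_def g'_def by measurable
  have pos: "\<exists>F. 0 < F \<and> (SUP x. w x) = ennreal F"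
    if "ennreal c < (\<integral>\<^sup>+x. w x \<partial>lborel)" "\<And>x. w x \<le> of_nat i" for c i and w :: "real \<Rightarrow> ennreal"
  proof -
    have "(SUP x. w x) \<le> of_nat i" using that by (auto intro: SUP_least)
    then have "(SUP x. w x) < top" using le_less_trans of_nat_less_top by blast
    then obtain F where F: "(SUP x. w x) = ennreal F" "0 \<le> F"
      by (cases "SUP x. w x") auto
    have "F \<noteq> 0"
    proof
      assume "F = 0"
      then have "w x = 0" for x using F(1) SUP_upper[of x UNIV w] by auto
      then have "w = (\<lambda>_. 0)" by auto
      with that show False by simp
    qed
    with F show ?thesis by (intro exI[of _ F]) auto
  qed
  obtain F where F: "0 < F" "(SUP x. f' x) = ennreal F"
    using pos[of a f' j] j by (auto simp: f'_def)
  obtain G where G: "0 < G" "(SUP x. g' x) = ennreal G"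
    using pos[of b g' k] k by (auto simp: g'_def)
  define N where "N = F powr (1 - l) * G powr l"
  have N: "0 < N" using F G by (simp add: N_def)
  have level: "indicator {0<..} s * (ennreal (1 - l) * emeasure lborel {x. ennreal (F * s) < f' x}
        + ennreal l * emeasure lborel {x. ennreal (G * s) < g' x})
      \<le> indicator {0<..} s * emeasure lborel {x. ennreal (N * s) < h x}" for s
  proof (cases "0 < s \<and> s < 1")
    case True
    then have s: "0 < s" "s < 1" by auto
    have ne: "{x. ennreal (F * s) < f' x} \<noteq> {}" "{x. ennreal (G * s) < g' x} \<noteq> {}"
      using F G s less_SUP_iff[of "ennreal (F * s)" f' UNIV] less_SUP_iff[of "ennreal (G * s)" g' UNIV]
      by (auto simp: ennreal_less_iff)
    have "ennreal (1 - l) * emeasure lborel {x. ennreal (F * s) < f' x}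
        + ennreal l * emeasure lborel {x. ennreal (G * s) < g' x} \<le> emeasure lborel {x. ennreal (N * s) < h x}"
    proof (rule brunn_minkowski_line[OF _ _ _ ne l])
      fix x y assume "x \<in> {x. ennreal (F * s) < f' x}" "y \<in> {x. ennreal (G * s) < g' x}"
      then have xy: "ennreal (F * s) < f x" "ennreal (G * s) < g y"
        by (auto simp: f'_def g'_def)
      \<comment> \<open>a level \<open>t > s\<close> that \<open>f\<close> and \<open>g\<close> still exceed makes the bound on \<open>h\<close> strict\<close>
      obtain s1 where s1: "s < s1" "ennreal (F * s1) < f x"
      proof -
        obtain z where z: "ennreal (F * s) < ennreal z" "ennreal z < f x"
          using ennreal_Ex_less_of_nat dense[OF xy(1)] by (metis ennreal_cases less_top_ennreal top.not_eq_extremum order_less_trans infinity_ennreal_def)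
        then show ?thesis using F s by (intro that[of "z / F"]) (auto simp: ennreal_less_iff field_simps)
      qed
      obtain s2 where s2: "s < s2" "ennreal (G * s2) < g y"
      proof -
        obtain z where z: "ennreal (G * s) < ennreal z" "ennreal z < g y"
          using ennreal_Ex_less_of_nat dense[OF xy(2)] by (metis ennreal_cases less_top_ennreal top.not_eq_extremum order_less_trans infinity_ennreal_def)
        then show ?thesis using G s by (intro that[of "z / G"]) (auto simp: ennreal_less_iff field_simps)
      qed
      define t where "t = min s1 s2"
      have t: "s < t" "0 < t" using s1 s2 s by (auto simp: t_def)
      have "ennreal (F * t) < f x" "ennreal (G * t) < g y"
        using s1 s2 F G le_less_trans[OF ennreal_leI[of "F * t" "F * s1"]]
          le_less_trans[OF ennreal_leI[of "G * t" "G * s2"]] by (auto simp: t_def)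
      then have "ennreal ((F * t) powr (1 - l) * (G * t) powr l) \<le> h ((1 - l) * x + l * y)"
        using fgh[of x y] F G t by (auto simp: geomean_le_def)
      moreover have "(F * t) powr (1 - l) * (G * t) powr l = N * t"
      proof -
        have "t powr (1 - l) * t powr l = t" using t by (simp add: powr_add[symmetric])
        then show ?thesis using F G t by (simp add: N_def powr_mult algebra_simps)
      qed
      ultimately have "ennreal (N * t) \<le> h ((1 - l) * x + l * y)" by simp
      moreover have "ennreal (N * s) < ennreal (N * t)" using N t s by (simp add: ennreal_less_iff)
      ultimately show "(1 - l) * x + l * y \<in> {x. ennreal (N * s) < h x}" by auto
    qed measurable
    then show ?thesis by (intro mult_left_mono) auto
  next
    case False
    show ?thesis
    proof (cases "0 < s")
      case True
      with False have s: "1 \<le> s" by auto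
      have "ennreal (F * s) \<ge> f' x" "ennreal (G * s) \<ge> g' x" for x
      proof -
        have "f' x \<le> ennreal F" "g' x \<le> ennreal G"
          using F G SUP_upper[of x UNIV f'] SUP_upper[of x UNIV g'] by auto
        moreover have "ennreal F \<le> ennreal (F * s)" "ennreal G \<le> ennreal (G * s)"
          using s F G by (auto intro!: ennreal_leI)
        ultimately show "ennreal (F * s) \<ge> f' x" "ennreal (G * s) \<ge> g' x" by auto
      qed
      then have "{x. ennreal (F * s) < f' x} = {}" "{x. ennreal (G * s) < g' x} = {}"
        by (auto simp: not_less)
      then show ?thesis by simp
    qed auto
  qed
  have "ennreal a = ennreal F * ennreal (a / F)" "ennreal b = ennreal G * ennreal (b / G)"
    using F G a b by (auto simp: ennreal_mult'[symmetric])
  let ?I = "\<integral>\<^sup>+s. indicator {0<..} s * emeasure lborel {x. ennreal (F * s) < f' x} \<partial>lborel"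
  let ?J = "\<integral>\<^sup>+s. indicator {0<..} s * emeasure lborel {x. ennreal (G * s) < g' x} \<partial>lborel"
  have quot: "ennreal (c / C) \<le> Y" if "0 < c" "0 < C" "ennreal c < ennreal C * Y" for c C Y
  proof (cases Y)
    case (real r)
    then show ?thesis using that by (auto simp: ennreal_mult'[symmetric] ennreal_less_iff field_simps intro!: ennreal_leI)
  qed auto
  have I: "ennreal (a / F) \<le> ?I"
    using quot[OF a(1) F(1)] j nn_integral_layer_cake[of f' F] F by (auto simp: f'_def)
  have J: "ennreal (b / G) \<le> ?J"
    using quot[OF b(1) G(1)] k nn_integral_layer_cake[of g' G] G by (auto simp: g'_def)
  have [measurable]: "(\<lambda>s. emeasure lborel {x. ennreal (c * s) < w x}) \<in> borel_measurable borel"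
    if [measurable]: "w \<in> borel_measurable borel" for c and w :: "real \<Rightarrow> ennreal"
  proof -
    have "{p \<in> space (borel \<Otimes>\<^sub>M borel). ennreal (c * fst p) < w (snd p)} \<in> sets (borel \<Otimes>\<^sub>M borel)"
      by measurable
    then have "{p :: real \<times> real. ennreal (c * fst p) < w (snd p)} \<in> sets (lborel \<Otimes>\<^sub>M lborel)"
      by (simp add: space_pair_measure)
    from lborel.measurable_emeasure_Pair[OF this] show ?thesis by (simp add: vimage_def)
  qed
  have "a powr (1 - l) * b powr l = N * ((a / F) powr (1 - l) * (b / G) powr l)"
    using F G a b by (simp add: N_def powr_divide)
  also have "\<dots> \<le> N * ((1 - l) * (a / F) + l * (b / G))"
    using N F G a b l by (intro mult_left_mono Youngs_inequality_0) auto
  finally have "ennreal (a powr (1 - l) * b powr l) \<le> ennreal (N * ((1 - l) * (a / F) + l * (b / G)))"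
    by (rule ennreal_leI)
  also have "\<dots> = ennreal N * (ennreal (1 - l) * ennreal (a / F) + ennreal l * ennreal (b / G))"
    using N F G a b l by (simp add: ennreal_mult'[symmetric] ennreal_plus[symmetric] del: ennreal_plus)
  also have "\<dots> \<le> ennreal N * (ennreal (1 - l) * ?I + ennreal l * ?J)"
    using I J by (intro mult_left_mono add_mono) auto
  also have "ennreal (1 - l) * ?I + ennreal l * ?J = (\<integral>\<^sup>+s. indicator {0<..} s *
      (ennreal (1 - l) * emeasure lborel {x. ennreal (F * s) < f' x}
        + ennreal l * emeasure lborel {x. ennreal (G * s) < g' x}) \<partial>lborel)"
    by (subst nn_integral_cmult[symmetric], measurable)+
       (subst nn_integral_add[symmetric], measurable, auto intro!: nn_integral_cong simp: algebra_simps)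
  also have "ennreal N * \<dots> \<le> ennreal N * (\<integral>\<^sup>+s. indicator {0<..} s * emeasure lborel {x. ennreal (N * s) < h x} \<partial>lborel)"
    by (intro mult_left_mono nn_integral_mono level) auto
  also have "\<dots> = (\<integral>\<^sup>+x. h x \<partial>lborel)"
    using N by (simp add: nn_integral_layer_cake[of h N])
  finally show "ennreal (a powr (1 - l) * b powr l) \<le> (\<integral>\<^sup>+x. h x \<partial>lborel)" .
qed

text \<open>
  When a coordinate \<open>i\<close> is added, the induction hypothesis applies to the functions with \<open>i\<close> fixed; their
  integrals are functions of \<open>i\<close> that satisfy the hypothesis of the one-dimensional inequality.
\<close>

lemma prekopa_leindler_PiM:
  fixes f g h :: "('i \<Rightarrow> real) \<Rightarrow> ennreal"
  assumes "finite I" and l: "0 < l" "l < 1"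
    and "f \<in> borel_measurable (Pi\<^sub>M I (\<lambda>_. lborel))" "g \<in> borel_measurable (Pi\<^sub>M I (\<lambda>_. lborel))"
      "h \<in> borel_measurable (Pi\<^sub>M I (\<lambda>_. lborel))"
    and "\<And>x y. x \<in> extensional I \<Longrightarrow> y \<in> extensional I \<Longrightarrow>
      geomean_le l (f x) (g y) (h (\<lambda>i\<in>I. (1 - l) * x i + l * y i))"
  shows "geomean_le l (integral\<^sup>N (Pi\<^sub>M I (\<lambda>_. lborel)) f) (integral\<^sup>N (Pi\<^sub>M I (\<lambda>_. lborel)) g)
    (integral\<^sup>N (Pi\<^sub>M I (\<lambda>_. lborel)) h)"
  using assms(1,4-)
proof (induction I arbitrary: f g h)
  case empty
  interpret product_sigma_finite "\<lambda>_::'i. lborel :: real measure" by standard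
  show ?case using empty(4)[of "\<lambda>_. undefined" "\<lambda>_. undefined"]
    by (simp add: nn_integral_empty restrict_def)
next
  case (insert i I)
  interpret product_sigma_finite "\<lambda>_::'i. lborel :: real measure" by standard
  note [measurable] = insert.prems(1-3)
  have sec: "(\<lambda>x. w (x(i := y))) \<in> borel_measurable (Pi\<^sub>M I (\<lambda>_. lborel))"
    if [measurable]: "w \<in> borel_measurable (Pi\<^sub>M (insert i I) (\<lambda>_. lborel))" for y :: real and w :: "('i \<Rightarrow> real) \<Rightarrow> ennreal"
    by measurable
  have int: "(\<lambda>y. \<integral>\<^sup>+x. w (x(i := y)) \<partial>Pi\<^sub>M I (\<lambda>_. lborel)) \<in> borel_measurable borel"
    if [measurable]: "w \<in> borel_measurable (Pi\<^sub>M (insert i I) (\<lambda>_. lborel))" for w :: "('i \<Rightarrow> real) \<Rightarrow> ennreal"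
  proof -
    interpret I: finite_product_sigma_finite "\<lambda>_::'i. lborel :: real measure" I by standard (fact insert.hyps)
    interpret sigma_finite_measure "Pi\<^sub>M I (\<lambda>_::'i. lborel :: real measure)"
      by (rule sigma_finite) (fact insert.hyps)
    have "(\<lambda>y. \<integral>\<^sup>+x. w (x(i := y)) \<partial>Pi\<^sub>M I (\<lambda>_. lborel)) \<in> borel_measurable lborel"
      by measurable
    then show ?thesis by simp
  qed
  have "geomean_le l (\<integral>\<^sup>+y. (\<integral>\<^sup>+x. f (x(i := y)) \<partial>Pi\<^sub>M I (\<lambda>_. lborel)) \<partial>lborel)
    (\<integral>\<^sup>+y. (\<integral>\<^sup>+x. g (x(i := y)) \<partial>Pi\<^sub>M I (\<lambda>_. lborel)) \<partial>lborel)
    (\<integral>\<^sup>+y. (\<integral>\<^sup>+x. h (x(i := y)) \<partial>Pi\<^sub>M I (\<lambda>_. lborel)) \<partial>lborel)"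
  proof (rule prekopa_leindler_line[OF int int int l])
    fix s t :: real
    show "geomean_le l (\<integral>\<^sup>+x. f (x(i := s)) \<partial>Pi\<^sub>M I (\<lambda>_. lborel)) (\<integral>\<^sup>+x. g (x(i := t)) \<partial>Pi\<^sub>M I (\<lambda>_. lborel))
      (\<integral>\<^sup>+x. h (x(i := (1 - l) * s + l * t)) \<partial>Pi\<^sub>M I (\<lambda>_. lborel))"
    proof (rule insert.IH[OF sec sec sec])
      fix x y :: "'i \<Rightarrow> real" assume xy: "x \<in> extensional I" "y \<in> extensional I"
      have "(\<lambda>k\<in>insert i I. (1 - l) * (x(i := s)) k + l * (y(i := t)) k)
          = (\<lambda>k\<in>I. (1 - l) * x k + l * y k)(i := (1 - l) * s + l * t)"
        using insert.hyps by (auto simp: fun_eq_iff)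
      moreover have "x(i := s) \<in> extensional (insert i I)" "y(i := t) \<in> extensional (insert i I)"
        using xy by (auto simp: extensional_def)
      ultimately show "geomean_le l (f (x(i := s))) (g (y(i := t)))
          (h ((\<lambda>k\<in>I. (1 - l) * x k + l * y k)(i := (1 - l) * s + l * t)))"
        using insert.prems(4)[of "x(i := s)" "y(i := t)"] by (simp only: )
    qed fact+
  qed fact+
  then show ?case
    using insert.hyps by (simp add: product_nn_integral_insert_rev)
qed

lemma prekopa_leindler:
  fixes f g h :: "'a::euclidean_space \<Rightarrow> ennreal"
  assumes [measurable]: "f \<in> borel_measurable borel" "g \<in> borel_measurable borel" "h \<in> borel_measurable borel"
    and l: "0 < l" "l < 1"
    and fgh: "\<And>x y. geomean_le l (f x) (g y) (h ((1 - l) *\<^sub>R x + l *\<^sub>R y))"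
  shows "geomean_le l (\<integral>\<^sup>+x. f x \<partial>lborel) (\<integral>\<^sup>+x. g x \<partial>lborel) (\<integral>\<^sup>+x. h x \<partial>lborel)"
proof -
  let ?\<phi> = "\<lambda>x. \<Sum>b\<in>Basis. x b *\<^sub>R b :: 'a"
  have eq: "(\<integral>\<^sup>+x. w x \<partial>lborel) = (\<integral>\<^sup>+x. w (?\<phi> x) \<partial>Pi\<^sub>M Basis (\<lambda>_. lborel))"
    if [measurable]: "w \<in> borel_measurable borel" for w :: "'a \<Rightarrow> ennreal"
    by (subst lborel_eq, subst nn_integral_distr) auto
  have "geomean_le l (\<integral>\<^sup>+x. f (?\<phi> x) \<partial>Pi\<^sub>M Basis (\<lambda>_. lborel)) (\<integral>\<^sup>+x. g (?\<phi> x) \<partial>Pi\<^sub>M Basis (\<lambda>_. lborel))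
    (\<integral>\<^sup>+x. h (?\<phi> x) \<partial>Pi\<^sub>M Basis (\<lambda>_. lborel))"
  proof (rule prekopa_leindler_PiM[OF finite_Basis l])
    fix x y :: "'a \<Rightarrow> real"
    have "?\<phi> (\<lambda>i\<in>Basis. (1 - l) * x i + l * y i) = (1 - l) *\<^sub>R ?\<phi> x + l *\<^sub>R ?\<phi> y"
      by (simp add: scaleR_sum_right sum.distrib[symmetric] scaleR_add_left)
    then show "geomean_le l (f (?\<phi> x)) (g (?\<phi> y)) (h (?\<phi> (\<lambda>i\<in>Basis. (1 - l) * x i + l * y i)))"
      using fgh by simp
  qed measurable
  then show ?thesis by (simp add: eq)
qed

lemma prekopa_leindler_sets:
  fixes A B E :: "'a::euclidean_space set"
  assumes sets: "A \<in> sets borel" "B \<in> sets borel" "E \<in> sets borel" and l: "0 < l" "l < 1"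
    and ABE: "\<And>x y. x \<in> A \<Longrightarrow> y \<in> B \<Longrightarrow> (1 - l) *\<^sub>R x + l *\<^sub>R y \<in> E"
  shows "geomean_le l (emeasure lborel A) (emeasure lborel B) (emeasure lborel E)"
proof -
  have "geomean_le l (\<integral>\<^sup>+x. indicator A x \<partial>lborel) (\<integral>\<^sup>+x. indicator B x \<partial>lborel) (\<integral>\<^sup>+x. indicator E x \<partial>lborel)"
  proof (rule prekopa_leindler[OF _ _ _ l])
    fix x y :: 'a
    show "geomean_le l (indicator A x) (indicator B y) (indicator E ((1 - l) *\<^sub>R x + l *\<^sub>R y))"
      unfolding geomean_le_def
    proof (intro allI impI)
      fix a b :: real
      assume a: "0 < a" "ennreal a < indicator A x" and b: "0 < b" "ennreal b < indicator B y"
      have xy: "x \<in> A" "y \<in> B" using a b by (cases "x \<in> A"; cases "y \<in> B"; simp)+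
      then have "a < 1" "b < 1" using a b by simp_all
      then have "a powr (1 - l) * b powr l \<le> 1" using a b l by (intro mult_le_one powr_le1) auto
      then show "ennreal (a powr (1 - l) * b powr l) \<le> indicator E ((1 - l) *\<^sub>R x + l *\<^sub>R y)"
        using ABE[OF xy] by simp
    qed
  qed (use sets in auto)
  then show ?thesis using sets by simp
qed

text \<open>
  Approximation by \<open>s a\<close> and \<open>s b\<close> with \<open>s < 1\<close> turns the strict thresholds into the plain inequality.
\<close>

lemma geomean_leD:
  assumes "geomean_le l (ennreal a) (ennreal b) (ennreal c)" "0 < l" "l < 1" "0 \<le> a" "0 \<le> b" "0 \<le> c"
  shows "a powr (1 - l) * b powr l \<le> c"
proof (cases "a = 0 \<or> b = 0")
  case False
  then have ab: "0 < a" "0 < b" using assms by auto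
  have *: "(s * a) powr (1 - l) * (s * b) powr l \<le> c" if "s \<in> {0<..<1}" for s
    using assms ab that by (auto simp: geomean_le_def ennreal_less_iff ennreal_le_iff)
  have s: "s * (a powr (1 - l) * b powr l) \<le> c" if "s \<in> {0<..<1}" for s
  proof -
    have "s powr (1 - l) * s powr l = s" using that by (simp add: powr_add[symmetric])
    then show ?thesis using *[OF that] that ab by (simp add: powr_mult algebra_simps)
  qed
  show ?thesis by (rule field_le_mult_one_interval) (use s in auto)
qed (use assms in auto)

section \<open>Sections by parallel hyperplanes\<close>

lemma nn_integral_lborel_translate:
  fixes f :: "'a::euclidean_space \<Rightarrow> ennreal"
  assumes [measurable]: "f \<in> borel_measurable borel"
  shows "(\<integral>\<^sup>+x. f (c + x) \<partial>lborel) = (\<integral>\<^sup>+x. f x \<partial>lborel)"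
proof -
  have "(\<integral>\<^sup>+x. f x \<partial>lborel) = (\<integral>\<^sup>+x. f x \<partial>distr lborel borel ((+) c))"
    by (simp add: lborel_distr_plus)
  then show ?thesis by (simp add: nn_integral_distr)
qed

lemma emeasure_lborel_translate:
  fixes S :: "'a::euclidean_space set"
  assumes "S \<in> sets borel"
  shows "emeasure lborel {x. c + x \<in> S} = emeasure lborel S"
proof -
  have [measurable]: "S \<in> sets borel" by fact
  have "{x \<in> space borel. c + x \<in> S} \<in> sets borel" by measurable
  then have "emeasure lborel {x. c + x \<in> S} = (\<integral>\<^sup>+x. indicator {x. c + x \<in> S} x \<partial>lborel)"
    by simp
  also have "\<dots> = (\<integral>\<^sup>+x. indicator S (c + x) \<partial>lborel)"
    by (simp add: indicator_def)
  finally show ?thesis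
    using nn_integral_lborel_translate[of "indicator S" c] assms by simp
qed

lemma emeasure_lborel_scaleR:
  fixes S :: "'a::euclidean_space set"
  assumes S: "S \<in> sets borel" and c: "0 < c"
  shows "emeasure lborel S = ennreal (c ^ DIM('a)) * emeasure lborel {x. c *\<^sub>R x \<in> S}"
proof -
  have "emeasure lborel S = emeasure (density (distr lborel borel (\<lambda>x. 0 + c *\<^sub>R x)) (\<lambda>_. ennreal (\<bar>c\<bar> ^ DIM('a)))) S"
    using c by (subst lborel_affine[of c 0]) auto
  also have "\<dots> = ennreal (c ^ DIM('a)) * emeasure lborel {x. c *\<^sub>R x \<in> S}"
    using S c by (subst emeasure_density_const) (auto simp: emeasure_distr vimage_def)
  finally show ?thesis .
qed

text \<open>
  The cylinder of height one whose base is the section of \<open>K\<close> at height \<open>t\<close> in direction \<open>u\<close>: its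
  points are the points of that section, translated parallel to \<open>u\<close> to heights between 0 and 1.
\<close>

definition section_cyl :: "'a::euclidean_space set \<Rightarrow> 'a \<Rightarrow> real \<Rightarrow> 'a set" where
  "section_cyl K u t = {x. 0 \<le> x \<bullet> u \<and> x \<bullet> u \<le> 1 \<and> x + (t - x \<bullet> u) *\<^sub>R u \<in> K}"

definition section_vol :: "'a::euclidean_space set \<Rightarrow> 'a \<Rightarrow> real \<Rightarrow> real" where
  "section_vol K u t = measure lborel (section_cyl K u t)"

lemma section_vol_nonneg [simp]: "0 \<le> section_vol K u t"
  by (simp add: section_vol_def)

lemma compact_section_cyl:
  assumes "compact K" "norm u = 1"
  shows "compact (section_cyl K u t)"
proof -
  have "closed ({x. 0 \<le> x \<bullet> u} \<inter> {x. x \<bullet> u \<le> 1} \<inter> (\<lambda>x. x + (t - x \<bullet> u) *\<^sub>R u) -` K)"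
    using assms by (intro closed_Int closed_Collect_le closed_vimage continuous_intros compact_imp_closed) auto
  also have "({x. 0 \<le> x \<bullet> u} \<inter> {x. x \<bullet> u \<le> 1} \<inter> (\<lambda>x. x + (t - x \<bullet> u) *\<^sub>R u) -` K) = section_cyl K u t"
    by (auto simp: section_cyl_def)
  finally have "closed (section_cyl K u t)" .
  moreover have "bounded (section_cyl K u t)"
  proof -
    obtain B where B: "\<And>x. x \<in> K \<Longrightarrow> norm x \<le> B"
      using compact_imp_bounded[OF assms(1)] unfolding bounded_iff by metis
    have "norm x \<le> B + (\<bar>t\<bar> + 1)" if "x \<in> section_cyl K u t" for x
    proof -
      have "norm x = norm ((x + (t - x \<bullet> u) *\<^sub>R u) - (t - x \<bullet> u) *\<^sub>R u)" by simp
      also have "\<dots> \<le> norm (x + (t - x \<bullet> u) *\<^sub>R u) + norm ((t - x \<bullet> u) *\<^sub>R u)"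
        by (rule norm_triangle_ineq4)
      also have "norm ((t - x \<bullet> u) *\<^sub>R u) \<le> \<bar>t\<bar> + 1"
      proof -
        have "0 \<le> x \<bullet> u" "x \<bullet> u \<le> 1" using that by (simp_all add: section_cyl_def)
        then show ?thesis using assms by simp
      qed
      finally have "norm x \<le> norm (x + (t - x \<bullet> u) *\<^sub>R u) + (\<bar>t\<bar> + 1)" by simp
      moreover have "norm (x + (t - x \<bullet> u) *\<^sub>R u) \<le> B"
        using that by (intro B) (simp add: section_cyl_def)
      ultimately show ?thesis by linarith
    qed
    then show ?thesis by (rule boundedI)
  qed
  ultimately show ?thesis by (simp add: compact_eq_bounded_closed)
qed

lemma borel_compact: "compact K \<Longrightarrow> K \<in> sets (borel :: 'a::t2_space measure)"
  by (simp add: borel_closed compact_imp_closed)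

lemma emeasure_section_cyl:
  assumes "compact K" "norm u = 1"
  shows "emeasure lborel (section_cyl K u t) = ennreal (section_vol K u t)"
  unfolding section_vol_def
  using compact_section_cyl[OF assms] emeasure_compact_finite[of "section_cyl K u t"]
  by (intro emeasure_eq_ennreal_measure) auto

text \<open>
  Tonelli's theorem on lines parallel to \<open>u\<close>. Both sides are the integral of \<open>\<phi> (y \<bullet> u)\<close> over the
  pairs of a point \<open>y\<close> of \<open>K\<close> and a translate of \<open>y\<close> parallel to \<open>u\<close> of height between 0 and 1.
\<close>

lemma nn_integral_sections:
  fixes K :: "'a::euclidean_space set"
  assumes [measurable]: "K \<in> sets borel" "\<phi> \<in> borel_measurable borel" and u: "norm u = 1"
  shows "(\<integral>\<^sup>+t. \<phi> t * emeasure lborel (section_cyl K u t) \<partial>lborel)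
    = (\<integral>\<^sup>+x. \<phi> (x \<bullet> u) * indicator K x \<partial>lborel)"
proof -
  have uu: "u \<bullet> u = 1" using u by (simp add: dot_square_norm)
  have F: "(\<integral>\<^sup>+t. \<integral>\<^sup>+x. w t x \<partial>lborel \<partial>lborel) = (\<integral>\<^sup>+x. \<integral>\<^sup>+t. w t x \<partial>lborel \<partial>lborel)"
    if "case_prod w \<in> borel_measurable (borel \<Otimes>\<^sub>M borel)" for w :: "real \<Rightarrow> 'a \<Rightarrow> ennreal"
    by (rule lborel_pair.Fubini') (use that in simp)
  have [measurable]: "section_cyl K u t \<in> sets borel" for t
  proof -
    have "{x \<in> space borel. 0 \<le> x \<bullet> u \<and> x \<bullet> u \<le> 1 \<and> x + (t - x \<bullet> u) *\<^sub>R u \<in> K} \<in> sets borel"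
      by measurable
    then show ?thesis by (simp add: section_cyl_def)
  qed
  let ?S = "{0..1::real}"
  have "(\<integral>\<^sup>+t. \<phi> t * emeasure lborel (section_cyl K u t) \<partial>lborel)
    = (\<integral>\<^sup>+t. \<integral>\<^sup>+x. \<phi> t * indicator (section_cyl K u t) x \<partial>lborel \<partial>lborel)"
    by (simp add: nn_integral_cmult)
  also have "\<dots> = (\<integral>\<^sup>+t. \<integral>\<^sup>+x. \<phi> t * (indicator ?S (x \<bullet> u) * indicator K (x + (t - x \<bullet> u) *\<^sub>R u)) \<partial>lborel \<partial>lborel)"
    by (intro nn_integral_cong) (auto simp: section_cyl_def indicator_def)
  also have "\<dots> = (\<integral>\<^sup>+x. \<integral>\<^sup>+t. \<phi> t * (indicator ?S (x \<bullet> u) * indicator K (x + (t - x \<bullet> u) *\<^sub>R u)) \<partial>lborel \<partial>lborel)"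
    by (rule F) measurable
  also have "\<dots> = (\<integral>\<^sup>+x. \<integral>\<^sup>+s. \<phi> (x \<bullet> u + s) * (indicator ?S (x \<bullet> u) * indicator K (x + s *\<^sub>R u)) \<partial>lborel \<partial>lborel)"
  proof (rule nn_integral_cong)
    fix x :: 'a
    show "(\<integral>\<^sup>+t. \<phi> t * (indicator ?S (x \<bullet> u) * indicator K (x + (t - x \<bullet> u) *\<^sub>R u)) \<partial>lborel)
        = (\<integral>\<^sup>+s. \<phi> (x \<bullet> u + s) * (indicator ?S (x \<bullet> u) * indicator K (x + s *\<^sub>R u)) \<partial>lborel)"
      by (subst nn_integral_real_affine[of _ 1 "x \<bullet> u"]) simp_all
  qed
  also have "\<dots> = (\<integral>\<^sup>+s. \<integral>\<^sup>+x. \<phi> (x \<bullet> u + s) * (indicator ?S (x \<bullet> u) * indicator K (x + s *\<^sub>R u)) \<partial>lborel \<partial>lborel)"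
    by (rule F[symmetric]) measurable
  also have "\<dots> = (\<integral>\<^sup>+s. \<integral>\<^sup>+x. \<phi> (x \<bullet> u) * (indicator ?S (x \<bullet> u - s) * indicator K x) \<partial>lborel \<partial>lborel)"
  proof (rule nn_integral_cong)
    fix s :: real
    show "(\<integral>\<^sup>+x. \<phi> (x \<bullet> u + s) * (indicator ?S (x \<bullet> u) * indicator K (x + s *\<^sub>R u)) \<partial>lborel)
        = (\<integral>\<^sup>+x. \<phi> (x \<bullet> u) * (indicator ?S (x \<bullet> u - s) * indicator K x) \<partial>lborel)"
      by (subst nn_integral_lborel_translate[of _ "s *\<^sub>R u", symmetric], measurable)
         (simp add: inner_add_left uu add.commute)
  qed
  also have "\<dots> = (\<integral>\<^sup>+x. \<integral>\<^sup>+s. \<phi> (x \<bullet> u) * (indicator ?S (x \<bullet> u - s) * indicator K x) \<partial>lborel \<partial>lborel)"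
    by (rule F) measurable
  also have "\<dots> = (\<integral>\<^sup>+x. \<phi> (x \<bullet> u) * indicator K x \<partial>lborel)"
  proof (rule nn_integral_cong)
    fix x :: 'a
    have "(\<integral>\<^sup>+s. \<phi> (x \<bullet> u) * (indicator ?S (x \<bullet> u - s) * indicator K x) \<partial>lborel)
        = (\<integral>\<^sup>+s. (\<phi> (x \<bullet> u) * indicator K x) * indicator {x \<bullet> u - 1..x \<bullet> u} s \<partial>lborel)"
      by (intro nn_integral_cong) (auto simp: indicator_def)
    also have "\<dots> = \<phi> (x \<bullet> u) * indicator K x"
      by (subst nn_integral_cmult_indicator) auto
    finally show "(\<integral>\<^sup>+s. \<phi> (x \<bullet> u) * (indicator ?S (x \<bullet> u - s) * indicator K x) \<partial>lborel) = \<phi> (x \<bullet> u) * indicator K x" .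
  qed
  finally show ?thesis .
qed

text \<open>
  The cylinder of height \<open>c\<close> over a section has volume \<open>c\<close> times the section volume by Tonelli's
  theorem. Shrinking it by the factor \<open>1 / c\<close> in all directions gives the cylinder of height one
  over the section shrunk by \<open>1 / c\<close>; this yields the exponent \<open>DIM('a) - 1\<close> without a determinant.
\<close>

lemma emeasure_section_dilate:
  fixes K :: "'a::euclidean_space set"
  assumes K: "compact K" and u: "norm u = 1" and c: "0 < c"
  shows "ennreal (c ^ (DIM('a) - 1)) *
      emeasure lborel {x. 0 \<le> x \<bullet> u \<and> x \<bullet> u \<le> 1 \<and> c *\<^sub>R (x - (x \<bullet> u) *\<^sub>R u) + t *\<^sub>R u \<in> K}
    = ennreal (section_vol K u t)"
proof -
  have uu: "u \<bullet> u = 1" using u by (simp add: dot_square_norm)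
  have [measurable]: "K \<in> sets borel" using K by (rule borel_compact)
  define L where "L = {z. 0 \<le> z \<bullet> u \<and> z \<bullet> u \<le> c \<and> z + (t - z \<bullet> u) *\<^sub>R u \<in> K}"
  have "{z \<in> space borel. 0 \<le> z \<bullet> u \<and> z \<bullet> u \<le> c \<and> z + (t - z \<bullet> u) *\<^sub>R u \<in> K} \<in> sets borel"
    by measurable
  then have L: "L \<in> sets borel" by (simp add: L_def)
  have "section_cyl L u \<tau> = (if \<tau> \<in> {0..c} then section_cyl K u t else {})" for \<tau>
    using uu by (auto simp: section_cyl_def L_def inner_add_left inner_diff_left algebra_simps)
  then have "(\<integral>\<^sup>+\<tau>. 1 * emeasure lborel (section_cyl L u \<tau>) \<partial>lborel)
      = (\<integral>\<^sup>+\<tau>. ennreal (section_vol K u t) * indicator {0..c} \<tau> \<partial>lborel)"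
    by (intro nn_integral_cong) (auto simp: emeasure_section_cyl[OF K u])
  also have "\<dots> = ennreal (section_vol K u t) * ennreal c"
    using c by (simp add: nn_integral_cmult_indicator)
  finally have "emeasure lborel L = ennreal (section_vol K u t) * ennreal c"
    using nn_integral_sections[OF L _ u, of "\<lambda>_. 1"] L by simp
  moreover have "emeasure lborel L = ennreal (c ^ DIM('a)) * emeasure lborel {x. c *\<^sub>R x \<in> L}"
    by (rule emeasure_lborel_scaleR[OF L c])
  moreover have "{x. c *\<^sub>R x \<in> L} = {x. 0 \<le> x \<bullet> u \<and> x \<bullet> u \<le> 1 \<and> c *\<^sub>R (x - (x \<bullet> u) *\<^sub>R u) + t *\<^sub>R u \<in> K}"
    using c by (auto simp: L_def algebra_simps zero_le_mult_iff)
  moreover have "ennreal (c ^ DIM('a)) = ennreal (c ^ (DIM('a) - 1)) * ennreal c"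
    using c DIM_positive[where 'a='a] by (simp add: ennreal_mult'[symmetric] power_Suc2[symmetric] del: power_Suc)
  ultimately have "(ennreal (c ^ (DIM('a) - 1)) *
      emeasure lborel {x. 0 \<le> x \<bullet> u \<and> x \<bullet> u \<le> 1 \<and> c *\<^sub>R (x - (x \<bullet> u) *\<^sub>R u) + t *\<^sub>R u \<in> K}) * ennreal c
    = ennreal (section_vol K u t) * ennreal c"
    by (simp add: mult_ac)
  then show ?thesis using c
    by (auto simp: mult.commute[of _ "ennreal c"] ennreal_mult_cancel_left)
qed

text \<open>
  The cone with apex \<open>p\<close> over the section at height \<open>t\<close> is contained in \<open>K\<close>.
\<close>

lemma section_vol_shrink:
  fixes K :: "'a::euclidean_space set"
  assumes K: "compact K" "convex K" and u: "norm u = 1" and p: "p \<in> K" and l: "0 < l" "l \<le> 1"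
  shows "l ^ (DIM('a) - 1) * section_vol K u t \<le> section_vol K u ((1 - l) * (p \<bullet> u) + l * t)"
proof -
  have uu: "u \<bullet> u = 1" using u by (simp add: dot_square_norm)
  let ?m = "DIM('a) - 1"
  define q where "q = (1 - l) *\<^sub>R (p - (p \<bullet> u) *\<^sub>R u)"
  let ?D = "{x. 0 \<le> x \<bullet> u \<and> x \<bullet> u \<le> 1 \<and> (1/l) *\<^sub>R (x - (x \<bullet> u) *\<^sub>R u) + t *\<^sub>R u \<in> K}"
  let ?r = "(1 - l) * (p \<bullet> u) + l * t"
  have "?D \<subseteq> {x. q + x \<in> section_cyl K u ?r}"
  proof
    fix x assume x: "x \<in> ?D"
    then have "(1 - l) *\<^sub>R p + l *\<^sub>R ((1/l) *\<^sub>R (x - (x \<bullet> u) *\<^sub>R u) + t *\<^sub>R u) \<in> K"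
      using K p l by (auto intro: convexD)
    moreover have q: "q \<bullet> u = 0" by (simp add: q_def inner_diff_left uu)
    moreover have "(1 - l) *\<^sub>R p + l *\<^sub>R ((1/l) *\<^sub>R (x - (x \<bullet> u) *\<^sub>R u) + t *\<^sub>R u)
        = q + x + (?r - (q + x) \<bullet> u) *\<^sub>R u"
    proof -
      have "(q + x) \<bullet> u = x \<bullet> u" using q by (simp add: inner_add_left)
      then show ?thesis using l by (simp only:) (simp add: q_def algebra_simps)
    qed
    ultimately show "x \<in> {x. q + x \<in> section_cyl K u ?r}"
      using x by (simp add: section_cyl_def inner_add_left)
  qed
  moreover have C: "section_cyl K u ?r \<in> sets borel"
    by (rule borel_compact[OF compact_section_cyl[OF K(1) u]])
  ultimately have "emeasure lborel ?D \<le> emeasure lborel {x. q + x \<in> section_cyl K u ?r}"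
    using measurable_sets[of "(+) q" borel borel "section_cyl K u ?r"] by (intro emeasure_mono) (auto simp: vimage_def)
  then have le: "emeasure lborel ?D \<le> ennreal (section_vol K u ?r)"
    by (simp add: emeasure_lborel_translate[OF C] emeasure_section_cyl[OF K(1) u])
  have "ennreal (l ^ ?m * section_vol K u t) = ennreal (l ^ ?m) * (ennreal ((1/l) ^ ?m) * emeasure lborel ?D)"
    using emeasure_section_dilate[OF K(1) u, of "1/l" t] l by (simp add: ennreal_mult)
  also have "\<dots> = ennreal (l ^ ?m * (1/l) ^ ?m) * emeasure lborel ?D"
    using l by (simp add: ennreal_mult mult.assoc)
  also have "l ^ ?m * (1/l) ^ ?m = 1" using l by (simp add: power_mult_distrib[symmetric])
  finally have "ennreal (l ^ ?m * section_vol K u t) \<le> ennreal (section_vol K u ?r)"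
    using le by simp
  then show ?thesis by (simp add: ennreal_le_iff)
qed

text \<open>
  The Brunn-Minkowski inequality for parallel sections. The Prekopa-Leindler inequality is
  multiplicative; dilating both sections to volume one and adapting the weight \<open>l\<close> to the dilation
  factors makes it additive. If a section has volume zero, the cone over the other one suffices.
\<close>

theorem section_vol_concave:
  fixes K :: "'a::euclidean_space set"
  assumes K: "compact K" "convex K" and u: "norm u = 1" and dim: "2 \<le> DIM('a)"
    and p: "p \<in> K" "p \<bullet> u = s" and q: "q \<in> K" "q \<bullet> u = t" and l: "0 \<le> l" "l \<le> 1"
  defines "m \<equiv> DIM('a) - 1"
  shows "(1 - l) * root m (section_vol K u s) + l * root m (section_vol K u t)
    \<le> root m (section_vol K u ((1 - l) * s + l * t))"
proof -
  have m: "0 < m" using dim by (simp add: m_def)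
  have uu: "u \<bullet> u = 1" using u by (simp add: dot_square_norm)
  let ?v = "section_vol K u" and ?r = "(1 - l) * s + l * t"
  consider "l = 0" | "l = 1" | "?v s = 0" "0 < l" | "?v t = 0" "l < 1" | "0 < l" "l < 1" "0 < ?v s" "0 < ?v t"
    using l section_vol_nonneg[of K u s] section_vol_nonneg[of K u t] by linarith
  then show ?thesis
  proof cases
    case 3
    have "l * root m (?v t) = root m (l ^ m * ?v t)"
      using m l by (simp add: real_root_mult real_root_power_cancel)
    also have "\<dots> \<le> root m (?v ?r)"
      using section_vol_shrink[OF K u p(1) 3(2) l(2), of t] m p by (simp add: m_def)
    finally show ?thesis using 3 by simp
  next
    case 4
    have "(1 - l) * root m (?v s) = root m ((1 - l) ^ m * ?v s)"
      using m l by (simp add: real_root_mult real_root_power_cancel)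
    also have "\<dots> \<le> root m (?v ?r)"
      using section_vol_shrink[OF K u q(1), of "1 - l" s] 4 l m q by (simp add: m_def add.commute)
    finally show ?thesis using 4 by simp
  next
    case 5
    define a b where "a = root m (?v s)" and "b = root m (?v t)"
    have ab: "0 < a" "0 < b" "a ^ m = ?v s" "b ^ m = ?v t"
      using 5 m by (auto simp: a_def b_def)
    define N where "N = (1 - l) * a + l * b"
    have N: "0 < N" using ab 5 by (auto simp: N_def intro: add_pos_pos)
    \<comment> \<open>with this weight, \<open>N\<close> times the combination of the dilated sections is the original combination\<close>
    define k where "k = l * b / N"
    have k: "0 < k" "k < 1" "1 - k = (1 - l) * a / N"
      using N ab 5 by (auto simp: k_def field_simps) (auto simp: N_def algebra_simps)
    define D where "D c r = {x. 0 \<le> x \<bullet> u \<and> x \<bullet> u \<le> 1 \<and> c *\<^sub>R (x - (x \<bullet> u) *\<^sub>R u) + r *\<^sub>R u \<in> K}" for c r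
    have D[measurable]: "D c r \<in> sets borel" for c r
    proof -
      have [measurable]: "K \<in> sets borel" using K(1) by (rule borel_compact)
      have "{x \<in> space borel. 0 \<le> x \<bullet> u \<and> x \<bullet> u \<le> 1 \<and> c *\<^sub>R (x - (x \<bullet> u) *\<^sub>R u) + r *\<^sub>R u \<in> K} \<in> sets borel"
        by measurable
      then show ?thesis by (simp add: D_def)
    qed
    have vol: "emeasure lborel (D c r) = ennreal (?v r / c ^ m)" if "0 < c" for c r
    proof -
      have "ennreal (c ^ m) * emeasure lborel (D c r) = ennreal (?v r)"
        using emeasure_section_dilate[OF K(1) u that, of r] by (simp add: D_def m_def)
      also have "\<dots> = ennreal (c ^ m) * ennreal (?v r / c ^ m)"
        using that by (simp add: ennreal_mult'[symmetric])
      finally show ?thesis using that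
        by (metis ennreal_mult_cancel_left ennreal_eq_0_iff ennreal_neq_top not_less zero_less_power)
    qed
    have "geomean_le k (emeasure lborel (D a s)) (emeasure lborel (D b t)) (emeasure lborel (D N ?r))"
    proof (rule prekopa_leindler_sets[OF D D D k(1,2)])
      fix x y :: 'a assume x: "x \<in> D a s" and y: "y \<in> D b t"
      have "(1 - l) *\<^sub>R (a *\<^sub>R (x - (x \<bullet> u) *\<^sub>R u) + s *\<^sub>R u) + l *\<^sub>R (b *\<^sub>R (y - (y \<bullet> u) *\<^sub>R u) + t *\<^sub>R u) \<in> K"
        using convexD[OF K(2), of "a *\<^sub>R (x - (x \<bullet> u) *\<^sub>R u) + s *\<^sub>R u"
            "b *\<^sub>R (y - (y \<bullet> u) *\<^sub>R u) + t *\<^sub>R u" "1 - l" l] x y 5 by (simp add: D_def)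
      moreover have "N * (1 - k) = (1 - l) * a" "N * k = l * b"
        using N by (auto simp: k(3)) (auto simp: k_def)
      then have "N *\<^sub>R ((1 - k) *\<^sub>R x + k *\<^sub>R y) = ((1 - l) * a) *\<^sub>R x + (l * b) *\<^sub>R y"
        "N * (((1 - k) *\<^sub>R x + k *\<^sub>R y) \<bullet> u) = ((1 - l) * a) * (x \<bullet> u) + (l * b) * (y \<bullet> u)"
        by (simp_all only: scaleR_add_right scaleR_scaleR inner_add_left inner_scaleR_left distrib_left mult.assoc[symmetric])
      then have "N *\<^sub>R (((1 - k) *\<^sub>R x + k *\<^sub>R y) - (((1 - k) *\<^sub>R x + k *\<^sub>R y) \<bullet> u) *\<^sub>R u) + ?r *\<^sub>R u
        = (1 - l) *\<^sub>R (a *\<^sub>R (x - (x \<bullet> u) *\<^sub>R u) + s *\<^sub>R u) + l *\<^sub>R (b *\<^sub>R (y - (y \<bullet> u) *\<^sub>R u) + t *\<^sub>R u)"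
        by (simp only: scaleR_diff_right scaleR_scaleR) (simp add: algebra_simps)
      ultimately have "N *\<^sub>R (((1 - k) *\<^sub>R x + k *\<^sub>R y) - (((1 - k) *\<^sub>R x + k *\<^sub>R y) \<bullet> u) *\<^sub>R u) + ?r *\<^sub>R u \<in> K"
        by simp
      moreover have "0 \<le> (1 - k) * (x \<bullet> u) + k * (y \<bullet> u)"
        using x y k(1,2) by (simp add: D_def)
      moreover have "(1 - k) * (x \<bullet> u) + k * (y \<bullet> u) \<le> 1"
        using x y k(1,2) by (intro convex_bound_le) (simp_all add: D_def)
      ultimately show "(1 - k) *\<^sub>R x + k *\<^sub>R y \<in> D N ?r" by (simp add: D_def inner_add_left)
    qed
    moreover have "emeasure lborel (D a s) = ennreal 1" "emeasure lborel (D b t) = ennreal 1"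
      using vol[OF ab(1), of s] vol[OF ab(2), of t] ab 5 by simp_all
    ultimately have "geomean_le k (ennreal 1) (ennreal 1) (ennreal (?v ?r / N ^ m))"
      using vol[OF N, of ?r] D by simp
    then have "1 \<le> ?v ?r / N ^ m"
      using geomean_leD[of k 1 1 "?v ?r / N ^ m"] k N by simp
    then have "N ^ m \<le> ?v ?r" using N by (simp add: field_simps)
    then have "root m (N ^ m) \<le> root m (?v ?r)" using m by (simp only: real_root_le_iff)
    moreover have "root m (N ^ m) = N" using m N by (intro real_root_power_cancel) auto
    ultimately show ?thesis by (simp add: N_def a_def b_def)
  qed auto
qed

lemma borel_measurable_section_vol:
  fixes K :: "'a::euclidean_space set"
  assumes K: "compact K" and u: "norm u = 1"
  shows "section_vol K u \<in> borel_measurable borel"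
proof -
  have [measurable]: "K \<in> sets borel" using K by (rule borel_compact)
  have "{p \<in> space (borel \<Otimes>\<^sub>M borel). 0 \<le> snd p \<bullet> u \<and> snd p \<bullet> u \<le> 1 \<and> snd p + (fst p - snd p \<bullet> u) *\<^sub>R u \<in> K}
      \<in> sets (borel \<Otimes>\<^sub>M (borel :: 'a measure))"
    by measurable
  then have "{p. 0 \<le> snd p \<bullet> u \<and> snd p \<bullet> u \<le> 1 \<and> snd p + (fst p - snd p \<bullet> u) *\<^sub>R u \<in> K}
      \<in> sets (lborel \<Otimes>\<^sub>M lborel)"
    by (simp add: space_pair_measure)
  from lborel.measurable_emeasure_Pair[OF this]
  have "(\<lambda>t. emeasure lborel (section_cyl K u t)) \<in> borel_measurable borel"
    by (simp add: section_cyl_def vimage_def)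
  then have "(\<lambda>t. enn2real (emeasure lborel (section_cyl K u t))) \<in> borel_measurable borel"
    by measurable
  then show ?thesis by (simp add: section_vol_def[abs_def] measure_def)
qed

lemma section_integral:
  fixes K :: "'a::euclidean_space set"
  assumes K: "compact K" and u: "norm u = 1" and w: "0 < w"
    and range: "\<And>x. x \<in> K \<Longrightarrow> c \<le> x \<bullet> u \<and> x \<bullet> u \<le> c + w"
    and \<psi>: "continuous_on UNIV \<psi>" "\<And>s. 0 \<le> s \<Longrightarrow> s \<le> 1 \<Longrightarrow> 0 \<le> \<psi> s"
  shows "((\<lambda>s. \<psi> s * (w * section_vol K u (c + w * s))) has_integral
    set_lebesgue_integral lborel K (\<lambda>x. \<psi> ((x \<bullet> u - c) / w))) {0..1}"
proof -
  have [measurable]: "K \<in> sets borel" using K by (rule borel_compact)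
  have [measurable]: "section_vol K u \<in> borel_measurable borel"
    by (rule borel_measurable_section_vol[OF K u])
  have [measurable]: "\<psi> \<in> borel_measurable borel" using \<psi>(1) by (rule borel_measurable_continuous_onI)
  have unit: "0 \<le> (x \<bullet> u - c) / w" "(x \<bullet> u - c) / w \<le> 1" if "x \<in> K" for x
    using range[OF that] w by (auto simp: field_simps)
  have zero: "section_vol K u t = 0" if "t < c \<or> c + w < t" for t
  proof -
    have uu: "u \<bullet> u = 1" using u by (simp add: dot_square_norm)
    have "(x + (t - x \<bullet> u) *\<^sub>R u) \<bullet> u = t" for x by (simp add: inner_add_left uu)
    then have "section_cyl K u t = {}" using range that by (force simp: section_cyl_def)
    then show ?thesis by (simp add: section_vol_def)
  qed
  have cont: "continuous_on K (\<lambda>x. \<psi> ((x \<bullet> u - c) / w))"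
    using w by (intro continuous_on_compose2[OF \<psi>(1)] continuous_intros) auto
  have int: "integrable lborel (\<lambda>x. indicator K x *\<^sub>R \<psi> ((x \<bullet> u - c) / w))"
    by (rule borel_integrable_compact[OF K cont])
  let ?\<phi> = "\<lambda>t. ennreal (\<psi> ((t - c) / w))"
  have "(\<integral>\<^sup>+s. ennreal (\<psi> s * (w * section_vol K u (c + w * s)) * indicator {0..1} s) \<partial>lborel)
      = (\<integral>\<^sup>+s. ennreal w * (?\<phi> (c + w * s) * ennreal (section_vol K u (c + w * s))) \<partial>lborel)"
  proof (intro nn_integral_cong)
    fix s :: real
    show "ennreal (\<psi> s * (w * section_vol K u (c + w * s)) * indicator {0..1} s)
        = ennreal w * (?\<phi> (c + w * s) * ennreal (section_vol K u (c + w * s)))"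
    proof (cases "s \<in> {0..1}")
      case True
      then show ?thesis using w \<psi>(2)[of s] by (simp add: ennreal_mult'[symmetric] mult_ac)
    next
      case False
      then have "w * s < 0 \<or> w < w * s" using w by (auto simp: mult_less_0_iff not_le)
      then have "section_vol K u (c + w * s) = 0" by (intro zero) auto
      then show ?thesis using False by simp
    qed
  qed
  also have "\<dots> = ennreal w * (\<integral>\<^sup>+s. ?\<phi> (c + w * s) * ennreal (section_vol K u (c + w * s)) \<partial>lborel)"
    by (rule nn_integral_cmult) measurable
  also have "\<dots> = (\<integral>\<^sup>+t. ?\<phi> t * ennreal (section_vol K u t) \<partial>lborel)"
    using w by (subst nn_integral_real_affine[of _ w c]) simp_all
  also have "\<dots> = (\<integral>\<^sup>+x. ?\<phi> (x \<bullet> u) * indicator K x \<partial>lborel)"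
    using nn_integral_sections[of K ?\<phi> u] u by (simp add: emeasure_section_cyl[OF K u])
  also have "\<dots> = (\<integral>\<^sup>+x. ennreal (indicator K x *\<^sub>R \<psi> ((x \<bullet> u - c) / w)) \<partial>lborel)"
    by (intro nn_integral_cong) (auto simp: indicator_def)
  also have "\<dots> = ennreal (set_lebesgue_integral lborel K (\<lambda>x. \<psi> ((x \<bullet> u - c) / w)))"
    unfolding set_lebesgue_integral_def
    by (rule nn_integral_eq_integral[OF int]) (auto simp: indicator_def \<psi>(2) unit)
  finally have nn: "(\<integral>\<^sup>+s. ennreal (\<psi> s * (w * section_vol K u (c + w * s)) * indicator {0..1} s) \<partial>lborel)
      = ennreal (set_lebesgue_integral lborel K (\<lambda>x. \<psi> ((x \<bullet> u - c) / w)))" .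
  have "((\<lambda>s. \<psi> s * (w * section_vol K u (c + w * s)) * indicator {0..1} s) has_integral
      set_lebesgue_integral lborel K (\<lambda>x. \<psi> ((x \<bullet> u - c) / w))) UNIV"
  proof (rule nn_integral_has_integral[OF _ _ nn])
    show "0 \<le> \<psi> s * (w * section_vol K u (c + w * s)) * indicator {0..1} s" for s
      using w \<psi>(2)[of s] by (auto simp: indicator_def)
    show "0 \<le> set_lebesgue_integral lborel K (\<lambda>x. \<psi> ((x \<bullet> u - c) / w))"
      unfolding set_lebesgue_integral_def
      by (rule integral_nonneg_AE) (auto simp: indicator_def \<psi>(2) unit)
  qed measurable
  then have "((\<lambda>s. if s \<in> {0..1} then \<psi> s * (w * section_vol K u (c + w * s)) else 0) has_integral
      set_lebesgue_integral lborel K (\<lambda>x. \<psi> ((x \<bullet> u - c) / w))) UNIV"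
    by (simp add: indicator_def of_bool_def if_distrib cong: if_cong)
  then show ?thesis by (simp only: has_integral_restrict_UNIV)
qed

section \<open>The Hausdorff measure of a face\<close>

text \<open>
  The volume of a ball as the integral of the volumes of its parallel sections, which are balls of
  radius \<open>sqrt (r^2 - (s - c)^2)\<close> in one dimension less.
\<close>

lemma nn_integral_ball_slices:
  assumes r: "0 \<le> r"
  shows "(\<integral>\<^sup>+s. ennreal (unit_ball_vol (real k) * sqrt (r\<^sup>2 - (s - c)\<^sup>2) ^ k) * indicator {c - r..c + r} s \<partial>lborel)
    = ennreal (unit_ball_vol (real (Suc k)) * r ^ Suc k)" (is "?L = _")
proof (cases "r = 0")
  case True
  have "?L = (\<integral>\<^sup>+(s::real). 0 \<partial>lborel)"
    using AE_lborel_singleton[of c] True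
    by (intro nn_integral_cong_AE) (auto simp: indicator_def elim!: eventually_mono)
  then show ?thesis using True by simp
next
  case False
  with r have r: "0 < r" by simp
  have ind: "indicator {c - r..c + r} (c + r * s) = (indicator {-1..1} s :: ennreal)" for s
  proof -
    have "r * s \<le> r \<longleftrightarrow> s \<le> 1" "- r \<le> r * s \<longleftrightarrow> -1 \<le> s"
      using r mult_le_cancel_left_pos[of r s 1] mult_le_cancel_left_pos[of r "-1" s] by auto
    then show ?thesis by (auto simp: indicator_def)
  qed
  have "?L = ennreal r * (\<integral>\<^sup>+s. ennreal (unit_ball_vol (real k) * sqrt (r\<^sup>2 - (r * s)\<^sup>2) ^ k) * indicator {-1..1} s \<partial>lborel)"
    using r by (subst nn_integral_real_affine[where c=r and t=c]) (simp_all add: ind)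
  also have "(\<lambda>s. ennreal (unit_ball_vol (real k) * sqrt (r\<^sup>2 - (r * s)\<^sup>2) ^ k) * indicator {-1..1} s)
      = (\<lambda>s. ennreal (unit_ball_vol (real k) * r ^ k) * ennreal (indicator {-1..1} s * sqrt (1 - s\<^sup>2) ^ k))"
  proof
    fix s :: real
    have "r\<^sup>2 - (r * s)\<^sup>2 = r\<^sup>2 * (1 - s\<^sup>2)" by (simp add: power_mult_distrib algebra_simps)
    then have "sqrt (r\<^sup>2 - (r * s)\<^sup>2) = r * sqrt (1 - s\<^sup>2)"
      using r by (simp add: real_sqrt_mult)
    then show "ennreal (unit_ball_vol (real k) * sqrt (r\<^sup>2 - (r * s)\<^sup>2) ^ k) * indicator {-1..1} s
      = ennreal (unit_ball_vol (real k) * r ^ k) * ennreal (indicator {-1..1} s * sqrt (1 - s\<^sup>2) ^ k)"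
      using r by (auto simp: indicator_def power_mult_distrib mult_ac ennreal_mult'[symmetric])
  qed
  also have "ennreal r * (\<integral>\<^sup>+s. ennreal (unit_ball_vol (real k) * r ^ k) * ennreal (indicator {-1..1} s * sqrt (1 - s\<^sup>2) ^ k) \<partial>lborel)
      = ennreal r * (ennreal (unit_ball_vol (real k) * r ^ k) * ennreal (Beta (1/2) (real k / 2 + 1)))"
    by (subst nn_integral_cmult) (auto simp: emeasure_cball_aux_integral)
  also have "\<dots> = ennreal (unit_ball_vol k * Beta (1/2) (k / 2 + 1) * r ^ Suc k)"
    using r by (simp add: ennreal_mult' [symmetric] mult_ac)
  also have "unit_ball_vol k * Beta (1/2) (k / 2 + 1) = unit_ball_vol (Suc k)"
    by (auto simp: unit_ball_vol_def Beta_def Gamma_eq_zero_iff field_simps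
          Gamma_one_half_real powr_half_sqrt [symmetric] powr_add [symmetric])
  finally show ?thesis .
qed

text \<open>
  Enumerates a countable family by the natural numbers without repetition, filling up with a
  default element \<open>d\<close>, so that sums over the family become series.
\<close>

lemma countable_family_sequence:
  assumes "countable C"
  obtains q :: "nat \<Rightarrow> 'b" where "C \<subseteq> range q" "range q \<subseteq> insert d C"
    "\<And>f. f d = 0 \<Longrightarrow> (\<Sum>i. f (q i)) = (\<integral>\<^sup>+p. f p \<partial>count_space C)"
proof -
  let ?I = "to_nat_on C ` C"
  define q where "q i = (if i \<in> ?I then from_nat_into C i else d)" for i
  have bij: "bij_betw (from_nat_into C) ?I C"
    using assms by (intro bij_betwI[where g = "to_nat_on C"]) auto
  have "C \<subseteq> range q"
  proof
    fix x assume "x \<in> C"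
    then have "q (to_nat_on C x) = x" using assms by (simp add: q_def)
    then show "x \<in> range q" by (metis rangeI)
  qed
  moreover have "range q \<subseteq> insert d C"
    using assms by (auto simp: q_def)
  moreover have "(\<Sum>i. f (q i)) = (\<integral>\<^sup>+p. f p \<partial>count_space C)" if "f d = 0" for f :: "'b \<Rightarrow> ennreal"
  proof -
    have "(\<Sum>i. f (q i)) = (\<integral>\<^sup>+i. f (q i) \<partial>count_space UNIV)"
      by (simp add: nn_integral_count_space_nat)
    also have "\<dots> = (\<integral>\<^sup>+i. f (from_nat_into C i) \<partial>count_space ?I)"
      using that by (subst nn_integral_count_space_indicator[of ?I]) (auto intro!: nn_integral_cong simp: q_def indicator_def)
    also have "\<dots> = (\<integral>\<^sup>+p. f p \<partial>count_space C)"
      by (rule nn_integral_bij_count_space[OF bij])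
    finally show ?thesis .
  qed
  ultimately show ?thesis by (rule that)
qed

text \<open>
  Vitali's covering theorem fills an open neighbourhood of \<open>S\<close> with disjoint small balls up to a
  null set. That null set is covered by the 5-fold enlargements of disjoint balls in an open set of
  small measure.
\<close>

lemma efficient_ball_cover:
  fixes S :: "'a::euclidean_space set"
  assumes S: "S \<in> sets borel" and d: "0 < d" and e: "0 < e"
  obtains x :: "nat \<Rightarrow> 'a" and r where "\<And>i. r i \<le> d" "S \<subseteq> (\<Union>i. cball (x i) (r i))"
    "(\<Sum>i. emeasure lborel (cball (x i) (r i))) \<le> emeasure lborel S + ennreal e"
proof -
  let ?n = "DIM('a)"
  let ?ball = "\<lambda>p::'a \<times> real. cball (fst p) (snd p)"
  define e1 where "e1 = e / 2"
  \<comment> \<open>the 5-fold enlargement multiplies volumes by \<open>5 ^ ?n\<close>\<close>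
  define e2 where "e2 = e / 2 / 5 ^ ?n"
  have e12: "0 < e1" "0 < e2" "e1 + 5 ^ ?n * e2 = e" using e by (auto simp: e1_def e2_def)
  obtain U where U: "open U" "S \<subseteq> U" "emeasure lborel (U - S) < ennreal e1"
    using outer_regular_lborel[OF S e12(1)] by auto
  define K1 where "K1 = {p. 0 < snd p \<and> snd p \<le> d \<and> ?ball p \<subseteq> U}"
  obtain C1 where C1: "countable C1" "C1 \<subseteq> K1" "pairwise (\<lambda>i j. disjnt (?ball i) (?ball j)) C1"
    "negligible (S - (\<Union>i\<in>C1. ?ball i))"
  proof (rule Vitali_covering_theorem_cballs[of K1 snd S fst])
    fix x \<rho> assume x: "x \<in> S" and \<rho>: "0 < (\<rho>::real)"
    obtain \<epsilon> where \<epsilon>: "0 < \<epsilon>" "cball x \<epsilon> \<subseteq> U" using U x open_contains_cball by (metis subsetD)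
    show "\<exists>i. i \<in> K1 \<and> x \<in> ?ball i \<and> snd i < \<rho>"
      using \<epsilon> \<rho> d subset_cball[of "min d (min \<epsilon> (\<rho>/2))" \<epsilon> x]
      by (intro exI[of _ "(x, min d (min \<epsilon> (\<rho>/2)))"]) (auto simp: K1_def)
  qed (auto simp: K1_def)
  define N where "N = S - (\<Union>i\<in>C1. ?ball i)"
  have N: "N \<in> sets borel" unfolding N_def
    using S C1(1) by (intro sets.Diff sets.countable_UN') auto
  have "emeasure lborel N = 0"
    using C1(4) N by (simp add: N_def[symmetric] negligible_iff_emeasure0)
  obtain U2 where U2: "open U2" "N \<subseteq> U2" "emeasure lborel (U2 - N) < ennreal e2"
    using outer_regular_lborel[OF N e12(2)] by auto
  have "emeasure lborel U2 \<le> emeasure lborel N + emeasure lborel (U2 - N)"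
    using U2 N emeasure_subadditive[of N lborel "U2 - N"] by (simp add: Un_absorb1)
  with U2 \<open>emeasure lborel N = 0\<close> have eU2: "emeasure lborel U2 \<le> ennreal e2" by simp
  define K2 where "K2 = {p. 0 < snd p \<and> snd p \<le> d / 5 \<and> ?ball p \<subseteq> U2}"
  obtain C2 where C2: "countable C2" "C2 \<subseteq> K2" "pairwise (\<lambda>i j. disjnt (?ball i) (?ball j)) C2"
    "N \<subseteq> (\<Union>i\<in>C2. cball (fst i) (5 * snd i))"
  proof (rule Vitali_covering_lemma_cballs[of N fst snd K2 "d / 5"])
    show "N \<subseteq> (\<Union>i\<in>K2. ?ball i)"
    proof
      fix x assume "x \<in> N"
      then obtain \<epsilon> where \<epsilon>: "0 < \<epsilon>" "cball x \<epsilon> \<subseteq> U2" using U2 open_contains_cball by (metis subsetD)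
      show "x \<in> (\<Union>i\<in>K2. ?ball i)"
        using \<epsilon> d subset_cball[of "min (d / 5) \<epsilon>" \<epsilon> x]
        by (intro UN_I[of "(x, min (d / 5) \<epsilon>)"]) (auto simp: K2_def)
    qed
  qed (auto simp: K2_def)
  define C where "C = C1 \<union> (\<lambda>p. (fst p, 5 * snd p)) ` C2"
  have disj: "(\<integral>\<^sup>+p. emeasure lborel (?ball p) \<partial>count_space D) = emeasure lborel (\<Union>p\<in>D. ?ball p)"
    if "countable D" "pairwise (\<lambda>i j. disjnt (?ball i) (?ball j)) D" for D
    using that by (intro emeasure_UN_countable[symmetric])
      (auto simp: disjoint_family_on_def pairwise_def disjnt_def)
  have 1: "(\<integral>\<^sup>+p. emeasure lborel (?ball p) \<partial>count_space C1) \<le> emeasure lborel S + ennreal e1"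
  proof -
    have "(\<integral>\<^sup>+p. emeasure lborel (?ball p) \<partial>count_space C1) \<le> emeasure lborel U"
      unfolding disj[OF C1(1,3)] using C1(2) U(1) by (intro emeasure_mono) (auto simp: K1_def)
    also have "\<dots> \<le> emeasure lborel S + emeasure lborel (U - S)"
      using U S emeasure_subadditive[of S lborel "U - S"] by (simp add: Un_absorb1)
    also have "\<dots> \<le> emeasure lborel S + ennreal e1" using U by (intro add_left_mono) simp
    finally show ?thesis .
  qed
  have scale: "emeasure lborel (cball x (5 * r)) = ennreal (5 ^ ?n) * emeasure lborel (cball x r)"
    if "0 \<le> r" for x :: 'a and r
    using that by (simp add: emeasure_cball power_mult_distrib ennreal_mult'[symmetric] mult_ac)
  have 2: "(\<integral>\<^sup>+p. emeasure lborel (?ball p) \<partial>count_space ((\<lambda>p. (fst p, 5 * snd p)) ` C2)) \<le> ennreal (5 ^ ?n * e2)"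
  proof -
    have "bij_betw (\<lambda>p. (fst p, 5 * snd p)) C2 ((\<lambda>p. (fst p, 5 * snd p)) ` C2)"
      by (auto simp: bij_betw_def inj_on_def prod_eq_iff)
    from nn_integral_bij_count_space[OF this, of "\<lambda>p. emeasure lborel (?ball p)"]
    have "(\<integral>\<^sup>+p. emeasure lborel (?ball p) \<partial>count_space ((\<lambda>p. (fst p, 5 * snd p)) ` C2))
        = (\<integral>\<^sup>+p. emeasure lborel (cball (fst p) (5 * snd p)) \<partial>count_space C2)" by simp
    also have "\<dots> = (\<integral>\<^sup>+p. ennreal (5 ^ ?n) * emeasure lborel (?ball p) \<partial>count_space C2)"
      using C2(2) by (intro nn_integral_cong) (auto simp: K2_def intro!: scale)
    also have "\<dots> = ennreal (5 ^ ?n) * emeasure lborel (\<Union>p\<in>C2. ?ball p)"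
      by (simp add: nn_integral_cmult disj[OF C2(1,3)])
    also have "\<dots> \<le> ennreal (5 ^ ?n) * emeasure lborel U2"
      using C2(2) U2(1) by (intro mult_left_mono emeasure_mono) (auto simp: K2_def)
    also have "\<dots> \<le> ennreal (5 ^ ?n) * ennreal e2"
      using eU2 by (intro mult_left_mono) auto
    finally show ?thesis by (simp add: ennreal_mult')
  qed
  have "countable C" using C1 C2 by (simp add: C_def)
  \<comment> \<open>negative radii encode empty balls\<close>
  obtain q where q: "C \<subseteq> range q" "range q \<subseteq> insert (0, -1) C"
    "\<And>f. f (0::'a, -1::real) = 0 \<Longrightarrow> (\<Sum>i. f (q i)) = (\<integral>\<^sup>+p. f p \<partial>count_space C)"
    using countable_family_sequence[OF \<open>countable C\<close>, of "(0, -1)"] by blast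
  show ?thesis
  proof (rule that[of "\<lambda>i. snd (q i)" "\<lambda>i. fst (q i)"])
    fix i have "q i \<in> insert (0, -1) C" using q(2) by auto
    then show "snd (q i) \<le> d"
      using C1(2) C2(2) d by (auto simp: C_def K1_def K2_def)
  next
    have "S \<subseteq> (\<Union>p\<in>C. ?ball p)"
      using C2(4) by (force simp: C_def N_def)
    then show "S \<subseteq> (\<Union>i. ?ball (q i))" using q(1) by fastforce
  next
    have "(\<Sum>i. emeasure lborel (?ball (q i))) = (\<integral>\<^sup>+p. emeasure lborel (?ball p) \<partial>count_space C)"
      by (rule q(3)) simp
    also have "\<dots> = (\<integral>\<^sup>+p. emeasure lborel (?ball p) * indicator C p \<partial>count_space UNIV)"
      by (simp add: nn_integral_count_space_indicator)
    also have "\<dots> \<le> (\<integral>\<^sup>+p. emeasure lborel (?ball p) * indicator C1 p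
        + emeasure lborel (?ball p) * indicator ((\<lambda>p. (fst p, 5 * snd p)) ` C2) p \<partial>count_space UNIV)"
      by (intro nn_integral_mono) (auto simp: C_def indicator_def)
    also have "\<dots> = (\<integral>\<^sup>+p. emeasure lborel (?ball p) \<partial>count_space C1)
        + (\<integral>\<^sup>+p. emeasure lborel (?ball p) \<partial>count_space ((\<lambda>p. (fst p, 5 * snd p)) ` C2))"
      by (simp add: nn_integral_add nn_integral_count_space_indicator)
    also have "\<dots> \<le> (emeasure lborel S + ennreal e1) + ennreal (5 ^ ?n * e2)"
      by (intro add_mono 1 2)
    also have "\<dots> = emeasure lborel S + ennreal e"
      using e12 by (simp add: add.assoc ennreal_plus[symmetric] del: ennreal_plus)
    finally show "(\<Sum>i. emeasure lborel (?ball (q i))) \<le> emeasure lborel S + ennreal e" .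
  qed
qed

text \<open>
  The section of a ball by a hyperplane lies in a ball of the radius given by Pythagoras.
\<close>

lemma hausdorff_weight_ball_slice:
  fixes x :: "'a::euclidean_space"
  assumes u: "norm u = 1" and k: "0 < k"
  shows "hausdorff_weight k (cball x r \<inter> {y. y \<bullet> u = a})
    \<le> ennreal (unit_ball_vol (real k) * sqrt (r\<^sup>2 - (a - x \<bullet> u)\<^sup>2) ^ k) * indicator {x \<bullet> u - r..x \<bullet> u + r} a"
proof (cases "cball x r \<inter> {y. y \<bullet> u = a} = {}")
  case True
  then show ?thesis by (simp add: hausdorff_weight_def)
next
  case False
  let ?C = "cball x r \<inter> {y. y \<bullet> u = a}"
  have uu: "u \<bullet> u = 1" using u by (simp add: dot_square_norm)
  define x' where "x' = x + (a - x \<bullet> u) *\<^sub>R u"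
  define R where "R = sqrt (r\<^sup>2 - (a - x \<bullet> u)\<^sup>2)"
  have pyth: "(dist y x)\<^sup>2 = (dist y x')\<^sup>2 + (a - x \<bullet> u)\<^sup>2" if "y \<bullet> u = a" for y
    using that uu unfolding dist_norm power2_norm_eq_inner x'_def
    by (simp add: inner_diff_left inner_diff_right inner_add_left inner_add_right inner_commute algebra_simps power2_eq_square)
  obtain z where z: "z \<in> ?C" using False by blast
  have r: "0 \<le> r" using z zero_le_dist[of x z] by (auto simp del: zero_le_dist)
  have dz: "(dist y x)\<^sup>2 \<le> r\<^sup>2" if "y \<in> ?C" for y
    using that by (intro power_mono) (auto simp: dist_commute)
  have ar: "\<bar>a - x \<bullet> u\<bar> \<le> r"
  proof -
    have "z \<bullet> u = a" using z by simp
    from pyth[OF this] have "(a - x \<bullet> u)\<^sup>2 \<le> r\<^sup>2"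
      using dz[OF z] zero_le_power2[of "dist z x'"] by linarith
    then show ?thesis using r by (metis abs_of_nonneg power2_le_iff_abs_le)
  qed
  have sub: "?C \<subseteq> cball x' R"
  proof
    fix y assume y: "y \<in> ?C"
    then have "(dist y x')\<^sup>2 \<le> r\<^sup>2 - (a - x \<bullet> u)\<^sup>2" using pyth[of y] dz[OF y] by simp
    then show "y \<in> cball x' R" by (simp add: R_def dist_commute real_le_rsqrt)
  qed
  have R: "0 \<le> R" using sub z by (metis cball_eq_empty empty_iff not_less subsetD)
  have "diameter ?C \<le> 2 * R"
    using diameter_subset[OF sub] diameter_cball[of x' R] R by simp
  moreover have "0 \<le> diameter ?C" by (rule diameter_ge_0) (auto intro: bounded_Int)
  ultimately have "unit_ball_vol (real k) * (diameter ?C / 2) ^ k \<le> unit_ball_vol (real k) * R ^ k"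
    by (intro mult_left_mono power_mono) auto
  then show ?thesis
    using False ar unfolding hausdorff_weight_def R_def
    by (auto simp: indicator_def abs_le_iff intro!: ennreal_leI)
qed

text \<open>
  Cover the cylinder over \<open>S\<close> by small \<open>n\<close>-dimensional balls of almost minimal total volume. Each
  of its horizontal sections is a translate of \<open>S\<close>, covered by sections of these balls. These are
  \<open>(n-1)\<close>-dimensional balls, whose Hausdorff weight is their volume. Averaging the
  resulting bounds over the heights in \<open>[0, 1]\<close> gives the total volume of the \<open>n\<close>-dimensional balls.
\<close>

theorem hausdorff_le_section_vol:
  fixes S :: "'a::euclidean_space set"
  assumes S: "compact S" "S \<subseteq> {x. x \<bullet> u = a}" and u: "norm u = 1" and dim: "2 \<le> DIM('a)"
  shows "hausdorff_outer_measure (DIM('a) - 1) S \<le> ennreal (section_vol S u a)"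
proof -
  define k where "k = DIM('a) - 1"
  have k: "0 < k" "Suc k = DIM('a)" using dim by (auto simp: k_def)
  have uu: "u \<bullet> u = 1" using u by (simp add: dot_square_norm)
  have cyl: "section_cyl S u a \<in> sets borel"
    by (rule borel_compact[OF compact_section_cyl[OF S(1) u]])
  have bound: "hausdorff_premeasure k d S \<le> ennreal (section_vol S u a) + ennreal e"
    if d: "0 < d" and e: "0 < e" for d e
  proof -
    obtain x :: "nat \<Rightarrow> 'a" and r where xr: "\<And>i. r i \<le> d / 2" "section_cyl S u a \<subseteq> (\<Union>i. cball (x i) (r i))"
      "(\<Sum>i. emeasure lborel (cball (x i) (r i))) \<le> emeasure lborel (section_cyl S u a) + ennreal e"
      by (rule efficient_ball_cover[OF cyl half_gt_zero[OF d] e]) (rule that)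
    define w where "w i s = ennreal (unit_ball_vol (real k) * sqrt ((r i)\<^sup>2 - (s - x i \<bullet> u)\<^sup>2) ^ k)
        * indicator {x i \<bullet> u - r i..x i \<bullet> u + r i} s" for i s
    have le: "hausdorff_premeasure k d S \<le> (\<Sum>i. w i s)" if s: "s \<in> {0..1}" for s
    proof -
      \<comment> \<open>the balls are moved so that their sections at height \<open>s\<close> come to lie in the hyperplane of \<open>S\<close>\<close>
      define c where "c i = x i - (s - a) *\<^sub>R u" for i
      let ?C = "\<lambda>i. cball (c i) (r i) \<inter> {y. y \<bullet> u = a}"
      have "hausdorff_premeasure k d S \<le> (\<Sum>i. hausdorff_weight k (?C i))"
        unfolding hausdorff_premeasure_def
      proof (rule INF_lower, intro CollectI conjI allI)
        show "bounded (?C i)" for i by (auto intro: bounded_Int)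
        show "diameter (?C i) \<le> d" for i
        proof (cases "0 \<le> r i")
          case True
          have "diameter (?C i) \<le> diameter (cball (c i) (r i))" by (rule diameter_subset) auto
          then show ?thesis using xr(1)[of i] True by simp
        qed (use d in auto)
        show "S \<subseteq> (\<Union>i. ?C i)"
        proof
          fix y assume y: "y \<in> S"
          then have ya: "y \<bullet> u = a" using S by auto
          have "y + (s - a) *\<^sub>R u \<in> section_cyl S u a"
            using y ya s uu by (simp add: section_cyl_def inner_add_left algebra_simps)
          then obtain i where "y + (s - a) *\<^sub>R u \<in> cball (x i) (r i)" using xr(2) by blast
          then have "y \<in> cball (c i) (r i)" by (simp add: c_def dist_norm algebra_simps)
          with ya show "y \<in> (\<Union>i. ?C i)" by auto
        qed
      qed
      also have "\<dots> \<le> (\<Sum>i. w i s)"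
      proof (intro suminf_le)
        fix i
        have c: "c i \<bullet> u = x i \<bullet> u - (s - a)" by (simp add: c_def inner_diff_left uu)
        then have "a - c i \<bullet> u = s - x i \<bullet> u"
          "(indicator {c i \<bullet> u - r i..c i \<bullet> u + r i} a :: ennreal) = indicator {x i \<bullet> u - r i..x i \<bullet> u + r i} s"
          by (auto simp: indicator_def)
        then show "hausdorff_weight k (?C i) \<le> w i s"
          using hausdorff_weight_ball_slice[OF u k(1), of "c i" "r i" a] by (simp only: w_def)
      qed auto
      finally show ?thesis .
    qed
    have "hausdorff_premeasure k d S = (\<integral>\<^sup>+s. hausdorff_premeasure k d S * indicator {0..1::real} s \<partial>lborel)"
      by (simp add: nn_integral_cmult_indicator)
    also have "\<dots> \<le> (\<integral>\<^sup>+s. (\<Sum>i. w i s) \<partial>lborel)"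
      by (intro nn_integral_mono) (auto simp: indicator_def le)
    also have "\<dots> = (\<Sum>i. \<integral>\<^sup>+s. w i s \<partial>lborel)"
      by (rule nn_integral_suminf) (simp add: w_def)
    also have "\<dots> = (\<Sum>i. emeasure lborel (cball (x i) (r i)))"
    proof (rule suminf_cong)
      fix i
      show "(\<integral>\<^sup>+s. w i s \<partial>lborel) = emeasure lborel (cball (x i) (r i))"
      proof (cases "0 \<le> r i")
        case True
        then show ?thesis
          by (simp only: w_def nn_integral_ball_slices emeasure_cball k(2))
      next
        case False
        then have "w i s = 0" for s by (auto simp: w_def indicator_def)
        then show ?thesis using False by simp
      qed
    qed
    finally show ?thesis using xr(3) by (simp add: emeasure_section_cyl[OF S(1) u])
  qed
  have "hausdorff_premeasure k d S \<le> ennreal (section_vol S u a)" if "0 < d" for d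
    by (rule ennreal_le_epsilon) (rule bound[OF that])
  then show ?thesis unfolding hausdorff_outer_measure_def k_def[symmetric]
    by (intro SUP_least) simp
qed

text \<open>
  On the points with outer normal \<open>u\<close> the integrand \<open>x \<bullet> \<nu>(x)\<close> is the constant \<open>a\<close>, the largest
  height, and these points lie in the face at that height.
\<close>

lemma cone_volume_le_section:
  fixes K :: "'a::euclidean_space set"
  assumes K: "convex_body K" and u: "norm u = 1" and dim: "2 \<le> DIM('a)"
    and a: "\<And>x. x \<in> K \<Longrightarrow> x \<bullet> u \<le> a" and a0: "0 \<le> a" and z: "\<exists>z\<in>K. z \<bullet> u = a"
  shows "real DIM('a) * measure (cone_volume_measure K) {u} \<le> a * section_vol K u a"
proof -
  let ?n = "real DIM('a)" and ?H = "hausdorff_measure (DIM('a) - 1) :: 'a measure"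
  have c: "compact K" using K by (simp add: convex_body_def)
  define F where "F = K \<inter> {x. x \<bullet> u = a}"
  have F: "compact F" unfolding F_def
    by (intro compact_Int_closed c closed_Collect_eq continuous_intros)
  have cylF: "section_cyl F u a = section_cyl K u a"
    using u by (auto simp: section_cyl_def F_def inner_add_left dot_square_norm)
  have Fs: "F \<in> sets ?H"
    using sets_borel_subset_hausdorff_measure borel_compact[OF F] by blast
  have "emeasure (cone_volume_measure K) {u} =
    (\<integral>\<^sup>+ x \<in> {x \<in> regular_boundary K. gauss_map K x \<in> {u}}.
       ennreal (1 / ?n * (x \<bullet> gauss_map K x)) \<partial>?H)"
    using u by (intro emeasure_cone_volume_measure K) auto
  also have "\<dots> \<le> (\<integral>\<^sup>+ x. ennreal (a / ?n) * indicator F x \<partial>?H)"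
  proof (intro nn_integral_mono)
    fix x :: 'a
    show "ennreal (1 / ?n * (x \<bullet> gauss_map K x)) * indicator {x \<in> regular_boundary K. gauss_map K x \<in> {u}} x
        \<le> ennreal (a / ?n) * indicator F x"
    proof (cases "x \<in> regular_boundary K \<and> gauss_map K x = u")
      case True
      then have xK: "x \<in> K"
        using frontier_subset_compact[OF c] by (auto simp: regular_boundary_def)
      have "u \<in> outer_unit_normals K x" using True gauss_map_normal by blast
      then have m: "y \<bullet> u \<le> x \<bullet> u" if "y \<in> K" for y using that by (auto simp: outer_unit_normals_def)
      obtain z0 where z0: "z0 \<in> K" "z0 \<bullet> u = a" using z by blast
      then have xa: "x \<bullet> u = a" using m[OF z0(1)] a[OF xK] by linarith
      then have "x \<in> F" using xK by (simp add: F_def)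
      moreover have "1 / ?n * (x \<bullet> gauss_map K x) = a / ?n" using True xa by simp
      ultimately show ?thesis using True by (simp only: indicator_simps) simp
    next
      case False
      then have "x \<notin> {x \<in> regular_boundary K. gauss_map K x \<in> {u}}" by blast
      then have "indicator {x \<in> regular_boundary K. gauss_map K x \<in> {u}} x = (0::ennreal)"
        by (rule indicator_simps(2))
      then show ?thesis by (simp only: mult_zero_right zero_le)
    qed
  qed
  also have "\<dots> = ennreal (a / ?n) * emeasure ?H F"
    using Fs by (simp add: nn_integral_cmult_indicator)
  also have "\<dots> \<le> ennreal (a / ?n) * ennreal (section_vol F u a)"
    unfolding emeasure_hausdorff_measure[OF Fs]
    by (intro mult_left_mono hausdorff_le_section_vol F u dim) (auto simp: F_def)
  also have "\<dots> = ennreal (a * section_vol K u a / ?n)"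
    using a0 by (simp add: ennreal_mult'[symmetric] section_vol_def cylF)
  finally have "emeasure (cone_volume_measure K) {u} \<le> ennreal (a * section_vol K u a / ?n)" .
  then have "measure (cone_volume_measure K) {u} \<le> a * section_vol K u a / ?n"
    using a0 unfolding measure_def by (intro enn2real_leI) auto
  then show ?thesis by (simp add: field_simps)
qed

section \<open>The functional on pairs of cone volumes\<close>

text \<open>
  The left-hand side of the theorem in terms of \<open>x = n \<mu>(u) / V\<close> and \<open>y = n \<mu>(-u) / V\<close>.
\<close>

definition slab_functional :: "nat \<Rightarrow> real \<Rightarrow> real \<Rightarrow> real" where
  "slab_functional n x y = x + y + (real n + 1) ^ (n - 1) * \<bar>(x - y) / real n\<bar> ^ n"

lemma slab_functional_eq:
  assumes "0 < n"
  shows "slab_functional n x y = x + y + ((real n + 1) * \<bar>x - y\<bar> / real n) ^ n / (real n + 1)"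
proof -
  obtain k where k: "n = Suc k" using assms gr0_conv_Suc by blast
  have "((real n + 1) * \<bar>x - y\<bar> / real n) ^ n = (real n + 1) ^ n * \<bar>(x - y) / real n\<bar> ^ n"
    by (simp add: power_mult_distrib power_divide abs_divide)
  then have "((real n + 1) * \<bar>x - y\<bar> / real n) ^ n / (real n + 1) = (real n + 1) ^ (n - 1) * \<bar>(x - y) / real n\<bar> ^ n"
    by (simp add: k)
  then show ?thesis by (simp add: slab_functional_def)
qed

lemma power_diff_less_linear:
  fixes v v' :: real
  assumes "2 \<le> n" "0 \<le> v" "v < v'" "v' \<le> 1"
  shows "v' ^ n - v ^ n < real n * (v' - v)"
proof -
  have "(\<lambda>t. real n * t - t ^ n) v < (\<lambda>t. real n * t - t ^ n) v'"
  proof (rule DERIV_pos_imp_increasing_open[OF assms(3)])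
    fix t assume t: "v < t" "t < v'"
    have "t ^ (n - 1) < 1" using t assms power_strict_mono[of t 1 "n - 1"] by auto
    then have "0 < real n * (1 - t ^ (n - 1))" using assms by simp
    moreover have "((\<lambda>t. real n * t - t ^ n) has_real_derivative real n * (1 - t ^ (n - 1))) (at t)"
      by (auto intro!: derivative_eq_intros simp: algebra_simps)
    ultimately show "\<exists>y. ((\<lambda>t. real n * t - t ^ n) has_real_derivative y) (at t) \<and> 0 < y" by blast
  qed (intro continuous_intros)
  then show ?thesis by (simp add: algebra_simps)
qed

text \<open>
  In terms of \<open>v = (n+1) \<bar>x-y\<bar> / n\<close> the last summand is \<open>v^n / (n+1)\<close>. On \<open>0 \<le> v \<le> 1\<close> it is
  a 1-Lipschitz function of \<open>\<bar>x-y\<bar>\<close>, so that it cannot make up for a decrease of \<open>x + y\<close>. The bound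
  on \<open>v\<close> comes from \<open>X \<le> n / (n+1)\<close>, which follows from the hypothesis by Bernoulli's inequality.
\<close>

lemma slab_functional_mono:
  assumes n: "2 \<le> n" and xX: "0 \<le> x" "x \<le> X" and yY: "0 \<le> y" "y \<le> Y" "Y \<le> X" and slab_functional: "slab_functional n X Y \<le> 1"
  shows "slab_functional n x y \<le> 1" and "slab_functional n x y = 1 \<Longrightarrow> x = X \<and> y = Y \<and> slab_functional n X Y = 1"
proof -
  define v where "v = (real n + 1) * \<bar>x - y\<bar> / real n"
  define w where "w = (real n + 1) * \<bar>X - Y\<bar> / real n"
  have n0: "0 < n" using n by simp
  have F: "slab_functional n x y = x + y + v ^ n / (real n + 1)" "slab_functional n X Y = X + Y + w ^ n / (real n + 1)"
    using slab_functional_eq[OF n0] by (simp_all add: v_def w_def)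
  have v0: "0 \<le> v" and w0: "0 \<le> w" by (auto simp: v_def w_def)
  have "1 + real n * (w - 1) \<le> w ^ n" using Bernoulli_inequality[of "w - 1" n] w0 by simp
  then have "X + Y + (1 + real n * (w - 1)) / (real n + 1) \<le> X + Y + w ^ n / (real n + 1)"
    by (intro add_left_mono divide_right_mono) auto
  with slab_functional F have "X + Y + (1 + real n * (w - 1)) / (real n + 1) \<le> 1" by simp
  moreover have "real n * w = (real n + 1) * (X - Y)"
    using n0 yY by (simp add: w_def)
  ultimately have X: "X * (real n + 1) \<le> real n"
    by (simp add: field_simps)
  have le1: "(real n + 1) * z / real n \<le> 1" if "z \<le> X" for z
  proof -
    have "(real n + 1) * z \<le> (real n + 1) * X" using that by (intro mult_left_mono) auto
    then show ?thesis using X n0 by (simp add: field_simps)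
  qed
  have v1: "v \<le> 1" unfolding v_def using xX yY by (intro le1) auto
  have w1: "w \<le> 1" unfolding w_def using xX yY by (intro le1) auto
  have strict: "v ^ n - w ^ n < real n * \<bar>v - w\<bar>" if "v \<noteq> w"
  proof (cases "w < v")
    case True
    then show ?thesis using power_diff_less_linear[OF n w0 True v1] by simp
  next
    case False
    then have "v ^ n \<le> w ^ n" using v0 by (intro power_mono) auto
    moreover have "0 < real n * \<bar>v - w\<bar>" using that n0 by simp
    ultimately show ?thesis by linarith
  qed
  have "real n * (v - w) = (real n + 1) * (\<bar>x - y\<bar> - \<bar>X - Y\<bar>)"
    using n0 by (simp add: v_def w_def field_simps)
  then have "\<bar>real n * (v - w)\<bar> = \<bar>(real n + 1) * (\<bar>x - y\<bar> - \<bar>X - Y\<bar>)\<bar>" by simp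
  then have "real n * \<bar>v - w\<bar> = (real n + 1) * \<bar>\<bar>x - y\<bar> - \<bar>X - Y\<bar>\<bar>"
    by (simp only: abs_mult) simp
  also have "\<dots> \<le> (real n + 1) * ((X - x) + (Y - y))"
    using xX yY by (intro mult_left_mono) auto
  finally have vw: "real n * \<bar>v - w\<bar> / (real n + 1) \<le> (X - x) + (Y - y)"
    by (simp add: field_simps)
  have diff: "slab_functional n x y - slab_functional n X Y = (v ^ n - w ^ n) / (real n + 1) - ((X - x) + (Y - y))"
    unfolding F by (simp add: diff_divide_distrib)
  have lt: "slab_functional n x y < slab_functional n X Y" if "v \<noteq> w"
  proof -
    have "(v ^ n - w ^ n) / (real n + 1) < real n * \<bar>v - w\<bar> / (real n + 1)"
      using strict[OF that] by (intro divide_strict_right_mono) auto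
    with vw diff show ?thesis by linarith
  qed
  have eq: "slab_functional n x y = slab_functional n X Y - ((X - x) + (Y - y))" if "v = w"
    using diff that by simp
  show "slab_functional n x y \<le> 1" using lt eq slab_functional xX yY by (cases "v = w") auto
  assume "slab_functional n x y = 1"
  with lt slab_functional have "v = w" by force
  with eq \<open>slab_functional n x y = 1\<close> slab_functional xX yY show "x = X \<and> y = Y \<and> slab_functional n X Y = 1" by auto
qed

lemma slab_functional_commute: "slab_functional n x y = slab_functional n y x"
  by (simp add: slab_functional_def abs_minus_commute[of x y] abs_divide)

section \<open>Frusta\<close>

text \<open>
  Writing \<open>q = exp (-2 t)\<close>, the inequalities for the following three polynomials are, up to positive
  factors, \<open>sinh (2 n t) \<ge> n sinh (2 t)\<close>, \<open>sinh ((n-1) t) sinh (n t) \<ge> n (n-1) sinh^2 t cosh t\<close> and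
  \<open>n coth (n t) > coth t\<close>. Each follows from a recursion in \<open>n\<close> with a nonnegative remainder.
\<close>

definition frustum_N :: "nat \<Rightarrow> real \<Rightarrow> real" where
  "frustum_N n q = (1 - q ^ (2 * n)) - real n * q ^ (n - 1) * (1 - q\<^sup>2)"

lemma frustum_N_Suc:
  assumes "1 \<le> n"
  shows "frustum_N (Suc n) q = q * frustum_N n q + (1 - q) * (1 - q ^ n) * (1 - q ^ Suc n)"
proof -
  obtain k where "n = Suc k" using assms not0_implies_Suc by fastforce
  moreover have "q ^ (2 * k) = q ^ k * q ^ k" by (metis mult_2 power_add)
  ultimately show ?thesis by (simp add: frustum_N_def power2_eq_square algebra_simps)
qed

lemma frustum_N_nonneg:
  assumes "0 \<le> q" "q < 1" "1 \<le> n"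
  shows "0 \<le> frustum_N n q"
  using assms(3)
proof (induction n rule: dec_induct)
  case base
  have "frustum_N 1 q = 0" unfolding frustum_N_def by simp
  then show ?case by simp
next
  case (step k)
  have "0 \<le> (1 - q) * (1 - q ^ k) * (1 - q ^ Suc k)"
    using assms by (intro mult_nonneg_nonneg) (simp_all add: power_le_one del: power_Suc)
  moreover have "0 \<le> q * frustum_N k q" using step.IH assms(1) by (rule mult_nonneg_nonneg[rotated])
  ultimately show ?case unfolding frustum_N_Suc[OF step(1)] by linarith
qed

lemma frustum_N_pos:
  assumes "0 \<le> q" "q < 1" "2 \<le> n"
  shows "0 < frustum_N n q"
proof -
  obtain k where k: "n = Suc k" "1 \<le> k" using assms(3) by (cases n) auto
  have "q ^ k < 1" using power_strict_mono[of q 1 k] assms k by simp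
  moreover have "q ^ Suc k < 1" using power_strict_mono[of q 1 "Suc k"] assms by (simp del: power_Suc)
  ultimately have "0 < (1 - q) * (1 - q ^ k) * (1 - q ^ Suc k)"
    using assms by (intro mult_pos_pos) (simp_all del: power_Suc)
  moreover have "0 \<le> q * frustum_N k q" using assms frustum_N_nonneg[of q k] k by simp
  ultimately show ?thesis unfolding k frustum_N_Suc[OF k(2)] by linarith
qed

definition frustum_D :: "nat \<Rightarrow> real \<Rightarrow> real" where
  "frustum_D n q = 2 * (1 - q ^ (n - 1)) * (1 - q ^ n)
    - real n * (real n - 1) * q ^ (n - 2) * (1 - q)\<^sup>2 * (1 + q)"

lemma frustum_D_pos:
  assumes q: "0 \<le> q" "q < 1" and n: "3 \<le> n"
  shows "0 < frustum_D n q"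
proof -
  have Suc: "frustum_D (Suc n) q = q * frustum_D n q + 2 * (1 - q) * frustum_N n q" if n: "2 \<le> n" for n
  proof -
    obtain k where "n = Suc (Suc k)" by (rule that[of "n - 2"]) (use n in simp)
    moreover have "q ^ (2 * k) = q ^ k * q ^ k" by (metis mult_2 power_add)
    ultimately show ?thesis
      by (simp add: frustum_D_def frustum_N_def power2_eq_square algebra_simps)
  qed
  have nonneg: "0 \<le> frustum_D n q" if "2 \<le> n" for n
    using that
  proof (induction n rule: dec_induct)
    case base
    show ?case by (simp add: frustum_D_def power2_eq_square algebra_simps)
  next
    case (step k)
    have "0 < frustum_N k q" using frustum_N_pos[OF q, of k] step by simp
    then show ?case using step q unfolding Suc[OF step(1)] by simp
  qed
  obtain k where k: "n = Suc k" "2 \<le> k" using n by (cases n) auto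
  have "0 < 2 * (1 - q) * frustum_N k q" using frustum_N_pos[OF q k(2)] q by simp
  moreover have "0 \<le> q * frustum_D k q" using nonneg[OF k(2)] q by simp
  ultimately show ?thesis unfolding k(1) Suc[OF k(2)] by linarith
qed

definition frustum_B :: "nat \<Rightarrow> real \<Rightarrow> real" where
  "frustum_B n q = (real n - 1) - (real n + 1) * q + (real n + 1) * q ^ n - (real n - 1) * q ^ (n + 1)"

lemma frustum_B_pos:
  assumes q: "0 \<le> q" "q < 1" and n: "2 \<le> n"
  shows "0 < frustum_B n q"
  using n
proof (induction n rule: dec_induct)
  case base
  have "frustum_B 2 q = (1 - q) ^ 3"
    by (simp add: frustum_B_def power2_eq_square power3_eq_cube algebra_simps)
  then show ?case using q by simp
next
  case (step k)
  have "frustum_B (Suc k) q = q * frustum_B k q + (1 - q) * (real k - (real k + 1) * q + q ^ (k + 1))"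
    by (simp add: frustum_B_def algebra_simps)
  moreover have "real k - (real k + 1) * q + q ^ (k + 1) \<ge> 0"
    using Bernoulli_inequality[of "q - 1" "k + 1"] q by (simp add: algebra_simps)
  ultimately have ge: "frustum_B (Suc k) q \<ge> q * frustum_B k q"
    using q by simp
  show ?case
  proof (cases "q = 0")
    case True
    then show ?thesis using step by (simp add: frustum_B_def)
  next
    case False
    then have "0 < q * frustum_B k q" using q step by simp
    with ge show ?thesis by linarith
  qed
qed

text \<open>
  For the frustum with ratio \<open>q\<close> between its ends, whose centroid is the origin, \<open>frustum_E\<close> is
  \<open>(n+1) (x-y) / n\<close> and \<open>frustum_\<phi>\<close> is \<open>(n+1) (1 - (x+y))\<close>, where \<open>x\<close> and \<open>y\<close> are \<open>n / V\<close> times its two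
  cone volumes (see \<open>frustum_values\<close> below).
\<close>

definition frustum_E :: "nat \<Rightarrow> real \<Rightarrow> real" where
  "frustum_E n q = frustum_N n q / (1 - q ^ n)\<^sup>2"

definition frustum_\<phi> :: "nat \<Rightarrow> real \<Rightarrow> real" where
  "frustum_\<phi> n q = 1 - (real n)\<^sup>2 * q ^ (n - 1) * (1 - q)\<^sup>2 / (1 - q ^ n)\<^sup>2"

text \<open>
  The two derivatives share the factor \<open>P\<close>; this relation is what makes the proof of
  \<open>frustum_ineq\<close> work.
\<close>

lemma frustum_derivs:
  assumes q: "0 \<le> q" "q < 1" and n: "2 \<le> n"
  defines "P \<equiv> real n * q ^ (n - 2) * frustum_B n q / (1 - q ^ n) ^ 3"
  shows "(frustum_E n has_real_derivative - (1 + q) * P) (at q)"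
    and "(frustum_\<phi> n has_real_derivative - real n * (1 - q) * P) (at q)"
proof -
  obtain k where k: "n = Suc (Suc k)" by (rule that[of "n - 2"]) (use n in simp)
  define W where "W = 1 - q ^ n"
  have "q ^ n < 1" using q n power_strict_mono[of q 1 n] by auto
  then have W: "W \<noteq> 0" by (simp add: W_def)
  have q2: "q ^ (2 * k) = q ^ k * q ^ k" "q ^ (k * 2) = q ^ k * q ^ k" by (simp_all only: mult_2 mult_2_right power_add)
  have dW: "((\<lambda>t. (1 - t ^ n)\<^sup>2) has_real_derivative 2 * W * (- real n * q ^ (n - 1))) (at q)"
    by (auto intro!: derivative_eq_intros simp: W_def)
  \<comment> \<open>the quotient rule for denominator \<open>W^2\<close>, with one factor \<open>W\<close> cancelled\<close>
  have quot: "(F' * W\<^sup>2 - F * (2 * W * (- real n * q ^ (n - 1)))) / (W\<^sup>2 * W\<^sup>2) = c * P"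
    if "F' * W + 2 * real n * q ^ (n - 1) * F = c * (real n * q ^ (n - 2) * frustum_B n q)" for F F' c
  proof -
    have "F' * W\<^sup>2 - F * (2 * W * (- real n * q ^ (n - 1))) = W * (F' * W + 2 * real n * q ^ (n - 1) * F)"
      by (simp add: power2_eq_square algebra_simps)
    then show ?thesis using W unfolding that P_def W_def[symmetric]
      by (simp add: power2_eq_square power3_eq_cube)
  qed
  define N' where "N' = - real (2 * n) * q ^ (2 * n - 1)
      - real n * ((real n - 1) * q ^ (n - 2) * (1 - q\<^sup>2) - 2 * q * q ^ (n - 1))"
  have dN: "(frustum_N n has_real_derivative N') (at q)"
    unfolding frustum_N_def N'_def using n
    by (auto intro!: derivative_eq_intros simp: of_nat_diff algebra_simps numeral_2_eq_2)
  have idN: "N' * W + 2 * real n * q ^ (n - 1) * frustum_N n q = - (1 + q) * (real n * q ^ (n - 2) * frustum_B n q)"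
    unfolding N'_def W_def frustum_N_def frustum_B_def k
    by (simp add: q2 power2_eq_square algebra_simps)
  have "((\<lambda>t. frustum_N n t / (1 - t ^ n)\<^sup>2) has_real_derivative
      (N' * (1 - q ^ n)\<^sup>2 - frustum_N n q * (2 * W * (- real n * q ^ (n - 1)))) / ((1 - q ^ n)\<^sup>2 * (1 - q ^ n)\<^sup>2)) (at q)"
    using W by (intro DERIV_divide dN dW) (simp add: W_def)
  then show "(frustum_E n has_real_derivative - (1 + q) * P) (at q)"
    unfolding W_def[symmetric] quot[OF idN] by (simp add: frustum_E_def[abs_def])
  define G where "G t = (real n)\<^sup>2 * t ^ (n - 1) * (1 - t)\<^sup>2" for t
  define G' where "G' = (real n)\<^sup>2 * ((real n - 1) * q ^ (n - 2) * (1 - q)\<^sup>2 - 2 * q ^ (n - 1) * (1 - q))"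
  have dG: "(G has_real_derivative G') (at q)"
    unfolding G_def G'_def using n
    by (auto intro!: derivative_eq_intros simp: of_nat_diff algebra_simps numeral_2_eq_2)
  have idG: "G' * W + 2 * real n * q ^ (n - 1) * G q = real n * (1 - q) * (real n * q ^ (n - 2) * frustum_B n q)"
    unfolding G'_def W_def G_def frustum_B_def k
    by (simp add: q2 power2_eq_square algebra_simps)
  have "((\<lambda>t. G t / (1 - t ^ n)\<^sup>2) has_real_derivative
      (G' * (1 - q ^ n)\<^sup>2 - G q * (2 * W * (- real n * q ^ (n - 1)))) / ((1 - q ^ n)\<^sup>2 * (1 - q ^ n)\<^sup>2)) (at q)"
    using W by (intro DERIV_divide dG dW) (simp add: W_def)
  then have "((\<lambda>t. G t / (1 - t ^ n)\<^sup>2) has_real_derivative real n * (1 - q) * P) (at q)"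
    unfolding W_def[symmetric] quot[OF idG] .
  then have "((\<lambda>t. 1 - G t / (1 - t ^ n)\<^sup>2) has_real_derivative 0 - real n * (1 - q) * P) (at q)"
    by (intro DERIV_diff DERIV_const)
  then show "(frustum_\<phi> n has_real_derivative - real n * (1 - q) * P) (at q)"
    by (simp add: frustum_\<phi>_def[abs_def] G_def)
qed

text \<open>
  By the relation between the derivatives, the derivative of \<open>\<phi> / E^n\<close> has the sign of
  \<open>\<phi> (1+q) / (1-q) - E\<close>, which is a positive multiple of the polynomial \<open>frustum_D\<close>. Hence the quotient
  increases from its value 1 at \<open>q = 0\<close>.
\<close>

lemma frustum_ineq:
  assumes q: "0 \<le> q" "q < 1" and n: "3 \<le> n"
  shows "frustum_E n q ^ n \<le> frustum_\<phi> n q" and "0 < q \<Longrightarrow> frustum_E n q ^ n < frustum_\<phi> n q"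
proof -
  have W: "0 < 1 - t ^ n" if "0 \<le> t" "t < 1" for t :: real
    using that n power_strict_mono[of t 1 n] by auto
  have E: "0 < frustum_E n t" if "0 \<le> t" "t < 1" for t
    using that frustum_N_pos[of t n] n W[of t] by (simp add: frustum_E_def)
  have at0: "frustum_E n 0 = 1" "frustum_\<phi> n 0 = 1"
    using n by (simp_all add: frustum_E_def frustum_\<phi>_def frustum_N_def zero_power)
  have key: "frustum_E n t < frustum_\<phi> n t * (1 + t) / (1 - t)" if t: "0 < t" "t < 1" for t
  proof -
    obtain k where k: "n = Suc (Suc k)" by (rule that[of "n - 2"]) (use n in simp)
    have "frustum_\<phi> n t * (1 + t) / (1 - t) - frustum_E n t = t * frustum_D n t / ((1 - t) * (1 - t ^ n)\<^sup>2)"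
    proof -
      have nz: "1 - t \<noteq> 0" "1 - t ^ n \<noteq> 0" using t W[of t] by auto
      have "frustum_\<phi> n t = ((1 - t ^ n)\<^sup>2 - (real n)\<^sup>2 * t ^ (n - 1) * (1 - t)\<^sup>2) / (1 - t ^ n)\<^sup>2"
        using nz by (simp add: frustum_\<phi>_def diff_divide_distrib)
      moreover have "U / W * (1 + t) / (1 - t) - M / W = (U * (1 + t) - (1 - t) * M) / ((1 - t) * W)"
        if "W \<noteq> 0" for U M W :: real
        using that nz(1) by (simp add: field_simps)
      ultimately have "frustum_\<phi> n t * (1 + t) / (1 - t) - frustum_E n t
        = (((1 - t ^ n)\<^sup>2 - (real n)\<^sup>2 * t ^ (n - 1) * (1 - t)\<^sup>2) * (1 + t) - (1 - t) * frustum_N n t)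
            / ((1 - t) * (1 - t ^ n)\<^sup>2)"
        using nz(2) by (simp only: frustum_E_def) simp
      also have "((1 - t ^ n)\<^sup>2 - (real n)\<^sup>2 * t ^ (n - 1) * (1 - t)\<^sup>2) * (1 + t) - (1 - t) * frustum_N n t
          = t * frustum_D n t"
      proof -
        have "t ^ (2 * k) = t ^ k * t ^ k" by (metis mult_2 power_add)
        then show ?thesis unfolding frustum_N_def frustum_D_def k
          by (simp add: power2_eq_square algebra_simps)
      qed
      finally show ?thesis .
    qed
    moreover have "0 < t * frustum_D n t / ((1 - t) * (1 - t ^ n)\<^sup>2)"
      using t W[of t] frustum_D_pos[of t n] n by (intro divide_pos_pos mult_pos_pos) auto
    ultimately show ?thesis by linarith
  qed
  show lt: "frustum_E n q ^ n < frustum_\<phi> n q" if "0 < q"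
  proof -
    have "(\<lambda>t. frustum_\<phi> n t / frustum_E n t ^ n) 0 < (\<lambda>t. frustum_\<phi> n t / frustum_E n t ^ n) q"
    proof (rule DERIV_pos_imp_increasing_open[OF that])
      fix t assume t: "0 < t" "t < q"
      with q have t1: "0 \<le> t" "t < 1" by auto
      define P where "P = real n * t ^ (n - 2) * frustum_B n t / (1 - t ^ n) ^ 3"
      have P: "0 < P" unfolding P_def
        using t t1 n W[OF t1] frustum_B_pos[OF t1, of n] by (intro divide_pos_pos mult_pos_pos) auto
      have d: "(frustum_E n has_real_derivative - (1 + t) * P) (at t)"
        "(frustum_\<phi> n has_real_derivative - real n * (1 - t) * P) (at t)"
        using frustum_derivs[OF t1, of n] n by (simp_all add: P_def)
      let ?E = "frustum_E n t" and ?\<phi> = "frustum_\<phi> n t"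
      have der: "((\<lambda>t. frustum_\<phi> n t / frustum_E n t ^ n) has_real_derivative
          ((- real n * (1 - t) * P) * ?E ^ n - ?\<phi> * (real n * ?E ^ (n - 1) * (- (1 + t) * P))) / (?E ^ n * ?E ^ n)) (at t)"
        using E[OF t1] d by (auto intro!: derivative_eq_intros simp: algebra_simps)
      moreover have "(- real n * (1 - t) * P) * ?E ^ n - ?\<phi> * (real n * ?E ^ (n - 1) * (- (1 + t) * P))
          = real n * P * (1 - t) * ?E ^ (n - 1) * (?\<phi> * (1 + t) / (1 - t) - ?E)"
      proof -
        have "?E ^ n = ?E * ?E ^ (n - 1)" using n by (simp add: power_eq_if)
        then show ?thesis using t1 by (simp add: field_simps)
      qed
      moreover have "0 < real n * P * (1 - t) * ?E ^ (n - 1) * (?\<phi> * (1 + t) / (1 - t) - ?E)"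
        using n P t1 E[OF t1] key[OF t(1) t1(2)] by (intro mult_pos_pos) auto
      ultimately have "0 < ((- real n * (1 - t) * P) * ?E ^ n - ?\<phi> * (real n * ?E ^ (n - 1) * (- (1 + t) * P))) / (?E ^ n * ?E ^ n)"
        using E[OF t1] by (simp only: divide_pos_pos mult_pos_pos zero_less_power)
      with der show "\<exists>y. ((\<lambda>t. frustum_\<phi> n t / frustum_E n t ^ n) has_real_derivative y) (at t) \<and> 0 < y"
        by blast
    next
      have "isCont (frustum_E n) t \<and> isCont (frustum_\<phi> n) t" if "0 \<le> t" "t \<le> q" for t
        using frustum_derivs[of t n] that q n by (auto intro: DERIV_isCont)
      then show "continuous_on {0..q} (\<lambda>t. frustum_\<phi> n t / frustum_E n t ^ n)"
        using E q by (intro continuous_intros continuous_at_imp_continuous_on) (auto simp: less_imp_neq[THEN not_sym])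
    qed
    then show ?thesis using at0 E[OF q] by (simp add: field_simps)
  qed
  show "frustum_E n q ^ n \<le> frustum_\<phi> n q"
    using lt q at0 by (cases "q = 0") auto
qed

section \<open>Concave profiles\<close>

lemma integral_step_pos:
  fixes F :: "real \<Rightarrow> real"
  assumes F: "(F has_integral I) {0..1}" and nonneg: "\<And>s. 0 \<le> s \<Longrightarrow> s \<le> 1 \<Longrightarrow> 0 \<le> F s"
    and pq: "0 \<le> p" "p < q" "q \<le> 1" and c: "0 < c" "\<And>s. p \<le> s \<Longrightarrow> s \<le> q \<Longrightarrow> c \<le> F s"
  shows "0 < I"
proof -
  have "((\<lambda>s. c) has_integral c * (q - p)) {p..q}"
    using has_integral_const_real[of c p q] pq by (simp add: mult.commute)
  then have "((\<lambda>s. if s \<in> {p..q} then c else 0) has_integral c * (q - p)) {0..1}"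
    using pq by (subst has_integral_restrict) auto
  then have "c * (q - p) \<le> I"
    by (rule has_integral_le[OF _ F]) (use nonneg c in auto)
  then show ?thesis using c pq by (smt (verit) mult_pos_pos)
qed

lemma power_diff_ge:
  fixes x y :: real
  assumes "0 \<le> y" "y \<le> x" "0 < m"
  shows "(x - y) ^ m \<le> x ^ m - y ^ m"
proof -
  have "(x - y) ^ m + y ^ m \<le> x ^ m"
    using assms(3)
  proof (induction m rule: nat_induct_non_zero)
    case (Suc m)
    have "(x - y) ^ Suc m + y ^ Suc m \<le> x * (x - y) ^ m + x * y ^ m"
      using assms by (auto intro!: add_mono mult_right_mono)
    also have "\<dots> \<le> x * x ^ m"
      using Suc assms by (simp add: distrib_left[symmetric] mult_left_mono)
    finally show ?case by simp
  qed simp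
  then show ?thesis by simp
qed

lemma concave_unit_intervalD:
  assumes "concave_on {0..1} (f :: real \<Rightarrow> real)" "0 \<le> s" "s \<le> 1" "0 \<le> t" "t \<le> 1" "0 \<le> l" "l \<le> 1"
  shows "(1 - l) * f s + l * f t \<le> f ((1 - l) * s + l * t)"
  using concave_onD[OF assms(1), of l s t] assms by simp

lemma concave_unit_intervalI:
  assumes "\<And>s t l. 0 \<le> s \<Longrightarrow> s \<le> 1 \<Longrightarrow> 0 \<le> t \<Longrightarrow> t \<le> 1 \<Longrightarrow> 0 \<le> l \<Longrightarrow> l \<le> 1 \<Longrightarrow>
      (1 - l) * f s + l * f t \<le> f ((1 - l) * s + l * t)"
  shows "concave_on {0..1} (f :: real \<Rightarrow> real)"
  using assms by (intro concave_on_linorderI) auto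

lemma concave_above_linear:
  assumes concave: "concave_on {0..1} f"
    and st: "0 \<le> s" "s < t" "t \<le> 1" and x: "s \<le> x" "x \<le> t"
    and e: "g0 + (g1 - g0) * s + e \<le> f s" "g0 + (g1 - g0) * t + e \<le> f t"
  shows "g0 + (g1 - g0) * x + e \<le> (f x :: real)"
proof -
  note conc = concave_unit_intervalD[OF concave]
  define l where "l = (x - s) / (t - s)"
  have l: "0 \<le> l" "l \<le> 1" using st x by (auto simp: l_def)
  have xl: "x = (1 - l) * s + l * t"
  proof -
    have "l * (t - s) = x - s" using st by (simp add: l_def)
    then show ?thesis by (simp add: algebra_simps)
  qed
  have "(1 - l) * (g0 + (g1 - g0) * s + e) + l * (g0 + (g1 - g0) * t + e) \<le> (1 - l) * f s + l * f t"
    using l e by (intro add_mono mult_left_mono) auto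
  also have "\<dots> \<le> f x" unfolding xl using st l by (intro conc) auto
  finally show ?thesis unfolding xl by (simp add: algebra_simps)
qed

text \<open>
  Suppose \<open>f 1 > g1\<close>. Since \<open>f - g\<close> is concave, there is a \<open>t0\<close> such that \<open>f \<le> g\<close> before \<open>t0\<close> and
  \<open>f > g\<close> after it. Then \<open>(s - t0) (f s ^ m - g s ^ m)\<close> is nonnegative and not almost everywhere
  zero, but its integral vanishes because the masses and the first moments agree.
\<close>

lemma concave_right_end_le:
  fixes f :: "real \<Rightarrow> real"
  assumes concave: "concave_on {0..1} f"
    and nonneg: "\<And>s. 0 \<le> s \<Longrightarrow> s \<le> 1 \<Longrightarrow> 0 \<le> f s"
    and g: "0 \<le> g0" "0 \<le> g1" and m: "0 < m"
    and f_int: "((\<lambda>s. f s ^ m) has_integral V) {0..1}" "((\<lambda>s. s * f s ^ m) has_integral M) {0..1}"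
    and g_int: "((\<lambda>s. (g0 + (g1 - g0) * s) ^ m) has_integral V) {0..1}"
      "((\<lambda>s. s * (g0 + (g1 - g0) * s) ^ m) has_integral M) {0..1}"
  shows "f 1 \<le> g1"
proof (rule ccontr)
  note conc = concave_unit_intervalD[OF concave]
  assume "\<not> f 1 \<le> g1"
  then have f1: "g1 < f 1" by simp
  define g where "g s = g0 + (g1 - g0) * s" for s
  have g_nonneg: "0 \<le> g s" if "0 \<le> s" "s \<le> 1" for s
  proof -
    have "g s = (1 - s) * g0 + s * g1" by (simp add: g_def algebra_simps)
    then show ?thesis using g that by simp
  qed
  \<comment> \<open>the sign change of \<open>f - g\<close> is the infimum of \<open>T\<close>\<close>
  define T where "T = {s. 0 \<le> s \<and> s \<le> 1 \<and> g s < f s}"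
  have "1 \<in> T" using f1 by (simp add: T_def g_def)
  have bdd: "bdd_below T" by (rule bdd_belowI[of _ 0]) (simp add: T_def)
  define t0 where "t0 = Inf T"
  have t0: "0 \<le> t0" "t0 \<le> 1"
  proof -
    show "0 \<le> t0" unfolding t0_def using \<open>1 \<in> T\<close> by (intro cInf_greatest) (auto simp: T_def)
    show "t0 \<le> 1" unfolding t0_def by (rule cInf_lower[OF \<open>1 \<in> T\<close> bdd])
  qed
  have below: "f s \<le> g s" if "0 \<le> s" "s < t0" for s
  proof (rule ccontr)
    assume "\<not> f s \<le> g s"
    then have "s \<in> T" using that t0 by (simp add: T_def)
    then have "t0 \<le> s" unfolding t0_def using bdd by (rule cInf_lower)
    with that show False by simp
  qed
  have above: "g s < f s" if s: "t0 < s" "s \<le> 1" for s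
  proof -
    obtain t1 where t1: "t1 \<in> T" "t1 < s"
      using cInf_less_iff[OF _ bdd, of s] \<open>1 \<in> T\<close> s unfolding t0_def by blast
    show ?thesis
    proof (cases "s = 1")
      case False
      define e where "e = min (f t1 - g t1) (f 1 - g1)"
      have e: "0 < e" using t1 f1 by (auto simp: e_def T_def)
      have "g0 + (g1 - g0) * s + e \<le> f s"
      proof (rule concave_above_linear[where f=f and s=t1 and t=1, OF concave])
        show "g0 + (g1 - g0) * t1 + e \<le> f t1" "g0 + (g1 - g0) * 1 + e \<le> f 1"
          by (auto simp: e_def g_def min_def)
      qed (use t1 s False in \<open>auto simp: T_def\<close>)
      with e show ?thesis by (simp add: g_def)
    qed (use f1 in \<open>simp add: g_def\<close>)
  qed
  \<comment> \<open>a point strictly between the crossing and the right end\<close>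
  obtain t1 where t1: "t0 < t1" "t1 < 1" "g t1 < f t1"
  proof (cases "t0 < 1")
    case True
    then show ?thesis using that[of "(t0 + 1) / 2"] above by auto
  next
    case False
    then have t0: "t0 = 1" using t0 by simp
    define d where "d = f 1 - g1"
    \<comment> \<open>so close to 1 that the concave lower bound \<open>l * f 1\<close> of \<open>f l\<close> still exceeds \<open>g l\<close>\<close>
    define l where "l = 1 - d / (2 * (d + g 0))"
    have gp: "0 \<le> g 0" using g_nonneg[of 0] by simp
    have d: "0 < d" using f1 by (simp add: d_def)
    have l: "0 \<le> l" "l < 1" using d gp by (auto simp: l_def field_simps)
    have "(1 - l) * f 0 + l * f 1 \<le> f ((1 - l) * 0 + l * 1)"
      using l by (intro conc) auto
    moreover have "0 \<le> (1 - l) * f 0" using nonneg[of 0] l by simp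
    ultimately have "l * f 1 \<le> f l" by simp
    moreover have "g l = (1 - l) * g 0 + l * g1" by (simp add: g_def algebra_simps)
    moreover have "(1 - l) * (d + g 0) = d / 2"
    proof -
      have "d + g 0 \<noteq> 0" using d gp by linarith
      then show ?thesis by (simp add: l_def field_simps)
    qed
    ultimately have "g l < f l" using d by (simp add: d_def algebra_simps)
    then show ?thesis using below[of l] t0 l by simp
  qed
  have t1_0: "0 \<le> t1" using t0 t1 by simp
  define e where "e = min (f t1 - g t1) (f 1 - g1)"
  have e: "0 < e" using t1 f1 by (auto simp: e_def)
  have int: "((\<lambda>s. (s - t0) * (f s ^ m - g s ^ m)) has_integral (M - M) - t0 * (V - V)) {0..1}"
  proof -
    have "((\<lambda>s. (s * f s ^ m - s * g s ^ m) - t0 * (f s ^ m - g s ^ m)) has_integral (M - M) - t0 * (V - V)) {0..1}"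
      using f_int g_int unfolding g_def by (intro has_integral_diff has_integral_mult_right)
    then show ?thesis by (simp add: algebra_simps)
  qed
  have "0 < (M - M) - t0 * (V - V)"
  proof (rule integral_step_pos[OF int _ t1_0 t1(2)])
    show "0 < (t1 - t0) * e ^ m" using t1 e by simp
  next
    fix s :: real assume s: "t1 \<le> s" "s \<le> 1"
    have "g0 + (g1 - g0) * s + e \<le> f s"
    proof (rule concave_above_linear[where f=f and s=t1 and t=1, OF concave])
      show "g0 + (g1 - g0) * t1 + e \<le> f t1" "g0 + (g1 - g0) * 1 + e \<le> f 1"
        by (auto simp: e_def g_def min_def)
    qed (use t1 t1_0 s in auto)
    then have "e \<le> f s - g s" by (simp add: g_def)
    then have "e ^ m \<le> (f s - g s) ^ m" using e by (intro power_mono) auto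
    also have "\<dots> \<le> f s ^ m - g s ^ m"
      using g_nonneg[of s] s t1_0 e \<open>e \<le> f s - g s\<close> m by (intro power_diff_ge) auto
    finally show "(t1 - t0) * e ^ m \<le> (s - t0) * (f s ^ m - g s ^ m)"
      using s t1 e by (intro mult_mono) auto
  next
    fix s :: real assume s: "0 \<le> s" "s \<le> 1"
    consider "s < t0" | "s = t0" | "t0 < s" by linarith
    then show "0 \<le> (s - t0) * (f s ^ m - g s ^ m)"
    proof cases
      case 1
      then have "f s ^ m \<le> g s ^ m" using below s nonneg by (intro power_mono) auto
      with 1 show ?thesis by (intro mult_nonpos_nonpos) auto
    next
      case 3
      then have "g s ^ m \<le> f s ^ m" using above[of s] s g_nonneg by (intro power_mono) auto
      with 3 show ?thesis by simp
    qed simp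
  qed simp
  then show False by simp
qed

lemma has_integral_reflect_unit:
  fixes F :: "real \<Rightarrow> real"
  assumes "(F has_integral I) {0..1}"
  shows "((\<lambda>s. F (1 - s)) has_integral I) {0..1}"
  using has_integral_affinity[of F I 0 1 "-1" 1] assms
  by (simp add: image_affinity_atLeastAtMost_diff)

lemma concave_left_end_le:
  fixes f :: "real \<Rightarrow> real"
  assumes concave: "concave_on {0..1} f"
    and nonneg: "\<And>s. 0 \<le> s \<Longrightarrow> s \<le> 1 \<Longrightarrow> 0 \<le> f s"
    and g: "0 \<le> g0" "0 \<le> g1" and m: "0 < m"
    and f_int: "((\<lambda>s. f s ^ m) has_integral V) {0..1}" "((\<lambda>s. s * f s ^ m) has_integral M) {0..1}"
    and g_int: "((\<lambda>s. (g0 + (g1 - g0) * s) ^ m) has_integral V) {0..1}"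
      "((\<lambda>s. s * (g0 + (g1 - g0) * s) ^ m) has_integral M) {0..1}"
  shows "f 0 \<le> g0"
proof -
  note conc = concave_unit_intervalD[OF concave]
  have refl: "((\<lambda>s. h (1 - s) ^ m) has_integral V) {0..1}" "((\<lambda>s. s * h (1 - s) ^ m) has_integral V - M) {0..1}"
    if "((\<lambda>s. h s ^ m) has_integral V) {0..1}" "((\<lambda>s. s * h s ^ m) has_integral M) {0..1}" for h :: "real \<Rightarrow> real"
  proof -
    show "((\<lambda>s. h (1 - s) ^ m) has_integral V) {0..1}" by (rule has_integral_reflect_unit[OF that(1)])
    have "((\<lambda>s. h (1 - s) ^ m - (1 - s) * h (1 - s) ^ m) has_integral V - M) {0..1}"
      using has_integral_reflect_unit[OF has_integral_diff[OF that]] .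
    then show "((\<lambda>s. s * h (1 - s) ^ m) has_integral V - M) {0..1}" by (simp add: algebra_simps)
  qed
  have eq: "g0 + (g1 - g0) * (1 - s) = g1 + (g0 - g1) * s" for s by (simp add: algebra_simps)
  have "(\<lambda>s. f (1 - s)) 1 \<le> g0"
  proof (rule concave_right_end_le[where f = "\<lambda>s. f (1 - s)" and ?g0.0 = g1 and m = m and V = V and M = "V - M"])
    show "concave_on {0..1} (\<lambda>s. f (1 - s))"
    proof (rule concave_unit_intervalI)
      fix s t l :: real assume *: "0 \<le> s" "s \<le> 1" "0 \<le> t" "t \<le> 1" "0 \<le> l" "l \<le> 1"
      have "1 - ((1 - l) * s + l * t) = (1 - l) * (1 - s) + l * (1 - t)" by (simp add: algebra_simps)
      then show "(1 - l) * f (1 - s) + l * f (1 - t) \<le> f (1 - ((1 - l) * s + l * t))"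
        using conc[of "1 - s" "1 - t" l] * by simp
    qed
  qed (use g m nonneg refl[OF f_int] refl[OF g_int] in \<open>simp_all add: eq\<close>)
  then show ?thesis by simp
qed

lemma linear_power_integrals:
  fixes q :: real
  assumes q: "q \<noteq> 1" and n: "0 < n"
  defines "A \<equiv> (1 - q ^ n) / (real n * (1 - q))"
  shows "((\<lambda>s. (q + (1 - q) * s) ^ (n - 1)) has_integral A) {0..1}"
    and "((\<lambda>s. s * (q + (1 - q) * s) ^ (n - 1)) has_integral
      ((1 - q ^ Suc n) / ((real n + 1) * (1 - q)) - q * A) / (1 - q)) {0..1}"
proof -
  have int: "((\<lambda>s. (q + (1 - q) * s) ^ k) has_integral (1 - q ^ Suc k) / (real (Suc k) * (1 - q))) {0..1}" for k
  proof -
    let ?F = "\<lambda>s. (q + (1 - q) * s) ^ Suc k / (real (Suc k) * (1 - q))"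
    have "((\<lambda>s. (q + (1 - q) * s) ^ k) has_integral ?F 1 - ?F 0) {0..1}"
    proof (rule fundamental_theorem_of_calculus)
      fix s :: real
      have "((\<lambda>s. (q + (1 - q) * s) ^ Suc k) has_real_derivative real (Suc k) * ((1 - q) * (q + (1 - q) * s) ^ k)) (at s within {0..1})"
        by (auto intro!: derivative_eq_intros simp del: of_nat_Suc power_Suc)
      then have "(?F has_real_derivative (real (Suc k) * ((1 - q) * (q + (1 - q) * s) ^ k)) / (real (Suc k) * (1 - q))) (at s within {0..1})"
        by (rule DERIV_cdivide)
      also have "(real (Suc k) * ((1 - q) * (q + (1 - q) * s) ^ k)) / (real (Suc k) * (1 - q)) = (q + (1 - q) * s) ^ k"
        using q by (simp del: of_nat_Suc)
      finally show "(?F has_vector_derivative (q + (1 - q) * s) ^ k) (at s within {0..1})"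
        by (simp add: has_real_derivative_iff_has_vector_derivative)
    qed simp
    then show ?thesis by (simp add: diff_divide_distrib)
  qed
  show 1: "((\<lambda>s. (q + (1 - q) * s) ^ (n - 1)) has_integral A) {0..1}"
    using int[of "n - 1"] n by (simp add: A_def)
  have "((\<lambda>s. ((q + (1 - q) * s) ^ n - q * (q + (1 - q) * s) ^ (n - 1)) / (1 - q)) has_integral
      ((1 - q ^ Suc n) / (real (Suc n) * (1 - q)) - q * A) / (1 - q)) {0..1}"
    by (intro has_integral_divide has_integral_diff has_integral_mult_right int 1)
  moreover have "((q + (1 - q) * s) ^ n - q * (q + (1 - q) * s) ^ (n - 1)) / (1 - q) = s * (q + (1 - q) * s) ^ (n - 1)" for s
  proof -
    have "(q + (1 - q) * s) ^ n = (q + (1 - q) * s) * (q + (1 - q) * s) ^ (n - 1)"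
      using n by (simp add: power_eq_if)
    then have "(q + (1 - q) * s) ^ n - q * (q + (1 - q) * s) ^ (n - 1) = (1 - q) * (s * (q + (1 - q) * s) ^ (n - 1))"
      by (simp add: algebra_simps)
    then show ?thesis using q by simp
  qed
  ultimately show "((\<lambda>s. s * (q + (1 - q) * s) ^ (n - 1)) has_integral
      ((1 - q ^ Suc n) / ((real n + 1) * (1 - q)) - q * A) / (1 - q)) {0..1}"
    by (simp add: add.commute)
qed

text \<open>
  The mean is largest for the cone \<open>f s = k s\<close>: with \<open>k\<close> chosen such that \<open>f\<close> and the cone agree at
  \<open>\<beta>\<close>, concavity puts \<open>f\<close> above the cone before \<open>\<beta>\<close> and below it after \<open>\<beta>\<close>.
\<close>

lemma concave_mean_le:
  fixes f :: "real \<Rightarrow> real"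
  assumes concave: "concave_on {0..1} f"
    and nonneg: "\<And>s. 0 \<le> s \<Longrightarrow> s \<le> 1 \<Longrightarrow> 0 \<le> f s"
    and n: "2 \<le> n"
    and f_int: "((\<lambda>s. f s ^ (n - 1)) has_integral V) {0..1}" "((\<lambda>s. s * f s ^ (n - 1)) has_integral \<beta> * V) {0..1}"
    and V: "0 < V" and \<beta>: "0 < \<beta>" "\<beta> < 1"
  shows "\<beta> / real n \<le> 1 / (real n + 1)"
proof -
  note conc = concave_unit_intervalD[OF concave]
  define k where "k = f \<beta> / \<beta>"
  have fb: "0 < f \<beta>"
  proof (rule ccontr)
    assume "\<not> 0 < f \<beta>"
    then have f0: "f \<beta> = 0" using nonneg[of \<beta>] \<beta> by simp
    have "f s = 0" if s: "0 \<le> s" "s \<le> 1" for s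
    proof -
      \<comment> \<open>the end point \<open>e\<close> with \<open>\<beta>\<close> between \<open>s\<close> and \<open>e\<close>\<close>
      define e :: real where "e = (if s \<le> \<beta> then 1 else 0)"
      define l where "l = (\<beta> - s) / (e - s)"
      have ne: "e \<noteq> s" using s \<beta> by (auto simp: e_def)
      have l: "0 \<le> l" "l < 1"
        using s \<beta> by (auto simp: l_def e_def field_simps)
      have "l * (e - s) = \<beta> - s" using ne by (simp add: l_def)
      then have "(1 - l) * s + l * e = \<beta>" by (simp add: algebra_simps)
      then have "(1 - l) * f s + l * f e \<le> 0"
        using conc[of s e l] s l f0 by (simp add: e_def)
      moreover have "0 \<le> l * f e" using l nonneg[of e] by (simp add: e_def)
      ultimately have "(1 - l) * f s \<le> 0" by linarith
      then have "f s \<le> 0" using l by (simp add: mult_le_0_iff)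
      then show ?thesis using nonneg[OF s] by simp
    qed
    then have "((\<lambda>s. f s ^ (n - 1)) has_integral 0) {0..1}"
      using n by (intro has_integral_is_0) auto
    then show False using has_integral_unique[OF f_int(1)] V by auto
  qed
  have k: "0 < k" using fb \<beta> by (simp add: k_def)
  let ?I = "(\<beta> * V - \<beta> * V) - k ^ (n - 1) * (1 / (real n + 1) - \<beta> * (1 / real n))"
  have pow: "((\<lambda>s::real. s ^ (n - 1)) has_integral 1 / real n) {0..1}"
    "((\<lambda>s::real. s * s ^ (n - 1)) has_integral 1 / (real n + 1)) {0..1}"
    using linear_power_integrals[of 0 n] n by (simp_all add: zero_power)
  have "((\<lambda>s. (s * f s ^ (n - 1) - \<beta> * f s ^ (n - 1)) - k ^ (n - 1) * (s * s ^ (n - 1) - \<beta> * s ^ (n - 1))) has_integral ?I) {0..1}"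
    by (intro has_integral_diff has_integral_mult_right f_int pow)
  then have "?I \<le> 0"
  proof (rule has_integral_le[OF _ has_integral_0])
    fix s :: real assume "s \<in> {0..1}"
    then have s: "0 \<le> s" "s \<le> 1" by auto
    have eq: "(s * f s ^ (n - 1) - \<beta> * f s ^ (n - 1)) - k ^ (n - 1) * (s * s ^ (n - 1) - \<beta> * s ^ (n - 1))
        = (s - \<beta>) * (f s ^ (n - 1) - (k * s) ^ (n - 1))"
      by (simp add: algebra_simps power_mult_distrib)
    have "(s - \<beta>) * (f s ^ (n - 1) - (k * s) ^ (n - 1)) \<le> 0"
    proof (cases "s \<le> \<beta>")
      case True
      have "(1 - s / \<beta>) * f 0 + s / \<beta> * f \<beta> \<le> f ((1 - s / \<beta>) * 0 + s / \<beta> * \<beta>)"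
        using True s \<beta> by (intro conc) auto
      moreover have "0 \<le> (1 - s / \<beta>) * f 0" using True \<beta> nonneg[of 0] by simp
      ultimately have "k * s \<le> f s" using \<beta> by (simp add: k_def mult.commute)
      then have "(k * s) ^ (n - 1) \<le> f s ^ (n - 1)" using k s by (intro power_mono) auto
      with True show ?thesis by (intro mult_nonpos_nonneg) auto
    next
      case False
      have "(1 - \<beta> / s) * f 0 + \<beta> / s * f s \<le> f ((1 - \<beta> / s) * 0 + \<beta> / s * s)"
        using False s \<beta> by (intro conc) auto
      moreover have "0 \<le> (1 - \<beta> / s) * f 0" using False \<beta> nonneg[of 0] by simp
      moreover have "(1 - \<beta> / s) * 0 + \<beta> / s * s = \<beta>" using False \<beta> by simp
      ultimately have "\<beta> / s * f s \<le> f \<beta>" by simp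
      then have "f s \<le> k * s" using False \<beta> by (simp add: k_def field_simps)
      then have "f s ^ (n - 1) \<le> (k * s) ^ (n - 1)" using nonneg s by (intro power_mono) auto
      with False show ?thesis by (intro mult_nonneg_nonpos) auto
    qed
    then show "(s * f s ^ (n - 1) - \<beta> * f s ^ (n - 1)) - k ^ (n - 1) * (s * s ^ (n - 1) - \<beta> * s ^ (n - 1)) \<le> 0"
      unfolding eq .
  qed
  then have "0 \<le> k ^ (n - 1) * (1 / (real n + 1) - \<beta> / real n)" by simp
  moreover have "0 < k ^ (n - 1)" using k by simp
  ultimately have "0 \<le> 1 / (real n + 1) - \<beta> / real n" by (simp add: zero_le_mult_iff)
  then show ?thesis by simp
qed

lemma has_integral_shifted_identity: "((\<lambda>s::real. s - \<beta>) has_integral 1 / 2 - \<beta>) {0..1}"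
proof -
  have "((\<lambda>s::real. s - \<beta>) has_integral (1 - \<beta>)\<^sup>2 / 2 - (0 - \<beta>)\<^sup>2 / 2) {0..1}"
  proof (rule fundamental_theorem_of_calculus)
    fix s :: real
    show "((\<lambda>s. (s - \<beta>)\<^sup>2 / 2) has_vector_derivative (s - \<beta>)) (at s within {0..1})"
      unfolding has_real_derivative_iff_has_vector_derivative[symmetric]
      by (auto intro!: derivative_eq_intros)
  qed simp
  moreover have "(1 - \<beta>)\<^sup>2 / 2 - (0 - \<beta>)\<^sup>2 / 2 = 1 / 2 - \<beta>"
    by (simp add: power2_eq_square field_simps)
  ultimately show ?thesis by (simp only:)
qed

text \<open>
  The intermediate value theorem between the cone \<open>q = 0\<close>, whose mean is \<open>n / (n+1)\<close>, and the
  cylinder \<open>q = 1\<close>, whose mean is \<open>1 / 2\<close>.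
\<close>

lemma linear_with_mean:
  assumes n: "2 \<le> n" and \<beta>: "1 / 2 \<le> \<beta>" "\<beta> / real n \<le> 1 / (real n + 1)"
  obtains q :: real where "0 \<le> q" "q \<le> 1"
    "((\<lambda>s. (s - \<beta>) * (q + (1 - q) * s) ^ (n - 1)) has_integral 0) {0..1}"
proof -
  let ?h = "\<lambda>q s::real. (s - \<beta>) * (q + (1 - q) * s) ^ (n - 1)"
  define \<Psi> where "\<Psi> q = integral (cbox 0 1) (?h q)" for q
  have int: "(?h q has_integral \<Psi> q) {0..1}" for q
  proof -
    have "?h q integrable_on {0..1}" by (intro integrable_continuous_real continuous_intros)
    then show ?thesis unfolding \<Psi>_def by (simp add: integrable_integral del: One_nat_def)
  qed
  have "continuous_on ({0..1} \<times> cbox 0 1) (\<lambda>(q, s). ?h q s)"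
    unfolding split_beta by (intro continuous_intros)
  then have cont: "continuous_on {0..1} \<Psi>"
    unfolding \<Psi>_def by (rule integral_continuous_on_param)
  have "((\<lambda>s. s * (0 + (1 - 0) * s) ^ (n - 1) - \<beta> * (0 + (1 - 0) * s) ^ (n - 1)) has_integral
      1 / (real n + 1) - \<beta> * (1 / real n)) {0..1}"
    using linear_power_integrals[of 0 n] n
    by (intro has_integral_diff has_integral_mult_right) (simp_all add: zero_power)
  then have "\<Psi> 0 = 1 / (real n + 1) - \<beta> * (1 / real n)"
    using int[of 0] by (simp add: left_diff_distrib has_integral_unique)
  then have 0: "0 \<le> \<Psi> 0" using \<beta> by simp
  have "\<Psi> 1 = 1 / 2 - \<beta>"
    using int[of 1] has_integral_shifted_identity[of \<beta>] by (simp add: has_integral_unique)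
  then have 1: "\<Psi> 1 \<le> 0" using \<beta> by simp
  obtain q where "0 \<le> q" "q \<le> 1" "\<Psi> q = 0"
    using IVT2'[OF 1 0 _ cont] by auto
  then show ?thesis using that int[of q] by simp
qed

text \<open>
  The frustum with profile \<open>q + (1-q) s\<close> over \<open>[0, 1]\<close> has mass \<open>A\<close> and mean \<open>\<beta>\<close>. Its
  ends lie at the distances \<open>\<beta>\<close> and \<open>1 - \<beta>\<close> from its mean, so the left-hand sides are the sum and the
  difference of its normalized cone volumes.
\<close>

lemma frustum_values:
  fixes q :: real
  assumes q: "0 \<le> q" "q < 1" and n: "3 \<le> n"
    and \<beta>: "((\<lambda>s. (s - \<beta>) * (q + (1 - q) * s) ^ (n - 1)) has_integral 0) {0..1}"
    and A: "((\<lambda>s. (q + (1 - q) * s) ^ (n - 1)) has_integral A) {0..1}"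
  shows "0 < A" and "(1 - \<beta>) / A + \<beta> * q ^ (n - 1) / A = 1 - frustum_\<phi> n q / (real n + 1)"
    and "(1 - \<beta>) / A - \<beta> * q ^ (n - 1) / A = real n / (real n + 1) * frustum_E n q"
proof -
  have n0: "0 < n" using n by simp
  define W where "W = 1 - q ^ n"
  have W: "0 < W" using q n power_strict_mono[of q 1 n] by (simp add: W_def)
  have r: "0 < 1 - q" using q by simp
  have A_eq: "A = W / (real n * (1 - q))"
    using has_integral_unique[OF A linear_power_integrals(1)[OF _ n0]] q by (simp add: W_def)
  show A0: "0 < A" using A_eq W r n0 by simp
  let ?B = "((1 - q ^ Suc n) / ((real n + 1) * (1 - q)) - q * A) / (1 - q)"
  have "((\<lambda>s. s * (q + (1 - q) * s) ^ (n - 1) - \<beta> * (q + (1 - q) * s) ^ (n - 1)) has_integral ?B - \<beta> * A) {0..1}"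
    using linear_power_integrals(2)[OF _ n0, of q] q A
    by (intro has_integral_diff has_integral_mult_right) (simp_all add: A_eq W_def)
  then have "((\<lambda>s. (s - \<beta>) * (q + (1 - q) * s) ^ (n - 1)) has_integral ?B - \<beta> * A) {0..1}"
    by (simp only: left_diff_distrib)
  then have "?B - \<beta> * A = 0"
    using \<beta> by (rule has_integral_unique)
  then have "\<beta> * A = ?B" by simp
  \<comment> \<open>both quantities are affine in \<open>Z\<close>; \<open>(n + 1) W^2\<close> is a common denominator\<close>
  define Z where "Z = \<beta> / A"
  have "Z = (\<beta> * A) / A\<^sup>2" using A0 by (simp add: Z_def power2_eq_square)
  also have "\<dots> = ?B / A\<^sup>2" by (simp only: \<open>\<beta> * A = ?B\<close>)
  also have "\<dots> = (1 - q ^ Suc n) / ((real n + 1) * (1 - q)\<^sup>2 * A\<^sup>2) - q / ((1 - q) * A)"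
    using A0 r by (simp add: power2_eq_square diff_divide_distrib mult_ac)
  also have "(1 - q) * A = W / real n" using r by (simp add: A_eq)
  also have "(real n + 1) * (1 - q)\<^sup>2 * A\<^sup>2 = (real n + 1) * (W / real n)\<^sup>2"
    using r by (simp add: A_eq power2_eq_square)
  finally have Z: "Z = (real n)\<^sup>2 * (1 - q ^ Suc n) / ((real n + 1) * W\<^sup>2) - real n * q / W"
    using n0 by (simp add: power_divide mult.commute)
  have invA: "1 / A = real n * (1 - q) / W" using A_eq by simp
  have X: "(1 - \<beta>) / A = real n * (1 - q) / W - Z" and Y: "\<beta> * q ^ (n - 1) / A = q ^ (n - 1) * Z"
    using invA by (simp_all add: Z_def diff_divide_distrib)
  obtain k where k: "n = Suc k" using n0 gr0_conv_Suc by blast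
  have W2: "(real n + 1) * W\<^sup>2 \<noteq> 0" using W by simp
  have q2: "q ^ (2 * k) = q ^ k * q ^ k" "q ^ (k * 2) = q ^ k * q ^ k" by (simp_all only: mult_2 mult_2_right power_add)
  have clear: "U = T" if "U * ((real n + 1) * W\<^sup>2) = T * ((real n + 1) * W\<^sup>2)" for U T
    using that W2 by (simp only: mult_cancel_right) simp
  have ZW: "Z * ((real n + 1) * W\<^sup>2) = (real n)\<^sup>2 * (1 - q ^ Suc n) - real n * (real n + 1) * q * W"
    using W2 W unfolding Z by (simp add: left_diff_distrib power2_eq_square)
  have XW: "(real n * (1 - q) / W) * ((real n + 1) * W\<^sup>2) = real n * (1 - q) * (real n + 1) * W"
    using W by (simp add: power2_eq_square)
  show "(1 - \<beta>) / A + \<beta> * q ^ (n - 1) / A = 1 - frustum_\<phi> n q / (real n + 1)"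
  proof (rule clear)
    have "frustum_\<phi> n q * W\<^sup>2 = W\<^sup>2 - (real n)\<^sup>2 * q ^ (n - 1) * (1 - q)\<^sup>2"
      using W by (simp add: frustum_\<phi>_def W_def[symmetric] left_diff_distrib)
    then have "(1 - frustum_\<phi> n q / (real n + 1)) * ((real n + 1) * W\<^sup>2)
        = (real n + 1) * W\<^sup>2 - (W\<^sup>2 - (real n)\<^sup>2 * q ^ (n - 1) * (1 - q)\<^sup>2)"
      by (simp add: left_diff_distrib)
    moreover have "((1 - \<beta>) / A + \<beta> * q ^ (n - 1) / A) * ((real n + 1) * W\<^sup>2)
        = real n * (1 - q) * (real n + 1) * W - (1 - q ^ (n - 1)) * ((real n)\<^sup>2 * (1 - q ^ Suc n) - real n * (real n + 1) * q * W)"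
      unfolding X Y ZW[symmetric] XW[symmetric] by (simp only: algebra_simps)
    ultimately show "((1 - \<beta>) / A + \<beta> * q ^ (n - 1) / A) * ((real n + 1) * W\<^sup>2)
        = (1 - frustum_\<phi> n q / (real n + 1)) * ((real n + 1) * W\<^sup>2)"
      unfolding W_def k by (simp add: q2 power2_eq_square algebra_simps)
  qed
  show "(1 - \<beta>) / A - \<beta> * q ^ (n - 1) / A = real n / (real n + 1) * frustum_E n q"
  proof (rule clear)
    have "frustum_E n q * W\<^sup>2 = frustum_N n q"
      using W by (simp add: frustum_E_def W_def[symmetric])
    then have "real n / (real n + 1) * frustum_E n q * ((real n + 1) * W\<^sup>2) = real n * frustum_N n q"
      by simp
    moreover have "((1 - \<beta>) / A - \<beta> * q ^ (n - 1) / A) * ((real n + 1) * W\<^sup>2)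
        = real n * (1 - q) * (real n + 1) * W - (1 + q ^ (n - 1)) * ((real n)\<^sup>2 * (1 - q ^ Suc n) - real n * (real n + 1) * q * W)"
      unfolding X Y ZW[symmetric] XW[symmetric] by (simp only: algebra_simps)
    ultimately show "((1 - \<beta>) / A - \<beta> * q ^ (n - 1) / A) * ((real n + 1) * W\<^sup>2)
        = real n / (real n + 1) * frustum_E n q * ((real n + 1) * W\<^sup>2)"
      unfolding W_def k frustum_N_def by (simp add: q2 power2_eq_square algebra_simps)
  qed
qed

text \<open>
  The inequality for the profile \<open>f\<close> of a body whose heights are rescaled to \<open>[0, 1]\<close>. The comparison
  with the frustum of the same mass and mean bounds both \<open>f 0\<close> and \<open>f 1\<close>; equality in the conclusion
  forces equality at both ends and a degenerate frustum.
\<close>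

theorem concave_profile_inequality:
  fixes f :: "real \<Rightarrow> real"
  assumes concave: "concave_on {0..1} f"
    and nonneg: "\<And>s. 0 \<le> s \<Longrightarrow> s \<le> 1 \<Longrightarrow> 0 \<le> f s"
    and n: "3 \<le> n"
    and f_int: "((\<lambda>s. f s ^ (n - 1)) has_integral V) {0..1}" "((\<lambda>s. s * f s ^ (n - 1)) has_integral \<beta> * V) {0..1}"
    and V: "0 < V" and \<beta>: "1 / 2 \<le> \<beta>" "\<beta> < 1"
    and x: "0 \<le> x" "x \<le> (1 - \<beta>) * f 1 ^ (n - 1) / V" and y: "0 \<le> y" "y \<le> \<beta> * f 0 ^ (n - 1) / V"
  shows "slab_functional n x y \<le> 1"
    and "slab_functional n x y = 1 \<Longrightarrow> ((\<lambda>s. (f 0 + (f 1 - f 0) * s) ^ (n - 1)) has_integral V) {0..1} \<and> (f 0 = 0 \<or> f 0 = f 1)"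
proof -
  note conc = concave_unit_intervalD[OF concave]
  have n2: "2 \<le> n" and m: "0 < n - 1" using n by auto
  have "\<beta> / real n \<le> 1 / (real n + 1)"
    using \<beta> by (intro concave_mean_le[OF concave nonneg n2 f_int V]) auto
  then obtain q where q: "0 \<le> q" "q \<le> 1"
    and q\<beta>: "((\<lambda>s. (s - \<beta>) * (q + (1 - q) * s) ^ (n - 1)) has_integral 0) {0..1}"
    using linear_with_mean[OF n2 \<beta>(1)] by blast
  define A where "A = integral {0..1} (\<lambda>s. (q + (1 - q) * s) ^ (n - 1))"
  have A: "((\<lambda>s. (q + (1 - q) * s) ^ (n - 1)) has_integral A) {0..1}"
    unfolding A_def by (intro integrable_integral integrable_continuous_real continuous_intros)
  have A0: "0 < A"
  proof (cases "q = 1")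
    case True
    then have "A = 1" using A has_integral_const_real[of "1::real" 0 1] by (simp add: has_integral_unique)
    then show ?thesis by simp
  qed (use frustum_values(1)[OF q(1) _ n q\<beta> A] q in auto)
  define X where "X = (1 - \<beta>) / A"
  define Y where "Y = \<beta> * q ^ (n - 1) / A"
  have XY: "Y \<le> X \<and> slab_functional n X Y \<le> 1 \<and> (slab_functional n X Y = 1 \<longrightarrow> q = 0 \<or> q = 1)"
  proof (cases "q = 1")
    case True
    then have A1: "A = 1" using A has_integral_const_real[of "1::real" 0 1] by (simp add: has_integral_unique)
    have "((\<lambda>s. s - \<beta>) has_integral 0) {0..1}" using q\<beta> True by simp
    from has_integral_unique[OF this has_integral_shifted_identity] have "\<beta> = 1 / 2" by simp
    then have XY1: "X = 1 / 2" "Y = 1 / 2" using True A1 by (simp_all add: X_def Y_def)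
    have "Y \<le> X" using XY1 by simp
    moreover have "slab_functional n X Y = 1" unfolding XY1 slab_functional_def using n by (simp add: zero_power)
    ultimately show ?thesis using True by simp
  next
    case False
    then have q1: "q < 1" using q by simp
    note fv = frustum_values[OF q(1) q1 n q\<beta> A, folded X_def Y_def]
    have E0: "0 \<le> frustum_E n q"
      using frustum_N_nonneg[OF q(1) q1, of n] n by (simp add: frustum_E_def)
    have "0 \<le> X - Y" unfolding fv using E0 by simp
    have "(real n + 1) * \<bar>X - Y\<bar> / real n = frustum_E n q"
      unfolding fv using E0 n by (simp add: abs_mult)
    then have "slab_functional n X Y = 1 - frustum_\<phi> n q / (real n + 1) + frustum_E n q ^ n / (real n + 1)"
      using slab_functional_eq[of n X Y] fv(2) n by simp
    then have "slab_functional n X Y = 1 - (frustum_\<phi> n q - frustum_E n q ^ n) / (real n + 1)"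
      by (simp add: diff_divide_distrib)
    moreover have "0 \<le> (frustum_\<phi> n q - frustum_E n q ^ n) / (real n + 1)"
      using frustum_ineq(1)[OF q(1) q1 n] by simp
    moreover have "0 < (frustum_\<phi> n q - frustum_E n q ^ n) / (real n + 1)" if "q \<noteq> 0"
      using frustum_ineq(2)[OF q(1) q1 n] that q by simp
    ultimately show ?thesis using \<open>0 \<le> X - Y\<close> by force
  qed
  \<comment> \<open>the frustum \<open>k * (q + (1 - q) * s)\<close> has mass \<open>V\<close> and mean \<open>\<beta>\<close>\<close>
  define k where "k = root (n - 1) (V / A)"
  have k: "0 < k" "k ^ (n - 1) = V / A" using V A0 m by (auto simp: k_def real_root_pow_pos2)
  have g_eq: "k * q + (k - k * q) * s = k * (q + (1 - q) * s)" for s by (simp add: algebra_simps)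
  have g1: "((\<lambda>s. (k * q + (k - k * q) * s) ^ (n - 1)) has_integral V) {0..1}"
  proof -
    have "((\<lambda>s. k ^ (n - 1) * (q + (1 - q) * s) ^ (n - 1)) has_integral k ^ (n - 1) * A) {0..1}"
      by (intro has_integral_mult_right A)
    moreover have "k ^ (n - 1) * A = V" using A0 k(2) by simp
    ultimately show ?thesis by (simp only: g_eq power_mult_distrib)
  qed
  have g2: "((\<lambda>s. s * (k * q + (k - k * q) * s) ^ (n - 1)) has_integral \<beta> * V) {0..1}"
  proof -
    have "((\<lambda>s. k ^ (n - 1) * ((s - \<beta>) * (q + (1 - q) * s) ^ (n - 1)) + \<beta> * (k * q + (k - k * q) * s) ^ (n - 1))
        has_integral k ^ (n - 1) * 0 + \<beta> * V) {0..1}"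
      by (intro has_integral_add has_integral_mult_right q\<beta> g1)
    moreover have "k ^ (n - 1) * ((s - \<beta>) * (q + (1 - q) * s) ^ (n - 1)) + \<beta> * (k * q + (k - k * q) * s) ^ (n - 1)
        = s * (k * q + (k - k * q) * s) ^ (n - 1)" for s
      unfolding g_eq power_mult_distrib by (simp add: left_diff_distrib right_diff_distrib)
    ultimately show ?thesis by simp
  qed
  have ends: "f 1 \<le> k" "f 0 \<le> k * q"
    using concave_right_end_le[OF concave nonneg _ _ m f_int g1 g2]
      concave_left_end_le[OF concave nonneg _ _ m f_int g1 g2] k q by auto
  have fX: "(1 - \<beta>) * f 1 ^ (n - 1) / V \<le> X" "\<beta> * f 0 ^ (n - 1) / V \<le> Y"
  proof -
    have h: "f 1 ^ (n - 1) \<le> V / A" "f 0 ^ (n - 1) \<le> V / A * q ^ (n - 1)"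
      using power_mono[OF ends(1) nonneg[of 1], of "n - 1"] power_mono[OF ends(2) nonneg[of 0], of "n - 1"]
      unfolding power_mult_distrib k(2) by auto
    have "(1 - \<beta>) * f 1 ^ (n - 1) / V \<le> (1 - \<beta>) * (V / A) / V"
      "\<beta> * f 0 ^ (n - 1) / V \<le> \<beta> * (V / A * q ^ (n - 1)) / V"
      by (intro divide_right_mono mult_left_mono h; use \<beta> V in simp)+
    then show "(1 - \<beta>) * f 1 ^ (n - 1) / V \<le> X" "\<beta> * f 0 ^ (n - 1) / V \<le> Y"
      using V by (simp_all add: X_def Y_def)
  qed
  note mono = slab_functional_mono[OF n2 x(1) order_trans[OF x(2) fX(1)] y(1) order_trans[OF y(2) fX(2)]]
  show "slab_functional n x y \<le> 1" using mono(1) XY by blast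
  assume "slab_functional n x y = 1"
  then have eq: "x = X" "y = Y" "slab_functional n X Y = 1" using mono(2) XY by blast+
  then have q01: "q = 0 \<or> q = 1" using XY by blast
  have pow_eq: "u = v" if "u ^ (n - 1) = v ^ (n - 1)" "0 \<le> u" "0 \<le> v" for u v :: real
    using that m power_eq_iff_eq_base by blast
  have "(1 - \<beta>) * f 1 ^ (n - 1) / V = (1 - \<beta>) * (V / A) / V"
    using eq(1) x(2) fX(1) V by (simp add: X_def)
  then have "(1 - \<beta>) * f 1 ^ (n - 1) = (1 - \<beta>) * (V / A)" using V by (simp only: divide_cancel_right) auto
  then have "f 1 ^ (n - 1) = k ^ (n - 1)" using \<beta> unfolding k(2) by (simp only: mult_cancel_left) auto
  then have f1: "f 1 = k" using nonneg[of 1] k by (rule_tac pow_eq) auto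
  have "\<beta> * f 0 ^ (n - 1) / V = \<beta> * (V / A * q ^ (n - 1)) / V"
    using eq(2) y(2) fX(2) V by (simp add: Y_def)
  then have "\<beta> * f 0 ^ (n - 1) = \<beta> * (V / A * q ^ (n - 1))" using V by (simp only: divide_cancel_right) auto
  then have "f 0 ^ (n - 1) = (k * q) ^ (n - 1)" using \<beta> unfolding power_mult_distrib k(2) by (simp only: mult_cancel_left) auto
  then have f0: "f 0 = k * q" using nonneg[of 0] k q by (rule_tac pow_eq) auto
  show "((\<lambda>s. (f 0 + (f 1 - f 0) * s) ^ (n - 1)) has_integral V) {0..1} \<and> (f 0 = 0 \<or> f 0 = f 1)"
    using g1 q01 by (auto simp: f0 f1)
qed

section \<open>Volumes of convex bodies\<close>

lemma interior_convex_nonempty: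
  fixes S :: "'a::euclidean_space set"
  assumes "convex S" "compact S" "0 < measure lborel S"
  shows "interior S \<noteq> {}"
proof
  assume "interior S = {}"
  then have "negligible S" using assms(1) by (simp add: negligible_convex_interior)
  then have "emeasure lborel S = 0"
    using borel_compact[OF assms(2)] by (simp add: negligible_iff_emeasure0)
  then show False using assms(3) by (simp add: measure_def)
qed

lemma emeasure_open_pos:
  fixes S :: "'a::euclidean_space set"
  assumes "open S" "S \<noteq> {}"
  shows "0 < emeasure lborel S"
proof (rule ccontr)
  assume "\<not> 0 < emeasure lborel S"
  then have "negligible S" using borel_open[OF assms(1)] by (simp add: negligible_iff_emeasure0)
  then show False using open_not_negligible[OF assms] by contradiction
qed

lemma measure_interior_pos:
  fixes K :: "'a::euclidean_space set"
  assumes "compact K" "interior K \<noteq> {}"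
  shows "0 < measure lborel K"
proof -
  have "0 < emeasure lborel (interior K)" using assms by (intro emeasure_open_pos) auto
  also have "\<dots> \<le> emeasure lborel K"
    using borel_compact[OF assms(1)] interior_subset by (intro emeasure_mono) auto
  finally show ?thesis
    using emeasure_compact_finite[OF assms(1)] by (simp add: measure_def enn2real_positive_iff)
qed

text \<open>
  A point of \<open>K\<close> outside \<open>C\<close> has a neighbourhood that misses \<open>C\<close> and meets the interior of \<open>K\<close> in a
  nonempty open set.
\<close>

lemma compact_convex_eq_of_measure_ge:
  fixes C K :: "'a::euclidean_space set"
  assumes C: "compact C" "C \<subseteq> K" and K: "compact K" "convex K" "interior K \<noteq> {}"
    and ge: "measure lborel K \<le> measure lborel C"
  shows "C = K"
proof (rule ccontr)
  assume "C \<noteq> K"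
  then obtain x where x: "x \<in> K" "x \<notin> C" using C by blast
  have "closure (interior K) = closure K" using K by (intro convex_closure_interior)
  then have "x \<in> closure (interior K)" using x(1) closure_subset by blast
  moreover have op: "open (- C)" using C(1) by (simp add: compact_imp_closed open_Compl)
  ultimately have ne: "- C \<inter> interior K \<noteq> {}"
    using x(2) open_Int_closure_eq_empty[OF op, of "interior K"] by blast
  have fin: "emeasure lborel S = ennreal (measure lborel S)" if "compact S" for S :: "'a set"
    using emeasure_compact_finite[OF that] by (intro emeasure_eq_ennreal_measure) auto
  have "0 < emeasure lborel (- C \<inter> interior K)"
    using op ne by (intro emeasure_open_pos open_Int) auto
  then have "emeasure lborel C < emeasure lborel C + emeasure lborel (- C \<inter> interior K)"
    by (simp add: fin[OF C(1)])
  also have "\<dots> = emeasure lborel (C \<union> (- C \<inter> interior K))"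
    using borel_compact[OF C(1)] op by (intro plus_emeasure) auto
  also have "\<dots> \<le> emeasure lborel K"
    using borel_compact[OF K(1)] C(2) interior_subset by (intro emeasure_mono) auto
  finally show False using ge by (simp add: fin C K ennreal_less_iff)
qed

section \<open>Equality in the Brunn-Minkowski inequality\<close>

text \<open>
  The distribution of \<open>x \<bullet> e\<close> for a point \<open>x\<close> distributed uniformly in \<open>S\<close>.
\<close>

definition marginal :: "'a::euclidean_space set \<Rightarrow> 'a \<Rightarrow> real measure" where
  "marginal S e = distr (uniform_measure lborel S) borel (\<lambda>x. x \<bullet> e)"

locale positive_compact =
  fixes S :: "'a::euclidean_space set"
  assumes S: "compact S" "0 < measure lborel S"
begin

lemma S_borel [measurable]: "S \<in> sets borel"
  using S(1) by (rule borel_compact)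

lemma emeasure_S: "emeasure lborel S = ennreal (measure lborel S)"
  using emeasure_compact_finite[OF S(1)] by (intro emeasure_eq_ennreal_measure) auto

sublocale U: prob_space "uniform_measure lborel S"
  using S(2) emeasure_S by (intro prob_space_uniform_measure) auto

lemma cdf_marginal: "cdf (marginal S e) r = measure lborel (S \<inter> {x. x \<bullet> e \<le> r}) / measure lborel S"
proof -
  have "{x \<in> space borel. x \<bullet> e \<le> r} \<in> sets borel" by measurable
  then have [measurable]: "{x. x \<bullet> e \<le> r} \<in> sets borel" by simp
  have "cdf (marginal S e) r = measure (uniform_measure lborel S) ((\<lambda>x. x \<bullet> e) -` {..r} \<inter> space (uniform_measure lborel S))"
    unfolding cdf_def marginal_def by (rule measure_distr) auto
  also have "(\<lambda>x. x \<bullet> e) -` {..r} \<inter> space (uniform_measure lborel S) = {x. x \<bullet> e \<le> r}" by auto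
  also have "measure (uniform_measure lborel S) {x. x \<bullet> e \<le> r} = measure lborel (S \<inter> {x. x \<bullet> e \<le> r}) / measure lborel S"
    using S(2) emeasure_S by (intro measure_uniform_measure) auto
  finally show ?thesis .
qed

lemma real_distribution_marginal: "real_distribution (marginal S e)"
  unfolding marginal_def by (intro U.real_distribution_distr) simp

lemma integrable_uniform:
  fixes f :: "'a \<Rightarrow> 'b::{banach, second_countable_topology}"
  assumes "continuous_on UNIV f"
  shows "integrable (uniform_measure lborel S) f"
proof -
  have "compact (f ` S)"
    by (rule compact_continuous_image[OF continuous_on_subset[OF assms] S(1)]) auto
  then have "bounded (f ` S)" by (rule compact_imp_bounded)
  then obtain B where B: "\<And>x. x \<in> S \<Longrightarrow> norm (f x) \<le> B"
    unfolding bounded_iff by blast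
  show ?thesis
  proof (rule U.integrable_const_bound[of _ B])
    show "AE x in uniform_measure lborel S. norm (f x) \<le> B"
      by (rule AE_uniform_measureI) (auto simp: B)
    have "f \<in> borel_measurable borel" using assms by (rule borel_measurable_continuous_onI)
    then show "f \<in> borel_measurable (uniform_measure lborel S)" by simp
  qed
qed

lemma nn_integral_exp:
  "(\<integral>\<^sup>+x. ennreal (exp (x \<bullet> e)) * indicator S x \<partial>lborel)
    = ennreal (measure lborel S * (\<integral>x. exp x \<partial>marginal S e))"
proof -
  have int: "integrable (uniform_measure lborel S) (\<lambda>x. exp (x \<bullet> e))"
    by (intro integrable_uniform continuous_intros)
  have "ennreal (\<integral>x. exp x \<partial>marginal S e) = ennreal (\<integral>x. exp (x \<bullet> e) \<partial>uniform_measure lborel S)"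
    unfolding marginal_def by (subst integral_distr) auto
  also have "\<dots> = (\<integral>\<^sup>+x. ennreal (exp (x \<bullet> e)) \<partial>uniform_measure lborel S)"
    using nn_integral_eq_integral[OF int] by simp
  also have "\<dots> = (\<integral>\<^sup>+x. ennreal (exp (x \<bullet> e)) * indicator S x \<partial>lborel) / emeasure lborel S"
    by (rule nn_integral_uniform_measure) auto
  finally have "ennreal (measure lborel S) * ennreal (\<integral>x. exp x \<partial>marginal S e)
      = emeasure lborel S * ((\<integral>\<^sup>+x. ennreal (exp (x \<bullet> e)) * indicator S x \<partial>lborel) / emeasure lborel S)"
    using emeasure_S by simp
  also have "\<dots> = (\<integral>\<^sup>+x. ennreal (exp (x \<bullet> e)) * indicator S x \<partial>lborel)"
    using S(2) by (simp add: emeasure_S ennreal_mult_divide_eq mult.commute[of "ennreal _"] ennreal_times_divide)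
  finally show ?thesis using S(2) by (simp add: ennreal_mult')
qed

definition mean :: 'a where "mean = (\<integral>x. x \<partial>uniform_measure lborel S)"

lemma integral_marginal: "(\<integral>x. x \<partial>marginal S e) = mean \<bullet> e"
proof -
  have "(\<integral>x. x \<partial>marginal S e) = (\<integral>x. x \<bullet> e \<partial>uniform_measure lborel S)"
    unfolding marginal_def by (subst integral_distr) auto
  also have "\<dots> = mean \<bullet> e"
    unfolding mean_def by (intro integral_inner_left integrable_uniform continuous_intros)
  finally show ?thesis .
qed

lemma integrable_marginal:
  assumes "continuous_on UNIV f"
  shows "integrable (marginal S e) (f :: real \<Rightarrow> real)"
proof -
  have "continuous_on UNIV (\<lambda>x. f (x \<bullet> e))"
    by (intro continuous_on_compose2[OF assms] continuous_intros) auto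
  from integrable_uniform[OF this] show ?thesis
    unfolding marginal_def using assms
    by (subst integrable_distr_eq) (auto intro: borel_measurable_continuous_onI)
qed

end

text \<open>
  The generalized inverse of the distribution function, in the form used in the proof of
  Skorohod's theorem: applied to a uniform random variable it has distribution \<open>M\<close>.
\<close>

abbreviation quantile :: "real measure \<Rightarrow> real \<Rightarrow> real" where
  "quantile M \<theta> \<equiv> Inf {x. \<theta> \<le> cdf M x}"

text \<open>
  The marginals of \<open>A\<close> and \<open>B\<close> in any direction \<open>e\<close> agree up to a translation. The
  Prekopa-Leindler inequality for the parts of the bodies below given levels shows that the quantile
  function of \<open>M\<close> is at most the average of those of \<open>A\<close> and \<open>B\<close>. Therefore the mean of
  \<open>exp (x \<bullet> e)\<close> over \<open>M\<close> is at most the integral of \<open>exp (quantile_A / 2) exp (quantile_B / 2)\<close>. The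
  weighted Prekopa-Leindler inequality bounds it from below by the geometric mean of the means
  over \<open>A\<close> and \<open>B\<close>. This is the case of equality in the Cauchy-Schwarz inequality, so the two
  exponentials are proportional and the quantile functions differ by a constant. That constant is
  the difference of the mean values of \<open>x \<bullet> e\<close>.
\<close>

lemma brunn_minkowski_equal_marginals:
  fixes A B M :: "'a::euclidean_space set"
  assumes comp: "compact A" "compact B" "compact M"
    and vol: "0 < measure lborel A" "measure lborel B = measure lborel A" "measure lborel M = measure lborel A"
    and mid: "\<And>x y. x \<in> A \<Longrightarrow> y \<in> B \<Longrightarrow> (1/2) *\<^sub>R x + (1/2) *\<^sub>R y \<in> M"
  shows "measure lborel (B \<inter> {x. x \<bullet> e \<le> r + (positive_compact.mean B \<bullet> e - positive_compact.mean A \<bullet> e)})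
    = measure lborel (A \<inter> {x. x \<bullet> e \<le> r})"
proof -
  interpret A: positive_compact A using comp vol by unfold_locales auto
  interpret B: positive_compact B using comp vol by unfold_locales auto
  interpret M: positive_compact M using comp vol by unfold_locales auto
  interpret LA: cdf_distribution "marginal A e"
    unfolding cdf_distribution_def by (rule A.real_distribution_marginal)
  interpret LB: cdf_distribution "marginal B e"
    unfolding cdf_distribution_def by (rule B.real_distribution_marginal)
  interpret LM: cdf_distribution "marginal M e"
    unfolding cdf_distribution_def by (rule M.real_distribution_marginal)
  let ?v = "measure lborel A"
  let ?\<Omega> = "restrict_space lborel {0<..<1} :: real measure"
  let ?a = "quantile (marginal A e)" and ?b = "quantile (marginal B e)" and ?m = "quantile (marginal M e)"
  interpret \<Omega>: prob_space ?\<Omega>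
    by (auto simp add: emeasure_restrict_space space_restrict_space intro!: prob_spaceI)
  have half: "{x. x \<bullet> e \<le> r} \<in> sets borel" for r
  proof -
    have "{x \<in> space borel. x \<bullet> e \<le> r} \<in> sets borel" by measurable
    then show ?thesis by simp
  qed
  note [measurable] = half
  have meas: "?a \<in> borel_measurable ?\<Omega>" "?b \<in> borel_measurable ?\<Omega>" "?m \<in> borel_measurable ?\<Omega>"
    using LA.measurable_CI LB.measurable_CI LM.measurable_CI
    by (simp_all cong: measurable_cong_sets add: sets_restrict_space)
  note [measurable] = meas
  have quantile_mid: "?m \<theta> \<le> (?a \<theta> + ?b \<theta>) / 2" if \<theta>: "0 < \<theta>" "\<theta> < 1" for \<theta>
  proof -
    have "\<theta> \<le> cdf (marginal A e) (?a \<theta>)" "\<theta> \<le> cdf (marginal B e) (?b \<theta>)"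
      using LA.pseudoinverse[OF \<theta>] LB.pseudoinverse[OF \<theta>] by blast+
    then have \<theta>v: "\<theta> * ?v \<le> measure lborel (A \<inter> {x. x \<bullet> e \<le> ?a \<theta>})" "\<theta> * ?v \<le> measure lborel (B \<inter> {x. x \<bullet> e \<le> ?b \<theta>})"
      using vol by (simp_all add: A.cdf_marginal B.cdf_marginal pos_le_divide_eq)
    define r where "r = (?a \<theta> + ?b \<theta>) / 2"
    let ?A = "A \<inter> {x. x \<bullet> e \<le> ?a \<theta>}" and ?B = "B \<inter> {x. x \<bullet> e \<le> ?b \<theta>}" and ?M = "M \<inter> {x. x \<bullet> e \<le> r}"
    have fin: "emeasure lborel (S \<inter> {x. x \<bullet> e \<le> s}) = ennreal (measure lborel (S \<inter> {x. x \<bullet> e \<le> s}))"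
      if "compact S" for S s
    proof -
      have "compact (S \<inter> {x. x \<bullet> e \<le> s})"
        by (intro compact_Int_closed that closed_Collect_le continuous_intros)
      from emeasure_compact_finite[OF this] show ?thesis by (intro emeasure_eq_ennreal_measure) auto
    qed
    have "geomean_le (1/2) (emeasure lborel ?A) (emeasure lborel ?B) (emeasure lborel ?M)"
    proof (rule prekopa_leindler_sets)
      fix x y assume "x \<in> ?A" "y \<in> ?B"
      then show "(1 - 1/2) *\<^sub>R x + (1/2) *\<^sub>R y \<in> ?M"
        using mid[of x y] by (simp add: r_def inner_add_left field_simps)
    qed auto
    then have "geomean_le (1/2) (ennreal (measure lborel ?A)) (ennreal (measure lborel ?B)) (ennreal (measure lborel ?M))"
      using fin comp by simp
    then have "measure lborel ?A powr (1 - 1/2) * measure lborel ?B powr (1/2) \<le> measure lborel ?M"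
      by (rule geomean_leD) auto
    moreover have "(\<theta> * ?v) powr (1 - 1/2) * (\<theta> * ?v) powr (1/2) \<le> measure lborel ?A powr (1 - 1/2) * measure lborel ?B powr (1/2)"
      using \<theta>v \<theta> vol(1) by (intro mult_mono powr_mono2) auto
    moreover have "(\<theta> * ?v) powr (1 - 1/2) * (\<theta> * ?v) powr (1/2) = \<theta> * ?v"
      using \<theta> vol(1) by (simp add: powr_add[symmetric] del: powr_half_sqrt)
    ultimately have "\<theta> * ?v \<le> measure lborel ?M" by linarith
    then have "\<theta> \<le> cdf (marginal M e) r"
      using vol by (simp add: M.cdf_marginal pos_le_divide_eq)
    then have "?m \<theta> \<le> r" using LM.pseudoinverse[OF \<theta>] by blast
    then show ?thesis by (simp only: r_def)
  qed
  define EA EB EM where "EA = (\<integral>x. exp x \<partial>marginal A e)" and "EB = (\<integral>x. exp x \<partial>marginal B e)"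
    and "EM = (\<integral>x. exp x \<partial>marginal M e)"
  have intexp: "integrable ?\<Omega> (\<lambda>\<theta>. exp (?a \<theta>))" "integrable ?\<Omega> (\<lambda>\<theta>. exp (?b \<theta>))" "integrable ?\<Omega> (\<lambda>\<theta>. exp (?m \<theta>))"
  proof -
    have "integrable (distr ?\<Omega> borel ?a) exp" "integrable (distr ?\<Omega> borel ?b) exp" "integrable (distr ?\<Omega> borel ?m) exp"
      unfolding LA.distr_I_eq_M LB.distr_I_eq_M LM.distr_I_eq_M
      by (intro A.integrable_marginal B.integrable_marginal M.integrable_marginal continuous_intros)+
    then show "integrable ?\<Omega> (\<lambda>\<theta>. exp (?a \<theta>))" "integrable ?\<Omega> (\<lambda>\<theta>. exp (?b \<theta>))" "integrable ?\<Omega> (\<lambda>\<theta>. exp (?m \<theta>))"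
      using integrable_distr_eq[OF meas(1), of exp] integrable_distr_eq[OF meas(2), of exp]
        integrable_distr_eq[OF meas(3), of exp] by simp_all
  qed
  have E: "EA = (\<integral>\<theta>. exp (?a \<theta>) \<partial>?\<Omega>)" "EB = (\<integral>\<theta>. exp (?b \<theta>) \<partial>?\<Omega>)" "EM = (\<integral>\<theta>. exp (?m \<theta>) \<partial>?\<Omega>)"
    using integral_distr[OF meas(1), of exp] integral_distr[OF meas(2), of exp] integral_distr[OF meas(3), of exp]
    by (simp_all add: EA_def EB_def EM_def LA.distr_I_eq_M LB.distr_I_eq_M LM.distr_I_eq_M)
  have pos: "0 < (\<integral>\<theta>. exp (h \<theta>) \<partial>?\<Omega>)" if "integrable ?\<Omega> (\<lambda>\<theta>. exp (h \<theta>))" for h :: "real \<Rightarrow> real"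
  proof -
    have "(\<integral>\<theta>. exp (h \<theta>) \<partial>?\<Omega>) \<noteq> 0"
    proof
      assume "(\<integral>\<theta>. exp (h \<theta>) \<partial>?\<Omega>) = 0"
      then have "AE \<theta> in ?\<Omega>. exp (h \<theta>) = 0"
        using integral_nonneg_eq_0_iff_AE[OF that] by simp
      then have "AE \<theta> in ?\<Omega>. False" by simp
      then show False by simp
    qed
    moreover have "0 \<le> (\<integral>\<theta>. exp (h \<theta>) \<partial>?\<Omega>)" by (rule integral_nonneg_AE) simp
    ultimately show ?thesis by linarith
  qed
  have EA: "0 < EA" and EB: "0 < EB"
    using pos[OF intexp(1)] pos[OF intexp(2)] by (simp_all only: E)
  have EM0: "0 < EM" using pos[OF intexp(3)] by (simp only: E)
  have PL: "sqrt EA * sqrt EB \<le> EM"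
  proof -
    let ?f = "\<lambda>S x. ennreal (exp (x \<bullet> e)) * indicator S x"
    have "geomean_le (1/2) (\<integral>\<^sup>+x. ?f A x \<partial>lborel) (\<integral>\<^sup>+x. ?f B x \<partial>lborel) (\<integral>\<^sup>+x. ?f M x \<partial>lborel)"
    proof (rule prekopa_leindler)
      fix x y :: 'a
      show "geomean_le (1/2) (?f A x) (?f B y) (?f M ((1 - 1/2) *\<^sub>R x + (1/2) *\<^sub>R y))"
        unfolding geomean_le_def
      proof (intro allI impI)
        fix a' b' :: real
        assume a': "0 < a'" "ennreal a' < ?f A x" and b': "0 < b'" "ennreal b' < ?f B y"
        have x: "x \<in> A" using a' by (cases "x \<in> A") auto
        have y: "y \<in> B" using b' by (cases "y \<in> B") auto
        have lt: "a' < exp (x \<bullet> e)" "b' < exp (y \<bullet> e)" using a' b' x y by (simp_all add: ennreal_less_iff)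
        define z where "z = (1 - 1/2) *\<^sub>R x + (1/2) *\<^sub>R y"
        have "a' powr (1 - 1/2) * b' powr (1/2) \<le> exp (x \<bullet> e) powr (1 - 1/2) * exp (y \<bullet> e) powr (1/2)"
          using lt a' b' by (intro mult_mono powr_mono2) auto
        also have "\<dots> = exp (x \<bullet> e * (1 - 1/2) + y \<bullet> e * (1/2))"
          by (simp only: exp_powr_real exp_add)
        also have "x \<bullet> e * (1 - 1/2) + y \<bullet> e * (1/2) = z \<bullet> e"
          by (simp add: z_def inner_add_left)
        finally have "ennreal (a' powr (1 - 1/2) * b' powr (1/2)) \<le> ennreal (exp (z \<bullet> e))"
          by (rule ennreal_leI)
        moreover have "z \<in> M" using mid[OF x y] by (simp add: z_def)
        ultimately show "ennreal (a' powr (1 - 1/2) * b' powr (1/2)) \<le> ?f M ((1 - 1/2) *\<^sub>R x + (1/2) *\<^sub>R y)"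
          unfolding z_def[symmetric] by simp
      qed
    qed auto
    then have "geomean_le (1/2) (ennreal (?v * EA)) (ennreal (?v * EB)) (ennreal (?v * EM))"
      unfolding A.nn_integral_exp B.nn_integral_exp M.nn_integral_exp EA_def EB_def EM_def vol(2,3) .
    then have "(?v * EA) powr (1 - 1/2) * (?v * EB) powr (1/2) \<le> ?v * EM"
      using EA EB EM0 vol(1) by (intro geomean_leD) auto
    then have "sqrt (?v * EA) * sqrt (?v * EB) \<le> ?v * EM"
      using EA EB vol(1) by (simp add: powr_half_sqrt)
    moreover have "sqrt (?v * EA) * sqrt (?v * EB) = ?v * (sqrt EA * sqrt EB)"
      using vol(1) by (simp add: real_sqrt_mult)
    ultimately show ?thesis using vol(1) by simp
  qed
  have intmid: "integrable ?\<Omega> (\<lambda>\<theta>. exp ((?a \<theta> + ?b \<theta>) / 2))"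
  proof (rule Bochner_Integration.integrable_bound)
    show "integrable ?\<Omega> (\<lambda>\<theta>. exp (?a \<theta>) + exp (?b \<theta>))"
      using intexp by (intro Bochner_Integration.integrable_add)
    have "exp ((s + t) / 2) \<le> exp s + exp t" for s t :: real
    proof -
      have "exp ((s + t) / 2) \<le> exp (max s t)" by simp
      also have "\<dots> \<le> exp s + exp t" by (simp add: max_def)
      finally show ?thesis .
    qed
    then show "AE \<theta> in ?\<Omega>. norm (exp ((?a \<theta> + ?b \<theta>) / 2)) \<le> norm (exp (?a \<theta>) + exp (?b \<theta>))"
      by simp
  qed measurable
  have EM_le: "EM \<le> (\<integral>\<theta>. exp ((?a \<theta> + ?b \<theta>) / 2) \<partial>?\<Omega>)"
    unfolding E using intexp intmid quantile_mid
    by (intro integral_mono) (auto simp: space_restrict_space)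
  define d where "d = ln (EB / EA)"
  \<comment> \<open>the defect in the Cauchy-Schwarz inequality\<close>
  let ?D = "\<lambda>\<theta>. (exp (?a \<theta> / 2) * sqrt EB - exp (?b \<theta> / 2) * sqrt EA)\<^sup>2"
  have sq: "(exp (t / 2))\<^sup>2 = exp t" for t :: real by (simp add: power2_eq_square flip: exp_add)
  have D_eq: "?D = (\<lambda>\<theta>. EB * exp (?a \<theta>) + EA * exp (?b \<theta>) - 2 * (sqrt EA * sqrt EB) * exp ((?a \<theta> + ?b \<theta>) / 2))"
  proof
    fix \<theta>
    have "exp ((?a \<theta> + ?b \<theta>) / 2) = exp (?a \<theta> / 2) * exp (?b \<theta> / 2)"
      by (simp add: add_divide_distrib exp_add)
    then show "?D \<theta> = EB * exp (?a \<theta>) + EA * exp (?b \<theta>) - 2 * (sqrt EA * sqrt EB) * exp ((?a \<theta> + ?b \<theta>) / 2)"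
      using EA EB by (simp add: power2_diff power_mult_distrib sq)
  qed
  have intD: "integrable ?\<Omega> ?D" unfolding D_eq using intexp intmid by auto
  have "(\<integral>\<theta>. ?D \<theta> \<partial>?\<Omega>) = EB * EA + EA * EB - 2 * (sqrt EA * sqrt EB) * (\<integral>\<theta>. exp ((?a \<theta> + ?b \<theta>) / 2) \<partial>?\<Omega>)"
    unfolding D_eq using intexp intmid by (simp add: E[symmetric])
  also have "\<dots> \<le> EB * EA + EA * EB - 2 * (sqrt EA * sqrt EB) * (sqrt EA * sqrt EB)"
    using order_trans[OF PL EM_le] EA EB by (intro diff_left_mono mult_left_mono) auto
  also have "\<dots> = 0" using EA EB by (simp add: algebra_simps)
  finally have "(\<integral>\<theta>. ?D \<theta> \<partial>?\<Omega>) \<le> 0" .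
  moreover have "0 \<le> (\<integral>\<theta>. ?D \<theta> \<partial>?\<Omega>)" by (rule integral_nonneg_AE) simp
  ultimately have "AE \<theta> in ?\<Omega>. ?D \<theta> = 0"
    using integral_nonneg_eq_0_iff_AE[OF intD] by simp
  then have AE: "AE \<theta> in ?\<Omega>. ?b \<theta> = ?a \<theta> + d"
  proof eventually_elim
    case (elim \<theta>)
    then have "exp (?a \<theta> / 2) * sqrt EB = exp (?b \<theta> / 2) * sqrt EA" by simp
    then have "(exp (?a \<theta> / 2) * sqrt EB)\<^sup>2 = (exp (?b \<theta> / 2) * sqrt EA)\<^sup>2" by simp
    then have "exp (?a \<theta>) * EB = exp (?b \<theta>) * EA"
      using EA EB by (simp add: power_mult_distrib sq)
    then have "exp (?b \<theta>) = exp (?a \<theta>) * (EB / EA)" using EA by (simp add: field_simps)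
    also have "\<dots> = exp (?a \<theta> + d)" using EA EB by (simp add: exp_add d_def)
    finally show ?case by simp
  qed
  have shift: "marginal B e = distr (marginal A e) borel (\<lambda>x. x + d)"
  proof -
    have "marginal B e = distr ?\<Omega> borel ?b" by (rule LB.distr_I_eq_M[symmetric])
    also have "\<dots> = distr ?\<Omega> borel (\<lambda>\<theta>. ?a \<theta> + d)"
      using AE by (intro distr_cong_AE) auto
    also have "\<dots> = distr (distr ?\<Omega> borel ?a) borel (\<lambda>x. x + d)"
      by (subst distr_distr) (auto simp: comp_def)
    finally show ?thesis by (simp add: LA.distr_I_eq_M)
  qed
  have d: "d = positive_compact.mean B \<bullet> e - positive_compact.mean A \<bullet> e"
  proof -
    have "B.mean \<bullet> e = (\<integral>x. x + d \<partial>marginal A e)"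
      unfolding B.integral_marginal[symmetric] shift by (subst integral_distr) auto
    also have "\<dots> = A.mean \<bullet> e + d"
      using A.integrable_marginal[of "\<lambda>x. x" e] LA.prob_space
      by (simp add: A.integral_marginal)
    finally show ?thesis by simp
  qed
  show "measure lborel (B \<inter> {x. x \<bullet> e \<le> r + (positive_compact.mean B \<bullet> e - positive_compact.mean A \<bullet> e)})
      = measure lborel (A \<inter> {x. x \<bullet> e \<le> r})"
  proof -
    have "cdf (marginal B e) (r + d) = cdf (marginal A e) r"
    proof -
      have "cdf (marginal B e) (r + d) = measure (marginal A e) ((\<lambda>x. x + d) -` {..r + d} \<inter> space (marginal A e))"
        unfolding cdf_def shift by (rule measure_distr) auto
      also have "(\<lambda>x. x + d) -` {..r + d} \<inter> space (marginal A e) = {..r}" by auto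
      finally show ?thesis by (simp add: cdf_def)
    qed
    then show ?thesis using vol by (simp add: A.cdf_marginal B.cdf_marginal d)
  qed
qed

text \<open>
  A point of \<open>B\<close> outside the translate of \<open>A\<close> is strictly separated from it by a hyperplane. The part
  of \<open>B\<close> beyond this hyperplane has positive volume, but the corresponding part of \<open>A\<close> is empty.
\<close>

lemma translate_subset:
  fixes A B :: "'a::euclidean_space set"
  assumes A: "closed A" "convex A" and B: "convex B" "compact B" "0 < measure lborel B"
    and marg: "\<And>e r. measure lborel (B \<inter> {x. x \<bullet> e \<le> r + l \<bullet> e}) = measure lborel (A \<inter> {x. x \<bullet> e \<le> r})"
  shows "B \<subseteq> (\<lambda>x. x + l) ` A"
proof
  fix y assume y: "y \<in> B"
  have "y - l \<in> A"
  proof (rule ccontr)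
    assume "y - l \<notin> A"
    then obtain a b where ab: "a \<bullet> (y - l) < b" "\<And>x. x \<in> A \<Longrightarrow> b < a \<bullet> x"
      using separating_hyperplane_closed_point[OF A(2,1)] by blast
    have "A \<inter> {x. x \<bullet> a \<le> b} = {}"
    proof -
      have "\<not> x \<bullet> a \<le> b" if "x \<in> A" for x using ab(2)[OF that] by (simp add: inner_commute)
      then show ?thesis by blast
    qed
    then have 0: "measure lborel (B \<inter> {x. x \<bullet> a \<le> b + l \<bullet> a}) = 0"
      using marg[of a b] by simp
    let ?H = "{x. x \<bullet> a < b + l \<bullet> a}"
    have H: "open ?H" by (intro open_Collect_less continuous_intros)
    have yH: "y \<in> ?H" using ab(1) by (simp add: inner_commute inner_diff_right algebra_simps)
    have "interior B \<noteq> {}" by (rule interior_convex_nonempty[OF B])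
    then have "closure (interior B) = closure B" using B(1) by (rule convex_closure_interior[rotated])
    then have "y \<in> closure (interior B)" using y closure_subset by auto
    then have ne: "?H \<inter> interior B \<noteq> {}" 
      using yH open_Int_closure_eq_empty[OF H, of "interior B"] by blast
    have op: "open (?H \<inter> interior B)" using H by (intro open_Int) auto
    have "compact (B \<inter> {x. x \<bullet> a \<le> b + l \<bullet> a})"
      by (intro compact_Int_closed B closed_Collect_le continuous_intros)
    then have "emeasure lborel (B \<inter> {x. x \<bullet> a \<le> b + l \<bullet> a}) = 0"
      using 0 emeasure_compact_finite[of "B \<inter> {x. x \<bullet> a \<le> b + l \<bullet> a}"]
      by (subst emeasure_eq_ennreal_measure) auto
    moreover have "emeasure lborel (?H \<inter> interior B) \<le> emeasure lborel (B \<inter> {x. x \<bullet> a \<le> b + l \<bullet> a})"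
    proof (rule emeasure_mono)
      have "interior B \<subseteq> B" by (rule interior_subset)
      then show "?H \<inter> interior B \<subseteq> B \<inter> {x. x \<bullet> a \<le> b + l \<bullet> a}" by force
      show "B \<inter> {x. x \<bullet> a \<le> b + l \<bullet> a} \<in> sets lborel"
        using borel_compact[OF \<open>compact (B \<inter> _)\<close>] by simp
    qed
    ultimately show False using emeasure_open_pos[OF op ne] by simp
  qed
  then show "y \<in> (\<lambda>x. x + l) ` A" by (intro image_eqI[of _ _ "y - l"]) auto
qed

text \<open>
  The translation vector is the difference of the centroids, because in each direction the marginals
  are translates by the difference of their means.
\<close>

theorem brunn_minkowski_equality:
  fixes A B M :: "'a::euclidean_space set"
  assumes conv: "convex A" "convex B" and comp: "compact A" "compact B" "compact M"
    and vol: "0 < measure lborel A" "measure lborel B = measure lborel A" "measure lborel M = measure lborel A"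
    and mid: "\<And>x y. x \<in> A \<Longrightarrow> y \<in> B \<Longrightarrow> (1/2) *\<^sub>R x + (1/2) *\<^sub>R y \<in> M"
  obtains l where "B = (\<lambda>x. x + l) ` A"
proof
  define l where "l = positive_compact.mean B - positive_compact.mean A"
  have marg: "measure lborel (B \<inter> {x. x \<bullet> e \<le> r + l \<bullet> e}) = measure lborel (A \<inter> {x. x \<bullet> e \<le> r})" for e r
    using brunn_minkowski_equal_marginals[OF comp vol mid, of e r] by (simp add: l_def inner_diff_left)
  have "B \<subseteq> (\<lambda>x. x + l) ` A"
    using conv comp vol marg by (intro translate_subset) (auto intro: compact_imp_closed)
  moreover have "A \<subseteq> (\<lambda>x. x + (- l)) ` B"
  proof (rule translate_subset)
    fix e r
    show "measure lborel (A \<inter> {x. x \<bullet> e \<le> r + (- l) \<bullet> e}) = measure lborel (B \<inter> {x. x \<bullet> e \<le> r})"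
      using marg[of e "r - l \<bullet> e"] by simp
  qed (use conv comp vol in \<open>auto intro: compact_imp_closed\<close>)
  then have "(\<lambda>x. x + l) ` A \<subseteq> B" by force
  ultimately show "B = (\<lambda>x. x + l) ` A" by blast
qed

section \<open>From the profile to the body\<close>

text \<open>
  The factor \<open>w\<close> in the profile \<open>f\<close> compensates for rescaling the heights from \<open>[c, c + w]\<close> to \<open>[0, 1]\<close>.
\<close>

lemma section_profile:
  fixes K :: "'a::euclidean_space set"
  assumes K: "compact K" "convex K" and u: "norm u = 1" and dim: "2 \<le> DIM('a)" and w: "0 < w"
    and range: "\<And>x. x \<in> K \<Longrightarrow> c \<le> x \<bullet> u \<and> x \<bullet> u \<le> c + w"
    and ends: "p \<in> K" "p \<bullet> u = c" "q \<in> K" "q \<bullet> u = c + w"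
  defines "f \<equiv> \<lambda>s. root (DIM('a) - 1) (w * section_vol K u (c + w * s))"
  shows "concave_on {0..1} f"
    and "\<And>s. 0 \<le> f s" and "\<And>s. f s ^ (DIM('a) - 1) = w * section_vol K u (c + w * s)"
    and "((\<lambda>s. f s ^ (DIM('a) - 1)) has_integral measure lborel K) {0..1}"
proof -
  let ?m = "DIM('a) - 1"
  have m: "0 < ?m" using dim by simp
  show "0 \<le> f s" for s using w by (simp add: f_def real_root_ge_zero)
  show f_pow: "f s ^ ?m = w * section_vol K u (c + w * s)" for s
    unfolding f_def using m w by (intro real_root_pow_pos2) auto
  have point: "\<exists>x\<in>K. x \<bullet> u = c + w * s" if "0 \<le> s" "s \<le> 1" for s
  proof (intro bexI)
    show "(1 - s) *\<^sub>R p + s *\<^sub>R q \<in> K" using K(2) ends that by (intro convexD) auto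
    show "((1 - s) *\<^sub>R p + s *\<^sub>R q) \<bullet> u = c + w * s" by (simp add: inner_add_left ends algebra_simps)
  qed
  show "concave_on {0..1} f"
  proof (rule concave_unit_intervalI)
    fix s t l :: real assume st: "0 \<le> s" "s \<le> 1" "0 \<le> t" "t \<le> 1" and l: "0 \<le> l" "l \<le> 1"
    obtain x y where x: "x \<in> K" "x \<bullet> u = c + w * s" and y: "y \<in> K" "y \<bullet> u = c + w * t"
      using point st by meson
    have "(1 - l) * f s + l * f t = root ?m w * ((1 - l) * root ?m (section_vol K u (c + w * s)) + l * root ?m (section_vol K u (c + w * t)))"
      using m by (simp add: f_def real_root_mult algebra_simps)
    also have "\<dots> \<le> root ?m w * root ?m (section_vol K u ((1 - l) * (c + w * s) + l * (c + w * t)))"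
      using w by (intro mult_left_mono section_vol_concave[OF K u dim x y l]) (simp add: real_root_ge_zero)
    also have "(1 - l) * (c + w * s) + l * (c + w * t) = c + w * ((1 - l) * s + l * t)"
      by (simp add: algebra_simps)
    finally show "(1 - l) * f s + l * f t \<le> f ((1 - l) * s + l * t)"
      using m by (simp add: f_def real_root_mult)
  qed
  show "((\<lambda>s. f s ^ ?m) has_integral measure lborel K) {0..1}"
    unfolding f_pow using section_integral[OF K(1) u w range, of "\<lambda>_. 1"] borel_compact[OF K(1)]
    by (simp add: set_lebesgue_integral_def)
qed

lemma section_vol_uminus:
  fixes K :: "'a::euclidean_space set"
  assumes K: "compact K" and u: "norm u = 1"
  shows "section_vol K (- u) t = section_vol K u (- t)"
proof -
  have uu: "u \<bullet> u = 1" using u by (simp add: dot_square_norm)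
  have "section_cyl K (- u) t = {x. u + x \<in> section_cyl K u (- t)}"
    by (auto simp: section_cyl_def inner_add_left uu algebra_simps)
  then have "emeasure lborel (section_cyl K (- u) t) = emeasure lborel (section_cyl K u (- t))"
    using emeasure_lborel_translate[OF borel_compact[OF compact_section_cyl[OF K u]]] by simp
  then show ?thesis by (simp add: section_vol_def measure_def)
qed

lemma section_cyl_slice_cong:
  assumes "norm u = 1" "K \<inter> {x. x \<bullet> u = t} = L \<inter> {x. x \<bullet> u = t}"
  shows "section_cyl K u t = section_cyl L u t"
proof -
  have uu: "u \<bullet> u = 1" using assms by (simp add: dot_square_norm)
  have "(x + (t - x \<bullet> u) *\<^sub>R u) \<bullet> u = t" for x by (simp add: inner_add_left uu)
  moreover have "y \<in> K \<longleftrightarrow> y \<in> L" if "y \<bullet> u = t" for y using assms(2) that by blast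
  ultimately show ?thesis by (simp add: section_cyl_def)
qed

lemma convex_section_cyl:
  assumes "convex K"
  shows "convex (section_cyl K u t)"
proof (rule convexI)
  fix x y and a b :: real assume x: "x \<in> section_cyl K u t" and y: "y \<in> section_cyl K u t"
    and ab: "0 \<le> a" "0 \<le> b" "a + b = 1"
  have "a *\<^sub>R (x + (t - x \<bullet> u) *\<^sub>R u) + b *\<^sub>R (y + (t - y \<bullet> u) *\<^sub>R u) \<in> K"
    using assms x y ab by (intro convexD) (simp_all add: section_cyl_def)
  moreover have "a *\<^sub>R (x + (t - x \<bullet> u) *\<^sub>R u) + b *\<^sub>R (y + (t - y \<bullet> u) *\<^sub>R u)
      = (a *\<^sub>R x + b *\<^sub>R y) + (t - (a *\<^sub>R x + b *\<^sub>R y) \<bullet> u) *\<^sub>R u"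
  proof -
    have "t = a * t + b * t" using ab by (simp add: distrib_right[symmetric])
    then show ?thesis
      by (simp add: inner_add_left algebra_simps) (metis scaleR_add_left add.commute)
  qed
  moreover have "0 \<le> a * (x \<bullet> u) + b * (y \<bullet> u)" using x y ab by (simp add: section_cyl_def)
  moreover have "a * (x \<bullet> u) + b * (y \<bullet> u) \<le> 1"
    using x y ab by (intro convex_bound_le) (simp_all add: section_cyl_def)
  ultimately show "a *\<^sub>R x + b *\<^sub>R y \<in> section_cyl K u t"
    by (simp add: section_cyl_def inner_add_left)
qed

text \<open>
  A small ball in the cylinder over the section projects onto a relatively open part of the section.
\<close>

lemma face_convex_body_in:
  fixes K :: "'a::euclidean_space set"
  assumes K: "compact K" "convex K" and u: "norm u = 1" and pos: "0 < section_vol K u t"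
  shows "convex_body_in {x. x \<bullet> u = t} (K \<inter> {x. x \<bullet> u = t})"
proof -
  have uu: "u \<bullet> u = 1" using u by (simp add: dot_square_norm)
  let ?H = "{x. x \<bullet> u = t}"
  have "interior (section_cyl K u t) \<noteq> {}"
    using pos compact_section_cyl[OF K(1) u] convex_section_cyl[OF K(2)]
    by (intro interior_convex_nonempty) (auto simp: section_vol_def)
  then obtain z e where z: "0 < e" "ball z e \<subseteq> section_cyl K u t"
    by (meson all_not_in_conv mem_interior)
  define z' where "z' = z + (t - z \<bullet> u) *\<^sub>R u"
  have z'H: "z' \<in> ?H" by (simp add: z'_def inner_add_left uu)
  have sub: "?H \<inter> ball z' e \<subseteq> K \<inter> ?H"
  proof
    fix y assume y: "y \<in> ?H \<inter> ball z' e"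
    define x where "x = y - (t - z \<bullet> u) *\<^sub>R u"
    have "dist z x = dist z' y" by (simp add: x_def z'_def dist_norm algebra_simps)
    then have "x \<in> section_cyl K u t" using y z by auto
    moreover have "x \<bullet> u = z \<bullet> u" using y by (simp add: x_def inner_diff_left uu)
    ultimately have "y \<in> K" by (simp add: section_cyl_def x_def)
    with y show "y \<in> K \<inter> ?H" by blast
  qed
  have "openin (top_of_set ?H) (?H \<inter> ball z' e)" by (simp add: openin_open_Int)
  from interior_of_maximal[OF sub this] have "z' \<in> (top_of_set ?H) interior_of (K \<inter> ?H)"
    using z'H z(1) by auto
  moreover have "compact (K \<inter> ?H)"
    by (intro compact_Int_closed K closed_Collect_eq continuous_intros)
  moreover have "convex (K \<inter> ?H)"
  proof (rule convex_Int[OF K(2)])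
    show "convex ?H" using convex_hyperplane[of u t] by (simp add: inner_commute)
  qed
  ultimately show ?thesis unfolding convex_body_in_def by blast
qed

lemma interior_height_less:
  fixes K :: "'a::euclidean_space set"
  assumes "x \<in> interior K" and u: "norm u = 1" and a: "\<And>x. x \<in> K \<Longrightarrow> x \<bullet> u \<le> a"
  shows "x \<bullet> u < a"
proof -
  obtain e where e: "0 < e" "cball x e \<subseteq> K" using assms(1) mem_interior_cball by blast
  have "x + e *\<^sub>R u \<in> K" using e u by (intro subsetD[OF e(2)]) (simp add: dist_norm)
  from a[OF this] show ?thesis using e u by (simp add: inner_add_left dot_square_norm)
qed

text \<open>
  Otherwise \<open>x \<bullet> u\<close> would be negative in the interior of \<open>K\<close>, and so would be its integral.
\<close>

lemma centered_support_pos: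
  fixes K :: "'a::euclidean_space set"
  assumes K: "compact K" "interior K \<noteq> {}" and u: "norm u = 1" and a: "\<And>x. x \<in> K \<Longrightarrow> x \<bullet> u \<le> a"
    and mean: "set_lebesgue_integral lborel K (\<lambda>x. x \<bullet> u) = 0"
  shows "0 < a"
proof (rule ccontr)
  assume "\<not> 0 < a"
  have int: "integrable lborel (\<lambda>x. indicator K x *\<^sub>R (- (x \<bullet> u)))"
    by (rule borel_integrable_compact[OF K(1)]) (intro continuous_intros)
  have "(\<integral>x. indicator K x *\<^sub>R (- (x \<bullet> u)) \<partial>lborel) = 0"
    using mean by (simp add: set_lebesgue_integral_def)
  moreover have "AE x in lborel. 0 \<le> indicator K x *\<^sub>R (- (x \<bullet> u))"
    using a \<open>\<not> 0 < a\<close> by (force simp: indicator_def)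
  ultimately have "AE x in lborel. indicator K x *\<^sub>R (- (x \<bullet> u)) = 0"
    using integral_nonneg_eq_0_iff_AE[OF int] by blast
  moreover have "indicator K x *\<^sub>R (- (x \<bullet> u)) \<noteq> 0" if "x \<in> interior K" for x
  proof -
    have "x \<in> K" using that interior_subset by blast
    then show ?thesis using interior_height_less[OF that u a] \<open>\<not> 0 < a\<close> by simp
  qed
  ultimately have "AE x in lborel. x \<notin> interior K" by (auto elim!: eventually_mono)
  then have "emeasure lborel (interior K) = 0"
    by (subst (asm) AE_iff_measurable[of "interior K"]) auto
  then show False using emeasure_open_pos[OF open_interior K(2)] by simp
qed

text \<open>
  The cylinders over the two faces and over the middle section are in the position of the equality
  case of the Brunn-Minkowski inequality. Both cylinders occupy the heights \<open>[0, 1]\<close>, so the translation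
  between them is horizontal and relates their bases.
\<close>

lemma prism_faces_translate:
  fixes K :: "'a::euclidean_space set"
  assumes K: "compact K" "convex K" and u: "norm u = 1" and w: "0 < w"
    and pos: "0 < section_vol K u c"
    and eq: "section_vol K u (c + w) = section_vol K u c" "section_vol K u (c + w / 2) = section_vol K u c"
  obtains l where "l \<bullet> u = w" "K \<inter> {x. x \<bullet> u = c + w} = (\<lambda>x. x + l) ` (K \<inter> {x. x \<bullet> u = c})"
proof -
  have uu: "u \<bullet> u = 1" using u by (simp add: dot_square_norm)
  let ?A = "section_cyl K u c" and ?B = "section_cyl K u (c + w)" and ?M = "section_cyl K u (c + w / 2)"
  obtain l where l: "?B = (\<lambda>x. x + l) ` ?A"
  proof (rule brunn_minkowski_equality[of ?A ?B ?M])
    fix x y assume x: "x \<in> ?A" and y: "y \<in> ?B"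
    have "(1/2) *\<^sub>R (x + (c - x \<bullet> u) *\<^sub>R u) + (1/2) *\<^sub>R (y + (c + w - y \<bullet> u) *\<^sub>R u) \<in> K"
      using x y by (intro convexD[OF K(2)]) (simp_all add: section_cyl_def)
    moreover have "(1/2) *\<^sub>R (x + (c - x \<bullet> u) *\<^sub>R u) + (1/2) *\<^sub>R (y + (c + w - y \<bullet> u) *\<^sub>R u)
        = ((1/2) *\<^sub>R x + (1/2) *\<^sub>R y) + (c + w / 2 - ((1/2) *\<^sub>R x + (1/2) *\<^sub>R y) \<bullet> u) *\<^sub>R u"
    proof -
      have "((1/2) * (c - x \<bullet> u)) *\<^sub>R u + ((1/2) * (c + w - y \<bullet> u)) *\<^sub>R u
          = (c + w / 2 - ((1/2) *\<^sub>R x + (1/2) *\<^sub>R y) \<bullet> u) *\<^sub>R u"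
        unfolding scaleR_add_left[symmetric] by (simp add: inner_add_left field_simps)
      then show ?thesis by (simp add: scaleR_add_right)
    qed
    ultimately show "(1/2) *\<^sub>R x + (1/2) *\<^sub>R y \<in> ?M"
      using x y by (simp add: section_cyl_def inner_add_left)
  qed (use K u pos eq in \<open>simp_all add: convex_section_cyl compact_section_cyl section_vol_def\<close>)
  have "?A \<noteq> {}" using pos by (auto simp: section_vol_def)
  then obtain z where "z \<in> ?A" by blast
  \<comment> \<open>\<open>z0\<close> and \<open>z0 + u\<close> lie at the heights 0 and 1, which forces \<open>l\<close> to be horizontal\<close>
  define z0 where "z0 = z - (z \<bullet> u) *\<^sub>R u"
  have z0: "z0 \<in> ?A" "z0 + u \<in> ?A" "z0 \<bullet> u = 0"
    using \<open>z \<in> ?A\<close> by (simp_all add: section_cyl_def z0_def inner_diff_left inner_add_left uu algebra_simps)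
  then have "z0 + l \<in> ?B" "z0 + u + l \<in> ?B" using l by auto
  then have "0 \<le> (z0 + l) \<bullet> u" "(z0 + u + l) \<bullet> u \<le> 1" by (auto simp: section_cyl_def)
  then have lu: "l \<bullet> u = 0" using z0(3) by (simp add: inner_add_left uu)
  show ?thesis
  proof
    show "(l + w *\<^sub>R u) \<bullet> u = w" by (simp add: inner_add_left lu uu)
    show "K \<inter> {x. x \<bullet> u = c + w} = (\<lambda>x. x + (l + w *\<^sub>R u)) ` (K \<inter> {x. x \<bullet> u = c})"
    proof (intro equalityI subsetI)
      fix y assume y: "y \<in> K \<inter> {x. x \<bullet> u = c + w}"
      then have "y - (c + w) *\<^sub>R u \<in> ?B" by (simp add: section_cyl_def inner_diff_left uu)
      then obtain x where x: "x \<in> ?A" "y - (c + w) *\<^sub>R u = x + l" using l by blast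
      then have y_eq: "y = x + l + (c + w) *\<^sub>R u" by (metis diff_add_cancel)
      have "x \<bullet> u = 0" using y lu by (simp add: y_eq inner_add_left uu)
      then have "x + c *\<^sub>R u \<in> K \<inter> {x. x \<bullet> u = c}"
        using x by (simp add: section_cyl_def inner_add_left uu)
      moreover have "y = (x + c *\<^sub>R u) + (l + w *\<^sub>R u)" by (simp add: y_eq algebra_simps)
      ultimately show "y \<in> (\<lambda>x. x + (l + w *\<^sub>R u)) ` (K \<inter> {x. x \<bullet> u = c})" by blast
    next
      fix y assume "y \<in> (\<lambda>x. x + (l + w *\<^sub>R u)) ` (K \<inter> {x. x \<bullet> u = c})"
      then obtain x where x: "x \<in> K" "x \<bullet> u = c" "y = x + (l + w *\<^sub>R u)" by blast
      then have "x - c *\<^sub>R u \<in> ?A" by (simp add: section_cyl_def inner_diff_left uu)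
      then have "x - c *\<^sub>R u + l \<in> ?B" using l by blast
      then have "x - c *\<^sub>R u + l + (c + w) *\<^sub>R u \<in> K"
        using x lu by (simp add: section_cyl_def inner_diff_left inner_add_left uu)
      moreover have "x - c *\<^sub>R u + l + (c + w) *\<^sub>R u = y" by (simp add: x algebra_simps)
      ultimately show "y \<in> K \<inter> {x. x \<bullet> u = c + w}" using x lu by (simp add: inner_add_left uu)
    qed
  qed
qed

lemma constant_profile_midpoint:
  fixes f :: "real \<Rightarrow> real"
  assumes concave: "concave_on {0..1} f"
    and k: "0 \<le> k" "f 0 = k" "f 1 = k" and m: "0 < m"
    and int: "((\<lambda>s. f s ^ m) has_integral V) {0..1}" "((\<lambda>s. k ^ m) has_integral V) {0..1::real}"
  shows "f (1 / 2) = k"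
proof -
  note conc = concave_unit_intervalD[OF concave]
  have ge: "k \<le> f s" if "0 \<le> s" "s \<le> 1" for s
    using conc[of 0 1 s] that k by (simp add: algebra_simps)
  show ?thesis
  proof (rule ccontr)
    assume "f (1 / 2) \<noteq> k"
    then have e: "0 < f (1 / 2) - k" using ge[of "1 / 2"] by simp
    define e where "e = (f (1 / 2) - k) / 2"
    have e0: "0 < e" using e by (simp add: e_def)
    have "0 < V - V"
    proof (rule integral_step_pos[OF has_integral_diff[OF int], of "1 / 2" "3 / 4" "e ^ m"])
      fix s :: real assume s: "0 \<le> s" "s \<le> 1"
      show "0 \<le> f s ^ m - k ^ m" using power_mono[OF ge[OF s] k(1)] by simp
    next
      fix s :: real assume s: "1 / 2 \<le> s" "s \<le> 3 / 4"
      have "(1 - (2 * s - 1)) * f (1 / 2) + (2 * s - 1) * f 1 \<le> f ((1 - (2 * s - 1)) * (1 / 2) + (2 * s - 1) * 1)"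
        using s by (intro conc) auto
      then have "(2 - 2 * s) * f (1 / 2) + (2 * s - 1) * k \<le> f s" by (simp add: k algebra_simps)
      moreover have "(2 - 2 * s) * f (1 / 2) + (2 * s - 1) * k = k + (2 - 2 * s) * (2 * e)"
      proof -
        have "z = k + 2 * ((z - k) / 2)" for z by (simp add: field_simps)
        from this[of "f (1 / 2)"] have fe: "f (1 / 2) = k + 2 * e" by (simp only: e_def)
        show ?thesis unfolding fe by (simp add: algebra_simps)
      qed
      moreover have "1 / 2 * (2 * e) \<le> (2 - 2 * s) * (2 * e)" using s e0 by (intro mult_right_mono) auto
      ultimately have "e \<le> f s - k" by simp
      then have "e ^ m \<le> (f s - k) ^ m" using e0 by (intro power_mono) auto
      also have "\<dots> \<le> f s ^ m - k ^ m" using k ge[of s] s m by (intro power_diff_ge) auto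
      finally show "e ^ m \<le> f s ^ m - k ^ m" .
    qed (use e0 in auto)
    then show False by simp
  qed
qed

text \<open>
  The hull is contained in \<open>K\<close>. Its profile is concave and at the ends at least as large as the affine
  function \<open>f0 + (f1 - f0) s\<close>, hence so everywhere, and its volume is at least that of \<open>K\<close>.
\<close>

lemma eq_convex_hull_of_linear_profile:
  fixes K :: "'a::euclidean_space set"
  assumes K: "compact K" "convex K" "interior K \<noteq> {}" and u: "norm u = 1" and dim: "2 \<le> DIM('a)" and w: "0 < w"
    and range: "\<And>x. x \<in> K \<Longrightarrow> c \<le> x \<bullet> u \<and> x \<bullet> u \<le> c + w"
    and Q: "compact Q" "Q \<noteq> {}" "Q \<subseteq> K \<inter> {x. x \<bullet> u = c}"
    and q: "q \<in> K" "q \<bullet> u = c + w"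
    and f0: "0 \<le> f0" "f0 ^ (DIM('a) - 1) \<le> w * section_vol Q u c"
    and f1: "0 \<le> f1" "f1 ^ (DIM('a) - 1) = w * section_vol K u (c + w)"
    and lin: "((\<lambda>s. (f0 + (f1 - f0) * s) ^ (DIM('a) - 1)) has_integral measure lborel K) {0..1}"
  shows "convex hull ((K \<inter> {x. x \<bullet> u = c + w}) \<union> Q) = K"
proof -
  let ?m = "DIM('a) - 1"
  have m: "0 < ?m" using dim by simp
  let ?F = "K \<inter> {x. x \<bullet> u = c + w}"
  define C where "C = convex hull (?F \<union> Q)"
  have F: "compact ?F" by (intro compact_Int_closed K closed_Collect_eq continuous_intros)
  have C: "compact C" "convex C" unfolding C_def
    using F Q by (auto intro: compact_convex_hull compact_Un)
  have sub: "?F \<union> Q \<subseteq> C" unfolding C_def by (rule hull_subset)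
  have CK: "C \<subseteq> K" unfolding C_def using K(2) Q by (intro hull_minimal) auto
  obtain p where p: "p \<in> Q" using Q by blast
  define f where "f s = root ?m (w * section_vol C u (c + w * s))" for s
  have pC: "p \<in> C" "p \<bullet> u = c" and qC: "q \<in> C" using p Q q sub by auto
  have rangeC: "c \<le> x \<bullet> u \<and> x \<bullet> u \<le> c + w" if "x \<in> C" for x using range CK that by blast
  note prof = section_profile[OF C u dim w rangeC pC qC q(2), folded f_def]
  have top: "section_vol C u (c + w) = section_vol K u (c + w)"
  proof -
    have "C \<inter> {x. x \<bullet> u = c + w} = K \<inter> {x. x \<bullet> u = c + w}" using sub CK by blast
    from section_cyl_slice_cong[OF u this] show ?thesis by (simp only: section_vol_def)
  qed
  have bottom: "section_vol Q u c \<le> section_vol C u c"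
  proof -
    have "section_cyl Q u c \<subseteq> section_cyl C u c" using sub unfolding section_cyl_def by blast
    then have "emeasure lborel (section_cyl Q u c) \<le> emeasure lborel (section_cyl C u c)"
      using borel_compact[OF compact_section_cyl[OF C(1) u]] by (intro emeasure_mono) auto
    then show ?thesis using Q C u by (simp add: emeasure_section_cyl)
  qed
  have pow_le: "a \<le> b" if "a ^ ?m \<le> b ^ ?m" "0 \<le> b" for a b :: real
    using power_strict_mono[of b a ?m] that m by (meson not_le)
  have "f 1 ^ ?m = f1 ^ ?m" using prof(3)[of 1] top f1 by simp
  then have e1: "f1 \<le> f 1" using prof(2)[of 1] pow_le[of f1 "f 1"] by simp
  have "w * section_vol Q u c \<le> w * section_vol C u c" using bottom w by (intro mult_left_mono) auto
  then have "f0 ^ ?m \<le> f 0 ^ ?m" using prof(3)[of 0] f0 by simp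
  then have e0: "f0 \<le> f 0" using prof(2)[of 0] by (rule pow_le)
  have "measure lborel K \<le> measure lborel C"
  proof (rule has_integral_le[OF lin prof(4)])
    fix s :: real assume "s \<in> {0..1}"
    then have s: "0 \<le> s" "s \<le> 1" by auto
    have "f0 + (f1 - f0) * s = (1 - s) * f0 + s * f1" by (simp add: algebra_simps)
    also have "\<dots> \<le> (1 - s) * f 0 + s * f 1" using s e0 e1 by (intro add_mono mult_left_mono) auto
    also have "\<dots> \<le> f ((1 - s) * 0 + s * 1)" using s by (intro concave_unit_intervalD prof(1)) auto
    finally have "f0 + (f1 - f0) * s \<le> f s" by simp
    moreover have "0 \<le> (1 - s) * f0 + s * f1" using s f0 f1 by simp
    ultimately show "(f0 + (f1 - f0) * s) ^ ?m \<le> f s ^ ?m"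
      by (intro power_mono) (simp_all add: algebra_simps)
  qed
  then have "C = K" by (rule compact_convex_eq_of_measure_ge[OF C(1) CK K])
  then show ?thesis by (simp add: C_def)
qed

definition is_prism_or_cone :: "'a::euclidean_space set \<Rightarrow> 'a \<Rightarrow> bool" where
  "is_prism_or_cone K u \<longleftrightarrow> (\<exists>H P. hyperplane_perp u H \<and> convex_body_in H P \<and>
     ((\<exists>l. l \<bullet> u \<noteq> 0 \<and> K = convex hull (P \<union> (\<lambda>x. x + l) ` P)) \<or>
      (\<exists>p. p \<notin> H \<and> K = convex hull (P \<union> {p}))))"

lemma is_prism_or_cone_uminus: "is_prism_or_cone K (- u) \<longleftrightarrow> is_prism_or_cone K u"
proof -
  have flip: "hyperplane_perp (- v) H" if v: "hyperplane_perp v H" for v :: 'a and H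
  proof -
    obtain b where b: "v \<noteq> 0" "H = {x. x \<bullet> v = b}" using v unfolding hyperplane_perp_def by blast
    have "H = {x. x \<bullet> (- v) = - b}" unfolding b(2) by simp
    with b(1) show ?thesis unfolding hyperplane_perp_def neg_equal_0_iff_equal by blast
  qed
  have "hyperplane_perp (- u) H \<longleftrightarrow> hyperplane_perp u H" for H
    using flip[of u H] flip[of "- u" H] unfolding minus_minus by blast
  then show ?thesis by (simp add: is_prism_or_cone_def)
qed

text \<open>
  The case in which the origin is at least as far from the lower supporting hyperplane as
  from the upper one. It makes the comparison frustum widen upwards, with a ratio \<open>q \<le> 1\<close> between
  its lower and its upper end.
\<close>

lemma cone_volume_inequality_lower_half:
  fixes K :: "'a::euclidean_space set"
  assumes dim: "3 \<le> DIM('a)" and K: "convex_body K" and cen: "set_lebesgue_integral lborel K (\<lambda>x. x \<bullet> u) = 0"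
    and u: "norm u = 1"
    and p: "p \<in> K" "\<And>x. x \<in> K \<Longrightarrow> p \<bullet> u \<le> x \<bullet> u" and q: "q \<in> K" "\<And>x. x \<in> K \<Longrightarrow> x \<bullet> u \<le> q \<bullet> u"
    and half: "q \<bullet> u \<le> - (p \<bullet> u)"
  defines "n \<equiv> DIM('a)"
  defines "x \<equiv> real n * measure (cone_volume_measure K) {u} / measure lborel K"
    and "y \<equiv> real n * measure (cone_volume_measure K) {- u} / measure lborel K"
  shows "slab_functional n x y \<le> 1" and "slab_functional n x y = 1 \<Longrightarrow> is_prism_or_cone K u"
proof -
  have c: "compact K" "convex K" "interior K \<noteq> {}" using K by (auto simp: convex_body_def)
  let ?m = "n - 1"
  have n3: "3 \<le> n" and dim2: "2 \<le> DIM('a)" and m: "0 < ?m" using dim by (auto simp: n_def)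
  define a where "a = q \<bullet> u"
  define b where "b = - (p \<bullet> u)"
  define w where "w = a + b"
  define V where "V = measure lborel K"
  define \<beta> where "\<beta> = b / w"
  have a: "0 < a" unfolding a_def by (rule centered_support_pos[OF c(1,3) u q(2) cen])
  have ab: "a \<le> b" using half by (simp add: a_def b_def)
  have w: "0 < w" using a ab by (simp add: w_def)
  have V: "0 < V" unfolding V_def by (rule measure_interior_pos[OF c(1,3)])
  have \<beta>: "1 / 2 \<le> \<beta>" "\<beta> < 1" "1 - \<beta> = a / w"
    using a ab w by (auto simp: \<beta>_def w_def field_simps)
  have range: "- b \<le> z \<bullet> u \<and> z \<bullet> u \<le> - b + w" if "z \<in> K" for z
    using p(2)[OF that] q(2)[OF that] by (simp add: a_def b_def w_def)
  have ends: "p \<bullet> u = - b" "q \<bullet> u = - b + w" by (simp_all add: a_def b_def w_def)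
  define f where "f s = root ?m (w * section_vol K u (- b + w * s))" for s
  note profile = section_profile[OF c(1,2) u dim2 w range p(1) ends(1) q(1) ends(2), folded n_def, folded f_def V_def]
  have prof:
    "concave_on {0..1} f"
    "\<And>s. 0 \<le> f s" "\<And>s. f s ^ ?m = w * section_vol K u (- b + w * s)"
    "((\<lambda>s. f s ^ ?m) has_integral V) {0..1}"
    by (rule profile; assumption)+
  have f_ends: "f 0 ^ ?m = w * section_vol K u (- b)" "f 1 ^ ?m = w * section_vol K u a"
    using prof(3)[of 0] prof(3)[of 1] by (simp_all add: w_def)
  have mean: "((\<lambda>s. s * f s ^ ?m) has_integral \<beta> * V) {0..1}"
  proof -
    have "set_lebesgue_integral lborel K (\<lambda>x. (x \<bullet> u - - b) / w) = \<beta> * V"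
    proof -
      have "set_integrable lborel K (\<lambda>x. x \<bullet> u)" "set_integrable lborel K (\<lambda>x. b)"
        unfolding set_integrable_def by (intro borel_integrable_compact c continuous_intros)+
      then have "set_lebesgue_integral lborel K (\<lambda>x. x \<bullet> u + b) = set_lebesgue_integral lborel K (\<lambda>x. b)"
        using set_integral_add(2)[of lborel K "\<lambda>x. x \<bullet> u" "\<lambda>x. b"] cen by simp
      also have "\<dots> = b * V"
        using borel_compact[OF c(1)] by (simp add: set_lebesgue_integral_def V_def)
      finally show ?thesis by (simp add: \<beta>_def)
    qed
    moreover have "((\<lambda>s. s * (w * section_vol K u (- b + w * s))) has_integral
        set_lebesgue_integral lborel K (\<lambda>x. (x \<bullet> u - - b) / w)) {0..1}"
      by (rule section_integral[OF c(1) u w range]) auto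
    ultimately have "((\<lambda>s. s * (w * section_vol K u (- b + w * s))) has_integral \<beta> * V) {0..1}"
      by simp
    moreover have "w * section_vol K u (- b + w * s) = f s ^ ?m" for s
      using prof(3)[of s] by simp
    ultimately show ?thesis by simp
  qed
  have mu: "real n * measure (cone_volume_measure K) {u} \<le> a * section_vol K u a"
    unfolding n_def by (rule cone_volume_le_section[OF K u dim2]) (use q a in \<open>auto simp: a_def\<close>)
  have mu': "real n * measure (cone_volume_measure K) {- u} \<le> b * section_vol K (- u) b"
    unfolding n_def by (rule cone_volume_le_section[OF K _ dim2]) (use p u a ab in \<open>auto simp: b_def intro!: bexI[of _ p]\<close>)
  have x: "0 \<le> x" "x \<le> (1 - \<beta>) * f 1 ^ ?m / V"
  proof -
    show "0 \<le> x" using V by (simp add: x_def V_def)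
    have "(1 - \<beta>) * f 1 ^ ?m = a * section_vol K u a" using w unfolding f_ends by (simp add: \<beta>(3))
    then show "x \<le> (1 - \<beta>) * f 1 ^ ?m / V" using mu V by (simp add: x_def V_def divide_right_mono)
  qed
  have y: "0 \<le> y" "y \<le> \<beta> * f 0 ^ ?m / V"
  proof -
    show "0 \<le> y" using V by (simp add: y_def V_def)
    have "\<beta> * f 0 ^ ?m = b * section_vol K (- u) b"
      using w unfolding f_ends by (simp add: \<beta>_def section_vol_uminus[OF c(1) u])
    then show "y \<le> \<beta> * f 0 ^ ?m / V" using mu' V by (simp add: y_def V_def divide_right_mono)
  qed
  note main = concave_profile_inequality[OF prof(1) prof(2) n3 prof(4) mean V \<beta>(1,2) x y]
  show "slab_functional n x y \<le> 1" by (rule main(1))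
  assume "slab_functional n x y = 1"
  from main(2)[OF this] have lin: "((\<lambda>s. (f 0 + (f 1 - f 0) * s) ^ ?m) has_integral V) {0..1}"
    and f01: "f 0 = 0 \<or> f 0 = f 1" by auto
  have hull: "convex hull ((K \<inter> {z. z \<bullet> u = - b + w}) \<union> Q) = K"
    if "compact Q" "Q \<noteq> {}" "Q \<subseteq> K \<inter> {z. z \<bullet> u = - b}" "f 0 ^ ?m \<le> w * section_vol Q u (- b)" for Q
    using that prof(2) f_ends lin
    by (intro eq_convex_hull_of_linear_profile[OF c u dim2 w range _ _ _ q(1) ends(2), of Q "f 0" "f 1"])
      (auto simp: n_def V_def w_def)
  show "is_prism_or_cone K u"
  proof (cases "f 0 = 0")
    case True
    have f1: "f 1 \<noteq> 0"
    proof
      assume "f 1 = 0"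
      then have "((\<lambda>s::real. 0::real) has_integral V) {0..1}" using lin True m by (simp add: zero_power)
      then show False using V has_integral_unique[OF has_integral_0] by fastforce
    qed
    then have "0 < section_vol K u a"
      using f_ends(2) w m section_vol_nonneg[of K u a] by (metis mult_zero_right order_le_less power_eq_0_iff)
    then have face: "convex_body_in {z. z \<bullet> u = a} (K \<inter> {z. z \<bullet> u = a})"
      by (rule face_convex_body_in[OF c(1,2) u])
    have "convex hull ((K \<inter> {z. z \<bullet> u = - b + w}) \<union> {p}) = K"
      using p(1) ends True w m by (intro hull) (auto simp: zero_power)
    then have "K = convex hull ((K \<inter> {z. z \<bullet> u = a}) \<union> {p})" by (simp add: w_def)
    moreover have "p \<notin> {z. z \<bullet> u = a}" using ends a ab by simp
    moreover have "hyperplane_perp u {z. z \<bullet> u = a}" using u by (auto simp: hyperplane_perp_def)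
    ultimately show ?thesis using face unfolding is_prism_or_cone_def by blast
  next
    case False
    with f01 have f1: "f 1 = f 0" by simp
    have f0: "0 < f 0" using False prof(2)[of 0] by simp
    have const: "((\<lambda>s. f 0 ^ ?m) has_integral V) {0..1::real}" using lin f1 by simp
    have "f (1 / 2) = f 0"
      by (rule constant_profile_midpoint[OF prof(1) _ refl f1 m prof(4) const]) (use f0 in auto)
    then have eqs: "section_vol K u (- b + w) = section_vol K u (- b)"
      "section_vol K u (- b + w / 2) = section_vol K u (- b)"
      using prof(3)[of 0] prof(3)[of 1] prof(3)[of "1 / 2"] f1 w by simp_all
    have "0 < f 0 ^ ?m" using f0 by simp
    then have pos: "0 < section_vol K u (- b)" using f_ends(1) w by (simp add: zero_less_mult_iff)
    obtain l where l: "l \<bullet> u = w" "K \<inter> {z. z \<bullet> u = - b + w} = (\<lambda>z. z + l) ` (K \<inter> {z. z \<bullet> u = - b})"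
      using prism_faces_translate[OF c(1,2) u w pos eqs] by blast
    let ?P = "K \<inter> {z. z \<bullet> u = - b}"
    have face: "convex_body_in {z. z \<bullet> u = - b} ?P"
      by (rule face_convex_body_in[OF c(1,2) u pos])
    have "section_vol ?P u (- b) = section_vol K u (- b)"
      unfolding section_vol_def by (subst section_cyl_slice_cong[OF u, of ?P _ K]) auto
    then have "convex hull ((K \<inter> {z. z \<bullet> u = - b + w}) \<union> ?P) = K"
      using p(1) ends face f_ends(1) by (intro hull) (auto simp: convex_body_in_def)
    then have "K = convex hull ((K \<inter> {z. z \<bullet> u = - b + w}) \<union> ?P)" by (rule sym)
    also have "(K \<inter> {z. z \<bullet> u = - b + w}) \<union> ?P = ?P \<union> (\<lambda>z. z + l) ` ?P"
      unfolding l(2) by (rule Un_commute)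
    finally have "K = convex hull (?P \<union> (\<lambda>z. z + l) ` ?P)" .
    moreover have "l \<bullet> u \<noteq> 0" using l(1) w by simp
    moreover have "hyperplane_perp u {z. z \<bullet> u = - b}" using u by (auto simp: hyperplane_perp_def)
    ultimately show ?thesis using face unfolding is_prism_or_cone_def by blast
  qed
qed

theorem theorem1:
  fixes K :: "(real ^ 'n) set" and \<mu> :: "real ^ 'n \<Rightarrow> real" and V :: real
  assumes "CARD('n) \<ge> 3"
    and "convex_body K"
    and "centroid K = 0"
    and \<mu>: "\<And>u. \<mu> u = measure (cone_volume_measure K) {u}"
    and V: "V = volume K"
  shows "\<forall>u \<in> sphere 0 1.
      real CARD('n) * ((\<mu> u + \<mu> (- u)) / V)
        + (real CARD('n) + 1) ^ (CARD('n) - 1) * \<bar>(\<mu> u - \<mu> (- u)) / V\<bar> ^ CARD('n) \<le> 1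
      \<and> (real CARD('n) * ((\<mu> u + \<mu> (- u)) / V)
          + (real CARD('n) + 1) ^ (CARD('n) - 1) * \<bar>(\<mu> u - \<mu> (- u)) / V\<bar> ^ CARD('n) = 1
        \<longrightarrow> (\<exists>H P. hyperplane_perp u H \<and> convex_body_in H P \<and>
              ((\<exists>l. l \<bullet> u \<noteq> 0 \<and> K = convex hull (P \<union> (\<lambda>x. x + l) ` P)) \<or>
               (\<exists>p. p \<notin> H \<and> K = convex hull (P \<union> {p})))))"
proof
  fix u :: "real ^ 'n" assume "u \<in> sphere 0 1"
  then have u: "norm u = 1" by simp
  let ?n = "CARD('n)"
  let ?x = "\<lambda>u. real ?n * \<mu> u / V"
  have c: "compact K" "convex K" "interior K \<noteq> {}" using assms(2) by (auto simp: convex_body_def)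
  have n: "3 \<le> DIM(real ^ 'n)" using assms(1) by simp
  have V0: "0 < measure lborel K" by (rule measure_interior_pos[OF c(1,3)])
  have zero: "set_lebesgue_integral lborel K (\<lambda>x. x) = 0"
    using assms(3) V0 by (simp add: centroid_def volume_def)
  have cen: "set_lebesgue_integral lborel K (\<lambda>x. x \<bullet> v) = 0" for v
  proof -
    have int: "set_integrable lborel K (\<lambda>x. x)"
      unfolding set_integrable_def by (intro borel_integrable_compact c continuous_intros)
    have "set_lebesgue_integral lborel K (\<lambda>x. x \<bullet> v) = (\<integral>x. (indicator K x *\<^sub>R x) \<bullet> v \<partial>lborel)"
      by (simp add: set_lebesgue_integral_def)
    also have "\<dots> = (\<integral>x. indicator K x *\<^sub>R x \<partial>lborel) \<bullet> v"
      using int unfolding set_integrable_def by (rule integral_inner_left[rotated])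
    finally show ?thesis using zero by (simp add: set_lebesgue_integral_def)
  qed
  have half: "slab_functional ?n (?x v) (?x (- v)) \<le> 1 \<and> (slab_functional ?n (?x v) (?x (- v)) = 1 \<longrightarrow> is_prism_or_cone K v)"
    if v: "norm v = 1" and p: "p \<in> K" "\<And>x. x \<in> K \<Longrightarrow> p \<bullet> v \<le> x \<bullet> v"
      and q: "q \<in> K" "\<And>x. x \<in> K \<Longrightarrow> x \<bullet> v \<le> q \<bullet> v" and "q \<bullet> v \<le> - (p \<bullet> v)" for v p q
    using cone_volume_inequality_lower_half[OF n assms(2) cen v p q that(6)]
    by (simp add: \<mu> V volume_def)
  have "K \<noteq> {}" using c by auto
  have cont: "continuous_on K (\<lambda>x. x \<bullet> u)" by (intro continuous_intros)
  obtain q where q: "q \<in> K" "\<And>x. x \<in> K \<Longrightarrow> x \<bullet> u \<le> q \<bullet> u"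
    using continuous_attains_sup[OF c(1) \<open>K \<noteq> {}\<close> cont] by blast
  obtain p where p: "p \<in> K" "\<And>x. x \<in> K \<Longrightarrow> p \<bullet> u \<le> x \<bullet> u"
    using continuous_attains_inf[OF c(1) \<open>K \<noteq> {}\<close> cont] by blast
  have "slab_functional ?n (?x u) (?x (- u)) \<le> 1 \<and> (slab_functional ?n (?x u) (?x (- u)) = 1 \<longrightarrow> is_prism_or_cone K u)"
  proof (cases "q \<bullet> u \<le> - (p \<bullet> u)")
    case True
    then show ?thesis using half[OF u p q] by blast
  next
    case False
    then have "slab_functional ?n (?x (- u)) (?x (- (- u))) \<le> 1 \<and> (slab_functional ?n (?x (- u)) (?x (- (- u))) = 1 \<longrightarrow> is_prism_or_cone K (- u))"
      using p q u by (intro half[of "- u" q p]) auto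
    then show ?thesis by (simp add: is_prism_or_cone_uminus slab_functional_commute)
  qed
  moreover have "slab_functional ?n (?x u) (?x (- u)) = real ?n * ((\<mu> u + \<mu> (- u)) / V)
      + (real ?n + 1) ^ (?n - 1) * \<bar>(\<mu> u - \<mu> (- u)) / V\<bar> ^ ?n"
  proof -
    have "(?x u - ?x (- u)) / real ?n = (\<mu> u - \<mu> (- u)) / V"
      by (simp add: diff_divide_distrib)
    moreover have "?x u + ?x (- u) = real ?n * ((\<mu> u + \<mu> (- u)) / V)"
      by (simp add: add_divide_distrib distrib_left)
    ultimately show ?thesis by (simp only: slab_functional_def)
  qed
  ultimately show "real CARD('n) * ((\<mu> u + \<mu> (- u)) / V)
        + (real CARD('n) + 1) ^ (CARD('n) - 1) * \<bar>(\<mu> u - \<mu> (- u)) / V\<bar> ^ CARD('n) \<le> 1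
      \<and> (real CARD('n) * ((\<mu> u + \<mu> (- u)) / V)
          + (real CARD('n) + 1) ^ (CARD('n) - 1) * \<bar>(\<mu> u - \<mu> (- u)) / V\<bar> ^ CARD('n) = 1
        \<longrightarrow> (\<exists>H P. hyperplane_perp u H \<and> convex_body_in H P \<and>
              ((\<exists>l. l \<bullet> u \<noteq> 0 \<and> K = convex hull (P \<union> (\<lambda>x. x + l) ` P)) \<or>
               (\<exists>p. p \<notin> H \<and> K = convex hull (P \<union> {p})))))"
    unfolding is_prism_or_cone_def by simp
qed

end
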